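(* Let $\lambda>1$ and let $f:\mathbb R^2\setminus\{0\}\to\mathbb R$ satisfy $f(\lambda x)=\lambda^{-1}f(x)$. Let $\mathcal A=B_\lambda\setminus B_1=\{x\in\mathbb R^2:1\le|x|<\lambda\}$. If $f\in L^2(\mathcal A)$, then there exists a constant $C(\lambda)$ such that $$\frac1{C(\lambda)}\|f\|_{L^2(\mathcal A)}\le\|\nabla(e^{\Delta}f)\|_{L^2(\mathbb R^2)}\le C(\lambda)\|f\|_{L^2(\mathcal A)}.$$
   Context: $e^{\Delta}f$ is the heat semigroup at time $1$: $(e^{\Delta}f)(x)=\int_{\mathbb R^2}\frac1{4\pi}e^{-|x-z|^2/4}f(z)\,dz$. The constant $C(\lambda)$ depends only on $\lambda$ (not on $f$). *)

theory Defs
  imports "HOL-Analysis.Analysis"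
begin

definition in_L2 :: "'a::euclidean_space set \<Rightarrow> ('a \<Rightarrow> 'b::euclidean_space) \<Rightarrow> bool" where
  "in_L2 S g \<longleftrightarrow>
     set_borel_measurable lebesgue S g \<and> set_integrable lebesgue S (\<lambda>x. (norm (g x))\<^sup>2)"

text \<open>Meaningful only together with \<open>in_L2 S g\<close>: the Bochner integral of a
  non-integrable function is 0.\<close>

definition L2_norm_on :: "'a::euclidean_space set \<Rightarrow> ('a \<Rightarrow> 'b::euclidean_space) \<Rightarrow> real" where
  "L2_norm_on S g = sqrt (LINT x:S|lebesgue. (norm (g x))\<^sup>2)"

text \<open>Meaningful only where \<open>g\<close> is differentiable.\<close>

definition gradient :: "('a::euclidean_space \<Rightarrow> real) \<Rightarrow> 'a \<Rightarrow> 'a" where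
  "gradient g x = (THE D. GDERIV g x :> D)"

definition heat_kernel :: "real^2 \<Rightarrow> real" where
  "heat_kernel y = 1 / (4 * pi) * exp (- (norm y)\<^sup>2 / 4)"

text \<open>The heat semigroup in the plane at time 1.\<close>

definition heat :: "(real^2 \<Rightarrow> real) \<Rightarrow> real^2 \<Rightarrow> real" where
  "heat f x = (LINT z|lebesgue. heat_kernel (x - z) * f z)"

text \<open>A function on the punctured plane is represented by a total function whose value
  at the origin is left unconstrained; the origin is a null set, so that value does not
  affect \<open>heat f\<close>.\<close>

definition dss :: "real \<Rightarrow> (real^2 \<Rightarrow> real) \<Rightarrow> bool" where
  "dss l f \<longleftrightarrow> (\<forall>x. x \<noteq> 0 \<longrightarrow> f (l *\<^sub>R x) = inverse l * f x)"

definition annulus :: "real \<Rightarrow> (real^2) set" where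
  "annulus l = ball 0 l - ball 0 1"

end

theory Submission
  imports Defs "HOL-Probability.Distributions"
begin

text \<open>Write \<open>u t\<close> for the heat evolution of \<open>f\<close> and \<open>D t\<close> for the Dirichlet energy
\<open>\<integral>|grad u t|\<^sup>2\<close>. Self-similarity of \<open>f\<close> gives \<open>u (l\<^sup>2 t) (l x) = u t x / l\<close>, hence
\<open>D (l\<^sup>2 t) = D t / l\<^sup>2\<close>. Since \<open>grad u t\<close> is a Gaussian average of \<open>grad u s\<close> for \<open>s < t\<close>, the
function \<open>D\<close> is nonincreasing, so on a time interval \<open>[t, l\<^sup>2 t]\<close> it is comparable with \<open>D 1 / t\<close>.

The estimate itself is an energy balance over one period of the scaling. The measure
\<open>u\<^sup>2 dx\<close> is invariant under the parabolic scaling and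
\<open>\<partial>\<^sub>t u\<^sup>2 = \<Delta> u\<^sup>2 - 2 |grad u|\<^sup>2\<close>. On the half space \<open>t \<ge> 0\<close> without the space-time origin,
divided by the scaling, the divergence theorem leaves only the trace at \<open>t = 0\<close>; formally, the
integral of \<open>f\<^sup>2\<close> over the annulus \<open>A\<close> is twice the integral of \<open>D\<close> over \<open>[1, l\<^sup>2]\<close>. Both
inequalities follow from this and the comparison above.

To avoid integrals that converge only conditionally, the balance is localized with a cutoff
\<open>\<eta>\<close> equal to 1 on the unit ball and 0 outside the ball of radius \<open>l\<close>. For \<open>e t = \<integral>\<eta> u\<^sup>2\<close>,
scaling turns the drop \<open>e t - e (l\<^sup>2 t)\<close> into \<open>\<integral>\<psi> u\<^sup>2\<close> with \<open>\<psi> x = \<eta> x - \<eta> (l x)\<close>, a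
weight living on a closed annulus around the origin and satisfies \<open>\<integral>\<psi> f\<^sup>2 = \<integral>\<^sub>A f\<^sup>2\<close>
(\<open>energy_drop\<close>, \<open>integral_psi_sq\<close>). By the mean value theorem the drop is also
\<open>(l\<^sup>2 - 1) t\<close> times the dissipation \<open>- e' \<tau>\<close> at an intermediate time, and the dissipation
lies between \<open>1\<close> and \<open>3\<close> times the local Dirichlet energy, up to an error bounded by a multiple of
\<open>\<integral>u\<^sup>2\<close> over that annulus (\<open>energy_derivative_upper\<close>, \<open>energy_derivative_lower\<close>). Along \<open>t \<rightarrow> 0\<close> this error
stays bounded (\<open>hflow_L2_K\<close>) and is multiplied by \<open>t\<close>, so it disappears.

For the upper bound (\<open>dirichlet_upper\<close>) one rescales back to times in \<open>[1, l\<^sup>2]\<close> and applies Fatou's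
lemma. For the lower bound (\<open>dirichlet_lower\<close>) one needs that \<open>\<integral>\<psi> f\<^sup>2\<close> is at most the limit
of \<open>\<integral>\<psi> (u t)\<^sup>2\<close>, which follows from weak convergence (\<open>flow_L2_lower_semicontinuous\<close>).\<close>

section \<open>Affine changes of variables and the planar heat kernel\<close>

type_synonym plane = "real^2"

lemma nn_integral_lborel_affine:
  fixes f :: "'a::euclidean_space \<Rightarrow> ennreal"
  assumes [measurable]: "f \<in> borel_measurable borel" and "c \<noteq> 0"
  shows "(\<integral>\<^sup>+x. f x \<partial>lborel) = ennreal (\<bar>c\<bar> ^ DIM('a)) * (\<integral>\<^sup>+x. f (t + c *\<^sub>R x) \<partial>lborel)"
  by (subst lborel_affine[OF \<open>c \<noteq> 0\<close>, of t])
     (simp add: nn_integral_density nn_integral_distr nn_integral_cmult)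

lemma integrable_lborel_affine:
  fixes f :: "'a::euclidean_space \<Rightarrow> 'b::{banach, second_countable_topology}"
  assumes f: "integrable lborel f" and "c \<noteq> 0"
  shows "integrable lborel (\<lambda>x. f (t + c *\<^sub>R x))"
proof -
  have [measurable]: "f \<in> borel_measurable borel" using f by auto
  have "(\<integral>\<^sup>+x. ennreal (norm (f (t + c *\<^sub>R x))) \<partial>lborel) < \<infinity>"
  proof (rule ccontr)
    assume "\<not> ?thesis"
    then have "(\<integral>\<^sup>+x. ennreal (norm (f (t + c *\<^sub>R x))) \<partial>lborel) = \<infinity>" by (simp add: less_top[symmetric])
    then have "(\<integral>\<^sup>+x. ennreal (norm (f x)) \<partial>lborel) = \<infinity>"
      using \<open>c \<noteq> 0\<close> by (subst nn_integral_lborel_affine[OF _ \<open>c \<noteq> 0\<close>, of _ t]) (auto simp: ennreal_mult_top)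
    with f show False by (auto simp: integrable_iff_bounded)
  qed
  then show ?thesis by (auto simp: integrable_iff_bounded)
qed

lemma integral_lborel_affine:
  fixes f :: "'a::euclidean_space \<Rightarrow> 'b::{banach, second_countable_topology}"
  assumes "c \<noteq> 0" and [measurable]: "f \<in> borel_measurable borel"
  shows "(LINT x|lborel. f x) = \<bar>c\<bar> ^ DIM('a) *\<^sub>R (LINT x|lborel. f (t + c *\<^sub>R x))"
  by (subst lborel_affine[OF \<open>c \<noteq> 0\<close>, of t])
     (simp add: integral_density integral_distr)

lemma integral_lborel_translate:
  fixes f :: "'a::euclidean_space \<Rightarrow> 'b::{banach, second_countable_topology}"
  assumes [measurable]: "f \<in> borel_measurable borel"
  shows "(LINT x|lborel. f (x + v)) = (LINT x|lborel. f x)"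
  using integral_lborel_affine[of 1 f v] by (simp add: add.commute)

lemma nn_integral_lborel_translate:
  fixes f :: "'a::euclidean_space \<Rightarrow> ennreal"
  assumes [measurable]: "f \<in> borel_measurable borel"
  shows "(\<integral>\<^sup>+x. f (x - v) \<partial>lborel) = (\<integral>\<^sup>+x. f x \<partial>lborel)"
  using nn_integral_lborel_affine[of f 1 "-v"] by (simp add: add.commute)

text \<open>The heat kernel at time \<open>t\<close>; all times occur, because the self-similarity of the data relates
the flow at time 1 to the flow at arbitrarily small times.\<close>

definition hk :: "real \<Rightarrow> plane \<Rightarrow> real" where
  "hk t y = exp (- (norm y)\<^sup>2 / (4 * t)) / (4 * pi * t)"

lemma hk_measurable [measurable]: "hk t \<in> borel_measurable borel"
  unfolding hk_def[abs_def] by measurable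

lemma hk_pos: "t > 0 \<Longrightarrow> hk t y > 0"
  by (simp add: hk_def)

lemma hk_uminus [simp]: "hk t (- y) = hk t y"
  by (simp add: hk_def)

lemma hk_minus_commute: "hk t (x - y) = hk t (y - x)"
  by (simp add: hk_def norm_minus_commute)

lemma norm2_eq_sum: "(norm (y::'a::euclidean_space))\<^sup>2 = (\<Sum>b\<in>Basis. (y \<bullet> b)\<^sup>2)"
  by (subst power2_norm_eq_inner, subst euclidean_inner) (simp add: power2_eq_square)

text \<open>The planar Gaussian factorizes over the coordinates, which reduces its normalization to the
one-dimensional normal density.\<close>

lemma hk_eq_prod:
  assumes "t > 0"
  shows "hk t y = (\<Prod>b\<in>Basis. normal_density 0 (sqrt (2 * t)) (y \<bullet> b))"
proof -
  have "(\<Prod>b\<in>Basis. normal_density 0 (sqrt (2 * t)) (y \<bullet> b))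
     = (\<Prod>b\<in>(Basis::plane set). 1 / sqrt (4 * pi * t)) * (\<Prod>b\<in>Basis. exp (- (y \<bullet> b)\<^sup>2 / (4 * t)))"
    using assms by (subst prod.distrib[symmetric]) (simp add: normal_density_def mult_ac)
  also have "(\<Prod>b\<in>(Basis::plane set). 1 / sqrt (4 * pi * t)) = 1 / (4 * pi * t)"
    using assms by (simp add: power_divide)
  also have "(\<Prod>b\<in>Basis. exp (- (y \<bullet> b)\<^sup>2 / (4 * t))) = exp (- (norm y)\<^sup>2 / (4 * t))"
    by (simp add: exp_sum[symmetric] norm2_eq_sum sum_negf[symmetric] sum_divide_distrib)
  finally show ?thesis by (simp add: hk_def)
qed

lemma nn_integral_hk:
  assumes "t > 0"
  shows "(\<integral>\<^sup>+y. ennreal (hk t (y - m)) \<partial>lborel) = 1"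
proof -
  have "(\<integral>\<^sup>+y. ennreal (hk t (y - m)) \<partial>lborel) = (\<integral>\<^sup>+y. ennreal (hk t y) \<partial>lborel)"
    by (rule nn_integral_lborel_translate) measurable
  also have "\<dots> = (\<integral>\<^sup>+(y::plane). (\<Prod>b\<in>Basis. ennreal (normal_density 0 (sqrt (2 * t)) (y \<bullet> b))) \<partial>lborel)"
    using assms by (simp add: hk_eq_prod prod_ennreal)
  also have "\<dots> = (\<Prod>b\<in>(Basis::plane set). (\<integral>\<^sup>+x. ennreal (normal_density 0 (sqrt (2 * t)) x) \<partial>lborel))"
    by (rule nn_integral_lborel_prod) auto
  also have "(\<integral>\<^sup>+x. ennreal (normal_density 0 (sqrt (2 * t)) x) \<partial>lborel) = 1"
    using assms by (subst nn_integral_eq_integral) auto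
  finally show ?thesis by simp
qed

lemma integrable_hk: "t > 0 \<Longrightarrow> integrable lborel (\<lambda>y. hk t (y - m))"
  and integral_hk: "t > 0 \<Longrightarrow> (LINT y|lborel. hk t (y - m)) = 1"
proof -
  assume t: "t > 0"
  then have "has_bochner_integral lborel (\<lambda>y. hk t (y - m)) 1"
    by (intro has_bochner_integral_nn_integral) (auto simp: nn_integral_hk less_imp_le[OF hk_pos])
  then show "integrable lborel (\<lambda>y. hk t (y - m))" "(LINT y|lborel. hk t (y - m)) = 1"
    by (auto dest: has_bochner_integral_integral_eq integrable.intros)
qed

lemma power2_norm_diff: "(norm (a - b :: 'a::real_inner))\<^sup>2 = (norm a)\<^sup>2 - 2 * (a \<bullet> b) + (norm b)\<^sup>2"
  by (simp add: power2_norm_eq_inner inner_diff inner_commute)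

lemma power2_norm_scaleR: "(norm (c *\<^sub>R a))\<^sup>2 = c\<^sup>2 * (norm a)\<^sup>2"
  by (simp add: power_mult_distrib)

text \<open>Completing the square: as a function of \<open>p\<close>, the product of two Gaussians is again a Gaussian,
centred at the weighted mean of the two centres. Both the semigroup law and its version for
gradients are integrals of this identity.\<close>

lemma hk_product:
  assumes "r > 0" "s > 0"
  shows "hk r (x - p) * hk s p = hk (r + s) x * hk (r * s / (r + s)) (p - (s / (r + s)) *\<^sub>R x)"
proof -
  have "(norm (x - p))\<^sup>2 / (4 * r) + (norm p)\<^sup>2 / (4 * s)
      = (norm x)\<^sup>2 / (4 * (r + s)) + (norm (p - (s / (r + s)) *\<^sub>R x))\<^sup>2 / (4 * (r * s / (r + s)))"
    unfolding power2_norm_diff power2_norm_scaleR inner_scaleR_right inner_commute[of p x]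
    using assms add_pos_pos[OF assms] by (simp add: divide_simps) (simp add: algebra_simps power2_eq_square power3_eq_cube)
  then have "exp (- (norm (x - p))\<^sup>2 / (4 * r)) * exp (- (norm p)\<^sup>2 / (4 * s))
      = exp (- (norm x)\<^sup>2 / (4 * (r + s))) * exp (- (norm (p - (s / (r + s)) *\<^sub>R x))\<^sup>2 / (4 * (r * s / (r + s))))"
    by (simp add: exp_add[symmetric])
  moreover have "(4 * pi * r) * (4 * pi * s) = (4 * pi * (r + s)) * (4 * pi * (r * s / (r + s)))"
    using assms by (simp add: divide_simps)
  ultimately show ?thesis
    unfolding hk_def times_divide_times_eq by presburger
qed

section \<open>Dependence of integrals on parameters\<close>

text \<open>Dominated convergence along sequences; domination is only asked for on a neighbourhood of the
parameter, since the kernels below have no bound that is uniform down to time 0.\<close>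

lemma isCont_integral_dominated:
  fixes k :: "'p::{first_countable_topology, t2_space} \<Rightarrow> 'z \<Rightarrow> 'b::{banach, second_countable_topology}"
  assumes U: "open U" "p0 \<in> U"
    and meas: "\<And>p. p \<in> U \<Longrightarrow> k p \<in> borel_measurable M"
    and w: "integrable M w"
    and bound: "\<And>p z. p \<in> U \<Longrightarrow> z \<in> space M \<Longrightarrow> norm (k p z) \<le> w z"
    and cont: "\<And>z. z \<in> space M \<Longrightarrow> isCont (\<lambda>p. k p z) p0"
  shows "isCont (\<lambda>p. LINT z|M. k p z) p0"
  unfolding isCont_def tendsto_at_iff_sequentially
proof (intro allI impI, unfold comp_def)
  fix X :: "nat \<Rightarrow> 'p" assume X: "X \<longlonglongrightarrow> p0"
  then have ev: "eventually (\<lambda>n. X n \<in> U) sequentially"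
    using U by (rule topological_tendstoD)
  then obtain N where N: "\<And>n. n \<ge> N \<Longrightarrow> X n \<in> U" by (auto simp: eventually_sequentially)
  have "(\<lambda>n. LINT z|M. k (X (n + N)) z) \<longlonglongrightarrow> (LINT z|M. k p0 z)"
  proof (rule integral_dominated_convergence[OF meas[OF U(2)] meas w])
    show "X (n + N) \<in> U" for n by (rule N) simp
    show "AE z in M. (\<lambda>n. k (X (n + N)) z) \<longlonglongrightarrow> k p0 z"
      by (intro AE_I2 isCont_tendsto_compose[OF cont] LIMSEQ_ignore_initial_segment X)
    show "AE z in M. norm (k (X (n + N)) z) \<le> w z" for n
      using bound N[of "n + N"] by auto
  qed
  then show "(\<lambda>n. LINT z|M. k (X n) z) \<longlonglongrightarrow> (LINT z|M. k p0 z)"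
    by (rule LIMSEQ_offset)
qed

text \<open>By the mean value inequality the difference quotients minus the candidate derivative are
bounded by \<open>2 w\<close>, and they tend to 0 pointwise. The quotient is given the value 0 at the base
point, where it is then continuous, so that the previous lemma applies to it.\<close>

lemma has_derivative_integral_dominated:
  fixes k :: "'p::real_normed_vector \<Rightarrow> 'z \<Rightarrow> 'b::{banach, second_countable_topology}"
  assumes U: "open U" "convex U" "p0 \<in> U"
    and int: "\<And>p. p \<in> U \<Longrightarrow> integrable M (k p)"
    and meas': "\<And>h. (\<lambda>z. k' p0 z h) \<in> borel_measurable M"
    and w: "integrable M w" and w_nonneg: "\<And>z. 0 \<le> w z"
    and bound: "\<And>p z h. p \<in> U \<Longrightarrow> z \<in> space M \<Longrightarrow> norm (k' p z h) \<le> w z * norm h"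
    and deriv: "\<And>p z. p \<in> U \<Longrightarrow> z \<in> space M \<Longrightarrow> ((\<lambda>p. k p z) has_derivative k' p z) (at p)"
  shows "((\<lambda>p. LINT z|M. k p z) has_derivative (\<lambda>h. LINT z|M. k' p0 z h)) (at p0)"
proof -
  have lin: "linear (k' p0 z)" if "z \<in> space M" for z
    using deriv[OF U(3) that] has_derivative_linear by blast
  have int': "integrable M (\<lambda>z. k' p0 z h)" for h
    by (rule Bochner_Integration.integrable_bound[OF integrable_mult_left[OF w, of "norm h"] meas'])
       (auto intro!: AE_I2 order_trans[OF bound[OF U(3)]])
  \<comment> \<open>The value at \<open>p = p0\<close> is 0, because the inverse of 0 is 0.\<close>
  define R where "R p z = (k p z - k p0 z - k' p0 z (p - p0)) /\<^sub>R norm (p - p0)" for p z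
  have "isCont (\<lambda>p. LINT z|M. R p z) p0"
  proof (rule isCont_integral_dominated[OF U(1,3) _ integrable_mult_right[OF w, of 2]])
    fix p assume p: "p \<in> U"
    show "R p \<in> borel_measurable M"
      unfolding R_def using int[OF p] int[OF U(3)] meas' by measurable
    fix z assume z: "z \<in> space M"
    have "norm (k p z - k p0 z) \<le> w z * norm (p - p0)"
    proof (rule differentiable_bound[OF U(2) _ _ p U(3)])
      show "((\<lambda>p. k p z) has_derivative k' q z) (at q within U)" if "q \<in> U" for q
        using deriv[OF that z] by (rule has_derivative_at_withinI)
      show "onorm (k' q z) \<le> w z" if "q \<in> U" for q
        using bound[OF that z] by (intro onorm_bound w_nonneg)
    qed
    then have "norm (k p z - k p0 z - k' p0 z (p - p0)) \<le> 2 * w z * norm (p - p0)"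
      using norm_triangle_ineq4[of "k p z - k p0 z" "k' p0 z (p - p0)"] bound[OF U(3) z, of "p - p0"] by linarith
    then show "norm (R p z) \<le> 2 * w z"
      using w_nonneg[of z] by (cases "p = p0") (auto simp: R_def divide_simps mult.commute)
  next
    fix z assume z: "z \<in> space M"
    from deriv[OF U(3) z] show "isCont (\<lambda>p. R p z) p0"
      by (simp add: has_derivative_at_within isCont_def R_def)
  qed
  then have lim: "((\<lambda>p. LINT z|M. R p z) \<longlongrightarrow> 0) (at p0)"
    by (simp add: isCont_def R_def)
  have eq: "(LINT z|M. R p z) = ((LINT z|M. k p z) - (LINT z|M. k p0 z) - (LINT z|M. k' p0 z (p - p0))) /\<^sub>R norm (p - p0)"
    if "p \<in> U" for p
    unfolding R_def using int[OF that] int[OF U(3)] int' by simp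
  have "((\<lambda>p. ((LINT z|M. k p z) - (LINT z|M. k p0 z) - (LINT z|M. k' p0 z (p - p0))) /\<^sub>R norm (p - p0)) \<longlongrightarrow> 0) (at p0)"
  proof (rule Lim_transform_eventually[OF lim])
    have "eventually (\<lambda>p. p \<in> U) (at p0)"
      using U by (intro eventually_at_in_open') auto
    then show "eventually (\<lambda>p. (LINT z|M. R p z) = ((LINT z|M. k p z) - (LINT z|M. k p0 z) - (LINT z|M. k' p0 z (p - p0))) /\<^sub>R norm (p - p0)) (at p0)"
      by eventually_elim (rule eq)
  qed
  moreover have "bounded_linear (\<lambda>h. LINT z|M. k' p0 z h)"
  proof (rule bounded_linear_intro[where K = "LINT z|M. w z"])
    fix h1 h2 :: 'p and r :: real
    show "(LINT z|M. k' p0 z (h1 + h2)) = (LINT z|M. k' p0 z h1) + (LINT z|M. k' p0 z h2)"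
      by (subst Bochner_Integration.integral_add[OF int' int', symmetric])
         (auto intro!: Bochner_Integration.integral_cong simp: linear_add[OF lin])
    show "(LINT z|M. k' p0 z (r *\<^sub>R h1)) = r *\<^sub>R (LINT z|M. k' p0 z h1)"
    proof -
      have "(LINT z|M. k' p0 z (r *\<^sub>R h1)) = (LINT z|M. r *\<^sub>R k' p0 z h1)"
        by (rule Bochner_Integration.integral_cong) (auto simp: linear_cmul[OF lin])
      then show ?thesis by simp
    qed
    have "norm (LINT z|M. k' p0 z h1) \<le> (LINT z|M. w z * norm h1)"
      by (rule order_trans[OF integral_norm_bound integral_mono])
         (use int' w bound[OF U(3)] in auto)
    then show "norm (LINT z|M. k' p0 z h1) \<le> norm h1 * (LINT z|M. w z)"
      by (simp add: mult.commute)
  qed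
  ultimately show ?thesis
    by (simp add: has_derivative_at_within)
qed

section \<open>Derivatives of the heat kernel and a common majorant\<close>

lemma le_one_plus_sq: "0 \<le> a \<Longrightarrow> (a::real) \<le> 1 + a\<^sup>2"
  using zero_le_power2[of "a - 1"] by (simp add: power2_diff del: zero_le_power2)

lemma one_plus_le_exp:
  fixes c s :: real
  assumes "c > 0" "s \<ge> 0"
  shows "1 + s \<le> (1 + 1 / c) * exp (c * s)"
proof -
  have "1 + s \<le> (1 + 1 / c) * (1 + c * s)"
    using assms by (simp add: field_simps)
  also have "\<dots> \<le> (1 + 1 / c) * exp (c * s)"
    using assms by (intro mult_left_mono exp_ge_add_one_self) auto
  finally show ?thesis .
qed

lemma norm_diff_sq_ge: "(norm (x - z :: 'a::real_inner))\<^sup>2 \<ge> (norm z)\<^sup>2 / 2 - (norm x)\<^sup>2"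
proof -
  have "0 \<le> (norm (2 *\<^sub>R x - z))\<^sup>2" by simp
  then show ?thesis
    by (simp add: power2_norm_diff power2_norm_scaleR)
qed

text \<open>One majorant for the heat kernel and all its derivatives that occur, so that a single
decay estimate serves to dominate all of them.\<close>

definition hk_major :: "real \<Rightarrow> plane \<Rightarrow> real" where
  "hk_major t y = hk t y * (1 + (norm y)\<^sup>2) * (2 + 2 / t + 2 / t\<^sup>2)"

text \<open>For bounded \<open>x\<close> and times in a compact subinterval of the half line, giving up part of the
Gaussian rate absorbs the polynomial factors and then the shift by \<open>x\<close>.\<close>

lemma hk_major_decay:
  assumes "0 < a" "a \<le> b"
  shows "\<exists>C c. C \<ge> 0 \<and> c > 0 \<and> (\<forall>t x z. a \<le> t \<longrightarrow> t \<le> b \<longrightarrow> norm x \<le> M \<longrightarrow>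
           hk_major t (x - z) \<le> C * exp (- c * (norm z)\<^sup>2))"
proof -
  let ?m = "2 + 2 / a + 2 / a\<^sup>2"
  define C where "C = ?m * (1 + 8 * b) * exp (M\<^sup>2 / (8 * b)) / (4 * pi * a)"
  have "hk_major t (x - z) \<le> C * exp (- (1 / (16 * b)) * (norm z)\<^sup>2)"
    if t: "a \<le> t" "t \<le> b" and x: "norm x \<le> M" for t x z
  proof -
    define s where "s = (norm (x - z))\<^sup>2"
    have s: "s \<ge> 0" "s \<ge> (norm z)\<^sup>2 / 2 - M\<^sup>2"
      using norm_diff_sq_ge[of z x] power_mono[OF x, of 2] by (auto simp: s_def)
    have t0: "t > 0" and b0: "b > 0" using t assms by auto
    have "hk t (x - z) \<le> exp (- s / (4 * b)) / (4 * pi * a)"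
      unfolding hk_def s_def[symmetric] using t t0 assms s
      by (intro frac_le) (auto simp: divide_simps mult_left_mono)
    moreover have "1 + s \<le> (1 + 8 * b) * exp (s / (8 * b))"
      using one_plus_le_exp[of "1 / (8 * b)" s] b0 s by simp
    moreover have "2 + 2 / t + 2 / t\<^sup>2 \<le> 2 + 2 / a + 2 / a\<^sup>2"
      using t assms by (intro add_mono frac_le) (auto intro!: power_mono)
    ultimately have "hk_major t (x - z) \<le>
        exp (- s / (4 * b)) / (4 * pi * a) * ((1 + 8 * b) * exp (s / (8 * b))) * ?m"
      unfolding hk_major_def s_def[symmetric] using t t0 b0 assms s hk_pos[OF t0, of "x - z"]
      by (intro mult_mono) (auto intro!: mult_nonneg_nonneg add_nonneg_nonneg)
    also have "\<dots> = ?m * (1 + 8 * b) / (4 * pi * a) * exp (- s / (8 * b))"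
    proof -
      have "exp (- s / (4 * b)) * exp (s / (8 * b)) = exp (- s / (8 * b))"
        using b0 by (simp add: exp_add[symmetric] field_simps)
      then show ?thesis by (simp add: mult_ac)
    qed
    also have "\<dots> \<le> ?m * (1 + 8 * b) / (4 * pi * a) *
                      exp (M\<^sup>2 / (8 * b) + - (1 / (16 * b)) * (norm z)\<^sup>2)"
      using s b0 assms by (intro mult_left_mono) (auto simp: field_simps)
    also have "\<dots> = C * exp (- (1 / (16 * b)) * (norm z)\<^sup>2)"
      unfolding C_def exp_add by simp
    finally show ?thesis .
  qed
  moreover have "C \<ge> 0" "1 / (16 * b) > 0" using assms by (auto simp: C_def)
  ultimately show ?thesis by blast
qed

definition grad_hk :: "real \<Rightarrow> plane \<Rightarrow> plane" where
  "grad_hk t y = (- hk t y / (2 * t)) *\<^sub>R y"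

definition dt_hk :: "real \<Rightarrow> plane \<Rightarrow> real" where
  "dt_hk t y = hk t y * ((norm y)\<^sup>2 / (4 * t\<^sup>2) - 1 / t)"

definition hess_hk :: "real \<Rightarrow> plane \<Rightarrow> plane \<Rightarrow> plane" where
  "hess_hk t y h = hk t y *\<^sub>R (((y \<bullet> h) / (4 * t\<^sup>2)) *\<^sub>R y - (1 / (2 * t)) *\<^sub>R h)"

lemma grad_hk_measurable [measurable]: "grad_hk t \<in> borel_measurable borel"
  unfolding grad_hk_def[abs_def] by measurable
lemma dt_hk_measurable [measurable]: "dt_hk t \<in> borel_measurable borel"
  unfolding dt_hk_def[abs_def] by measurable
lemma hess_hk_measurable [measurable]: "(\<lambda>y. hess_hk t y h) \<in> borel_measurable borel"
  unfolding hess_hk_def[abs_def] by measurable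

lemma hk_has_derivative:
  assumes t: "t > 0"
  shows "((\<lambda>p. hk (snd p) (fst p)) has_derivative
           (\<lambda>q. grad_hk t y \<bullet> fst q + dt_hk t y * snd q)) (at (y, t))"
  unfolding hk_def grad_hk_def dt_hk_def power2_norm_eq_inner
  using t
  by (auto intro!: derivative_eq_intros simp: fun_eq_iff inner_commute divide_simps power2_eq_square)
     (simp add: algebra_simps)

lemma grad_hk_has_derivative:
  assumes t: "t > 0"
  shows "(grad_hk t has_derivative hess_hk t y) (at y)"
proof -
  have 1: "(hk t has_derivative (\<lambda>h. grad_hk t y \<bullet> h)) (at y)"
    unfolding hk_def[abs_def] grad_hk_def power2_norm_eq_inner
    using t
    by (auto intro!: derivative_eq_intros simp: fun_eq_iff inner_commute divide_simps power2_eq_square)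
  show ?thesis
    unfolding grad_hk_def[abs_def] hess_hk_def[abs_def] using t
    by (auto intro!: derivative_eq_intros 1 simp: fun_eq_iff algebra_simps grad_hk_def power2_eq_square)
qed

text \<open>The kernel solves the heat equation: the trace of the Hessian is the time derivative.\<close>

lemma sum_hess_hk:
  assumes "t > 0"
  shows "(\<Sum>b\<in>Basis. hess_hk t y b \<bullet> b) = dt_hk t y"
proof -
  have "(\<Sum>b\<in>Basis. hess_hk t y b \<bullet> b)
      = hk t y * ((\<Sum>b\<in>Basis. (y \<bullet> b)\<^sup>2) / (4 * t\<^sup>2) - (\<Sum>b\<in>(Basis::plane set). 1 / (2 * t)))"
    unfolding sum_divide_distrib sum_subtractf[symmetric] sum_distrib_left
    by (rule sum.cong) (auto simp: hess_hk_def inner_diff_left power2_eq_square)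
  then show ?thesis by (simp add: dt_hk_def norm2_eq_sum)
qed

text \<open>The left-hand side collects the factors that multiply the heat kernel in its first space
derivative, its second space derivative and its time derivative.\<close>

lemma kernel_factors_le:
  assumes t: "t > 0"
  shows "(norm (y::plane)) / (2 * t) + (norm y)\<^sup>2 / (4 * t\<^sup>2) + 1 / t \<le> (1 + (norm y)\<^sup>2) * (2 + 2 / t + 2 / t\<^sup>2)"
proof -
  define s r where "s = norm y" and "r = 1 / t"
  have s: "s \<ge> 0" and r: "r \<ge> 0" using t by (auto simp: s_def r_def)
  have "s * r \<le> (1 + s\<^sup>2) * r" by (rule mult_right_mono[OF le_one_plus_sq[OF s] r])
  moreover have "s\<^sup>2 * r\<^sup>2 \<le> (1 + s\<^sup>2) * r\<^sup>2" "1 * r \<le> (1 + s\<^sup>2) * r"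
    using r by (intro mult_right_mono; simp)+
  moreover have "0 \<le> s * r" "0 \<le> s\<^sup>2 * r\<^sup>2" "0 \<le> 1 + s\<^sup>2" using s r by auto
  moreover have "p / 2 + q / 4 + r \<le> 2 * w + 2 * X + 2 * Y"
    if "p \<le> X" "q \<le> Y" "1 * r \<le> X" "0 \<le> p" "0 \<le> q" "0 \<le> w" for p q w X Y
    using that by linarith
  ultimately have "s * r / 2 + s\<^sup>2 * r\<^sup>2 / 4 + r \<le> 2 * (1 + s\<^sup>2) + 2 * ((1 + s\<^sup>2) * r) + 2 * ((1 + s\<^sup>2) * r\<^sup>2)"
    by blast
  then show ?thesis
    unfolding s_def r_def by (simp add: algebra_simps power_divide add_divide_distrib)
qed

lemma hk_le_major: "t > 0 \<Longrightarrow> norm (hk t y) \<le> hk_major t y"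
proof -
  assume t: "t > 0"
  have "1 * 1 \<le> (1 + (norm y)\<^sup>2) * (2 + 2 / t + 2 / t\<^sup>2)"
    using t by (intro mult_mono) (auto intro: add_increasing2)
  then show ?thesis using hk_pos[OF t, of y] mult_left_mono[of 1 _ "hk t y"]
    by (simp add: hk_major_def mult.assoc)
qed

lemma grad_dt_hk_le_major:
  assumes t: "t > 0"
  shows "norm (grad_hk t y) + norm (dt_hk t y) \<le> hk_major t y"
proof -
  have "norm (grad_hk t y) = hk t y * (norm y / (2 * t))"
    using t hk_pos[OF t, of y] by (simp add: grad_hk_def)
  moreover have "norm (dt_hk t y) \<le> hk t y * ((norm y)\<^sup>2 / (4 * t\<^sup>2) + 1 / t)"
    unfolding dt_hk_def norm_mult using t hk_pos[OF t, of y]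
    by (auto intro!: mult_left_mono simp: abs_le_iff)
  ultimately have "norm (grad_hk t y) + norm (dt_hk t y) \<le> hk t y * ((norm y) / (2 * t) + (norm y)\<^sup>2 / (4 * t\<^sup>2) + 1 / t)"
    by (simp add: algebra_simps)
  also have "\<dots> \<le> hk_major t y"
    unfolding hk_major_def mult.assoc using hk_pos[OF t, of y] by (intro mult_left_mono kernel_factors_le t) auto
  finally show ?thesis .
qed

lemma hess_hk_le_major:
  assumes t: "t > 0"
  shows "norm (hess_hk t y h) \<le> hk_major t y * norm h"
proof -
  let ?m = "(1 + (norm y)\<^sup>2) * (2 + 2 / t + 2 / t\<^sup>2)"
  let ?v = "((y \<bullet> h) / (4 * t\<^sup>2)) *\<^sub>R y - (1 / (2 * t)) *\<^sub>R h"
  have "norm (?v)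
      \<le> \<bar>y \<bullet> h\<bar> / (4 * t\<^sup>2) * norm y + 1 / (2 * t) * norm h"
    using t by (intro order_trans[OF norm_triangle_ineq4]) simp
  also have "\<dots> \<le> (norm y * norm h) / (4 * t\<^sup>2) * norm y + 1 / t * norm h"
    using t by (intro add_mono mult_right_mono divide_right_mono Cauchy_Schwarz_ineq2 frac_le) auto
  also have "\<dots> = ((norm y)\<^sup>2 / (4 * t\<^sup>2) + 1 / t) * norm h"
    by (simp add: algebra_simps power2_eq_square)
  also have "\<dots> \<le> ?m * norm h"
  proof (rule mult_right_mono)
    have "norm y / (2 * t) \<ge> 0" using t by simp
    then show "(norm y)\<^sup>2 / (4 * t\<^sup>2) + 1 / t \<le> (1 + (norm y)\<^sup>2) * (2 + 2 / t + 2 / t\<^sup>2)"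
      using kernel_factors_le[OF t, of y] by linarith
  qed simp
  finally have "norm (?v)
      \<le> ?m * norm h" .
  from mult_left_mono[OF this, of "hk t y"] show ?thesis
    using hk_pos[OF t, of y] by (simp add: hess_hk_def hk_major_def mult.assoc)
qed

section \<open>The heat flow of Gaussian-integrable data\<close>

definition hflow :: "(plane \<Rightarrow> real) \<Rightarrow> real \<Rightarrow> plane \<Rightarrow> real" where
  "hflow f t x = (LINT z|lborel. f z * hk t (x - z))"

definition hgrad :: "(plane \<Rightarrow> real) \<Rightarrow> real \<Rightarrow> plane \<Rightarrow> plane" where
  "hgrad f t x = (LINT z|lborel. f z *\<^sub>R grad_hk t (x - z))"

definition hlap :: "(plane \<Rightarrow> real) \<Rightarrow> real \<Rightarrow> plane \<Rightarrow> real" where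
  "hlap f t x = (LINT z|lborel. f z * dt_hk t (x - z))"

definition hhess :: "(plane \<Rightarrow> real) \<Rightarrow> real \<Rightarrow> plane \<Rightarrow> plane \<Rightarrow> plane" where
  "hhess f t x h = (LINT z|lborel. f z *\<^sub>R hess_hk t (x - z) h)"

text \<open>Self-similar data are only locally integrable, with mass growing linearly in the radius.
Integrability against every Gaussian is all that smoothness of the flow requires.\<close>

locale gauss_integrable =
  fixes f :: "plane \<Rightarrow> real"
  assumes f_measurable [measurable]: "f \<in> borel_measurable borel"
    and f_integrable: "\<And>c. c > 0 \<Longrightarrow> integrable lborel (\<lambda>z. exp (- c * (norm z)\<^sup>2) * f z)"
begin

text \<open>The box around \<open>(x0, t0)\<close> is an arbitrary choice that keeps \<open>t\<close> away from 0.\<close>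

lemma dominating_weight:
  assumes t: "t0 > 0"
  obtains w where "integrable lborel w" "\<And>z. 0 \<le> w z"
    "\<And>x t z. norm (x - x0) < 1 \<Longrightarrow> t0 / 2 < t \<Longrightarrow> t < 2 * t0 \<Longrightarrow> \<bar>f z\<bar> * hk_major t (x - z) \<le> w z"
proof -
  obtain C c where C: "C \<ge> 0" "c > 0"
    "\<And>t x z. t0 / 2 \<le> t \<Longrightarrow> t \<le> 2 * t0 \<Longrightarrow> norm x \<le> norm x0 + 1 \<Longrightarrow>
           hk_major t (x - z) \<le> C * exp (- c * (norm z)\<^sup>2)"
    using hk_major_decay[of "t0 / 2" "2 * t0" "norm x0 + 1"] t by auto
  define w where "w z = C * \<bar>exp (- c * (norm z)\<^sup>2) * f z\<bar>" for z
  have "integrable lborel w"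
    unfolding w_def by (intro integrable_mult_right integrable_abs f_integrable C)
  moreover have "\<bar>f z\<bar> * hk_major t (x - z) \<le> w z" if "norm (x - x0) < 1" "t0 / 2 < t" "t < 2 * t0" for x t z
  proof -
    have "norm x \<le> norm x0 + 1" using that(1) norm_triangle_ineq2[of x x0] by linarith
    then have "\<bar>f z\<bar> * hk_major t (x - z) \<le> \<bar>f z\<bar> * (C * exp (- c * (norm z)\<^sup>2))"
      using that by (intro mult_left_mono C) auto
    then show ?thesis by (simp add: w_def abs_mult mult_ac)
  qed
  moreover have "0 \<le> w z" for z using C by (simp add: w_def)
  ultimately show ?thesis using that by blast
qed

lemma integrable_hk_major_bound:
  fixes K :: "plane \<Rightarrow> 'b::{banach, second_countable_topology}"
  assumes t: "t > 0" and [measurable]: "K \<in> borel_measurable borel"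
    and K: "\<And>y. norm (K y) \<le> C * hk_major t y"
  shows "integrable lborel (\<lambda>z. f z *\<^sub>R K (x - z))"
proof -
  obtain w where w: "integrable lborel w" "\<And>z. 0 \<le> w z"
    "\<And>x' t' z. norm (x' - x) < 1 \<Longrightarrow> t / 2 < t' \<Longrightarrow> t' < 2 * t \<Longrightarrow> \<bar>f z\<bar> * hk_major t' (x' - z) \<le> w z"
    using dominating_weight[OF t, of x] by blast
  have C: "0 \<le> C"
  proof -
    have "hk_major t 0 > 0" using t by (simp add: hk_major_def hk_pos add_pos_nonneg)
    moreover have "0 \<le> C * hk_major t 0" using K[of 0] norm_ge_zero order_trans by blast
    ultimately show ?thesis by (simp add: zero_le_mult_iff)
  qed
  show ?thesis
  proof (rule Bochner_Integration.integrable_bound[OF integrable_mult_right[OF w(1), of C]])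
    have "norm (f z *\<^sub>R K (x - z)) \<le> norm (C * w z)" for z
    proof -
      have "norm (f z *\<^sub>R K (x - z)) \<le> \<bar>f z\<bar> * (C * hk_major t (x - z))"
        by (simp add: mult_left_mono K)
      also have "\<dots> \<le> C * w z"
        using mult_left_mono[OF w(3)[of x t z] C] t by (simp add: mult_ac)
      finally show ?thesis by simp
    qed
    then show "AE z in lborel. norm (f z *\<^sub>R K (x - z)) \<le> norm (C * w z)" by simp
  qed measurable
qed

lemma integrable_hk_times: "t > 0 \<Longrightarrow> integrable lborel (\<lambda>z. f z * hk t (x - z))"
  using integrable_hk_major_bound[of t "hk t" 1 x] hk_le_major[of t] by simp

lemma integrable_grad_hk_times: "t > 0 \<Longrightarrow> integrable lborel (\<lambda>z. f z *\<^sub>R grad_hk t (x - z))"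
proof -
  assume t: "t > 0"
  have "norm (grad_hk t y) \<le> 1 * hk_major t y" for y
    using grad_dt_hk_le_major[OF t, of y] norm_ge_zero[of "dt_hk t y"] by linarith
  then show ?thesis using integrable_hk_major_bound[of t "grad_hk t" 1 x] t by simp
qed

lemma integrable_dt_hk_times: "t > 0 \<Longrightarrow> integrable lborel (\<lambda>z. f z * dt_hk t (x - z))"
proof -
  assume t: "t > 0"
  have "norm (dt_hk t y) \<le> 1 * hk_major t y" for y
    using grad_dt_hk_le_major[OF t, of y] norm_ge_zero[of "grad_hk t y"] by linarith
  then show ?thesis using integrable_hk_major_bound[of t "dt_hk t" 1 x] t by simp
qed

lemma integrable_hess_hk_times: "t > 0 \<Longrightarrow> integrable lborel (\<lambda>z. f z *\<^sub>R hess_hk t (x - z) h)"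
  using hess_hk_le_major[of t _ h]
  by (intro integrable_hk_major_bound[of t "\<lambda>y. hess_hk t y h" "norm h" x]) (auto simp: mult.commute)

lemma continuous_on_convolution:
  fixes K :: "real \<Rightarrow> plane \<Rightarrow> 'b::{banach, second_countable_topology}"
  assumes [measurable]: "\<And>t. K t \<in> borel_measurable borel"
    and K: "\<And>t y. t > 0 \<Longrightarrow> norm (K t y) \<le> hk_major t y"
    and cont: "\<And>t y. t > 0 \<Longrightarrow> isCont (\<lambda>p. K (snd p) (fst p)) (y, t)"
  shows "continuous_on (UNIV \<times> {0<..}) (\<lambda>p. LINT z|lborel. f z *\<^sub>R K (snd p) (fst p - z))"
proof (intro continuous_at_imp_continuous_on ballI)
  fix p0 :: "plane \<times> real" assume "p0 \<in> UNIV \<times> {0<..}"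
  then obtain x0 t0 where p0: "p0 = (x0, t0)" and t0: "t0 > 0" by (cases p0) auto
  obtain w where w: "integrable lborel w" "\<And>z. 0 \<le> w z"
    "\<And>x t z. norm (x - x0) < 1 \<Longrightarrow> t0 / 2 < t \<Longrightarrow> t < 2 * t0 \<Longrightarrow> \<bar>f z\<bar> * hk_major t (x - z) \<le> w z"
    using dominating_weight[OF t0, of x0] by blast
  let ?U = "ball x0 1 \<times> {t0 / 2 <..< 2 * t0}"
  show "isCont (\<lambda>p. LINT z|lborel. f z *\<^sub>R K (snd p) (fst p - z)) p0"
  proof (rule isCont_integral_dominated[of ?U, OF _ _ _ w(1)])
    show "open ?U" by (intro open_Times) auto
    show "p0 \<in> ?U" using t0 by (simp add: p0)
    show "(\<lambda>z. f z *\<^sub>R K (snd p) (fst p - z)) \<in> borel_measurable lborel" for p by measurable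
    show "norm (f z *\<^sub>R K (snd p) (fst p - z)) \<le> w z" if "p \<in> ?U" for p z
    proof -
      have "norm (f z *\<^sub>R K (snd p) (fst p - z)) \<le> \<bar>f z\<bar> * hk_major (snd p) (fst p - z)"
        using that t0 by (auto intro!: mult_left_mono K)
      also have "\<dots> \<le> w z"
        using that by (intro w) (auto simp: dist_norm norm_minus_commute)
      finally show ?thesis .
    qed
    have "isCont (\<lambda>p. K (snd (fst p - z, snd p)) (fst (fst p - z, snd p))) p0" for z
      by (rule isCont_o2[where g = "\<lambda>p. K (snd p) (fst p)"])
         (auto intro!: continuous_intros cont t0 simp: p0)
    then show "isCont (\<lambda>p. f z *\<^sub>R K (snd p) (fst p - z)) p0" for z
      by (auto intro!: continuous_intros)
  qed
qed

lemma continuous_on_hflow: "continuous_on (UNIV \<times> {0<..}) (\<lambda>p. hflow f (snd p) (fst p))"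
proof -
  have "isCont (\<lambda>p. hk (snd p) (fst p)) (y, t)" if "t > 0" for y t
    using hk_has_derivative[OF that] by (rule has_derivative_continuous)
  then show ?thesis
    using continuous_on_convolution[of hk] hk_le_major by (simp add: hflow_def)
qed

lemma continuous_on_hgrad: "continuous_on (UNIV \<times> {0<..}) (\<lambda>p. hgrad f (snd p) (fst p))"
  unfolding hgrad_def
proof (rule continuous_on_convolution)
  fix t :: real and y assume t: "t > 0"
  show "norm (grad_hk t y) \<le> hk_major t y"
    using grad_dt_hk_le_major[OF t, of y] norm_ge_zero[of "dt_hk t y"] by linarith
  show "isCont (\<lambda>p. grad_hk (snd p) (fst p)) (y, t)"
    unfolding grad_hk_def hk_def using t by (auto intro!: continuous_intros)
qed simp

lemma continuous_on_hlap: "continuous_on (UNIV \<times> {0<..}) (\<lambda>p. hlap f (snd p) (fst p))"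
proof -
  have "norm (dt_hk t y) \<le> hk_major t y" if t: "t > 0" for t y
    using grad_dt_hk_le_major[OF t, of y] norm_ge_zero[of "grad_hk t y"] by linarith
  moreover have "isCont (\<lambda>p. dt_hk (snd p) (fst p)) (y, t)" if "t > 0" for y t
    unfolding dt_hk_def hk_def using that by (auto intro!: continuous_intros)
  ultimately show ?thesis
    using continuous_on_convolution[of dt_hk] by (simp add: hlap_def)
qed

text \<open>Differentiability in space and time jointly, which contains the spatial gradient, the time
derivative and joint continuity at once.\<close>

lemma hflow_has_derivative:
  assumes t0: "t0 > 0"
  shows "((\<lambda>p. hflow f (snd p) (fst p)) has_derivative (\<lambda>q. hgrad f t0 x0 \<bullet> fst q + hlap f t0 x0 * snd q)) (at (x0, t0))"
proof -
  let ?n = "\<lambda>p z q. norm (grad_hk (snd p) (fst p - z) \<bullet> fst q + dt_hk (snd p) (fst p - z) * snd q)"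
  obtain w where w: "integrable lborel w" "\<And>z. 0 \<le> w z"
    "\<And>x t z. norm (x - x0) < 1 \<Longrightarrow> t0 / 2 < t \<Longrightarrow> t < 2 * t0 \<Longrightarrow> \<bar>f z\<bar> * hk_major t (x - z) \<le> w z"
    using dominating_weight[OF t0, of x0] by blast
  let ?U = "ball x0 1 \<times> {t0 / 2 <..< 2 * t0}"
  let ?k' = "\<lambda>p z q. f z * (grad_hk (snd p) (fst p - z) \<bullet> fst q + dt_hk (snd p) (fst p - z) * snd q)"
  have "((\<lambda>p. LINT z|lborel. f z * hk (snd p) (fst p - z)) has_derivative
         (\<lambda>q. LINT z|lborel. ?k' (x0, t0) z q)) (at (x0, t0))"
  proof (rule has_derivative_integral_dominated[of ?U _ _ _ ?k', OF _ _ _ _ _ w(1,2)])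
    show "open ?U" by (intro open_Times) auto
    show "convex ?U" by (intro convex_Times) auto
    show "(x0, t0) \<in> ?U" using t0 by simp
    show "integrable lborel (\<lambda>z. f z * hk (snd p) (fst p - z))" if "p \<in> ?U" for p
      using that t0 by (intro integrable_hk_times) auto
    show "(\<lambda>z. ?k' (x0, t0) z h) \<in> borel_measurable lborel" for h by measurable
    show "norm (?k' p z q) \<le> w z * norm q" if "p \<in> ?U" for p z q
    proof -
      have pos: "snd p > 0" using that t0 by auto
      have nq: "norm (fst q) \<le> norm q" "norm (snd q) \<le> norm q"
        by (metis norm_fst_le norm_snd_le prod.collapse)+
      have "?n p z q
          \<le> norm (grad_hk (snd p) (fst p - z)) * norm (fst q) + norm (dt_hk (snd p) (fst p - z)) * norm (snd q)"
        using Cauchy_Schwarz_ineq2[of "grad_hk (snd p) (fst p - z)" "fst q"]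
        by (intro order_trans[OF norm_triangle_ineq]) (auto simp: abs_mult)
      also have "\<dots> \<le> (norm (grad_hk (snd p) (fst p - z)) + norm (dt_hk (snd p) (fst p - z))) * norm q"
        unfolding distrib_right
        by (intro add_mono mult_left_mono nq norm_ge_zero)
      also have "\<dots> \<le> hk_major (snd p) (fst p - z) * norm q"
        by (intro mult_right_mono grad_dt_hk_le_major pos) simp
      finally have "\<bar>f z\<bar> * ?n p z q
          \<le> \<bar>f z\<bar> * (hk_major (snd p) (fst p - z) * norm q)"
        by (rule mult_left_mono) simp
      also have "\<dots> \<le> w z * norm q"
        unfolding mult.assoc[symmetric] using that
        by (intro mult_right_mono w) (auto simp: dist_norm norm_minus_commute)
      finally show ?thesis by (simp add: abs_mult)
    qed
    show "((\<lambda>p. f z * hk (snd p) (fst p - z)) has_derivative ?k' p z) (at p)" if "p \<in> ?U" for p z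
    proof -
      have "snd p > 0" using that t0 by auto
      have 1: "((\<lambda>p. (fst p - z, snd p)) has_derivative (\<lambda>q. (fst q, snd q))) (at p)"
        by (auto intro!: derivative_eq_intros)
      have "((\<lambda>p. hk (snd (fst p - z, snd p)) (fst (fst p - z, snd p))) has_derivative
            (\<lambda>q. grad_hk (snd p) (fst p - z) \<bullet> fst (fst q, snd q) + dt_hk (snd p) (fst p - z) * snd (fst q, snd q))) (at p)"
        by (rule has_derivative_compose[OF 1 hk_has_derivative[OF \<open>snd p > 0\<close>]])
      then show ?thesis by (auto intro!: derivative_eq_intros)
    qed
  qed
  moreover have "(LINT z|lborel. ?k' (x0, t0) z q) = hgrad f t0 x0 \<bullet> fst q + hlap f t0 x0 * snd q" for q
  proof -
    have "hgrad f t0 x0 \<bullet> fst q + hlap f t0 x0 * snd q =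
       (LINT z|lborel. (f z *\<^sub>R grad_hk t0 (x0 - z)) \<bullet> fst q) + (LINT z|lborel. (f z * dt_hk t0 (x0 - z)) * snd q)"
      unfolding hgrad_def hlap_def
      by (subst integral_inner_left[OF integrable_grad_hk_times[OF t0]]) simp
    also have "\<dots> = (LINT z|lborel. (f z *\<^sub>R grad_hk t0 (x0 - z)) \<bullet> fst q + (f z * dt_hk t0 (x0 - z)) * snd q)"
      by (rule Bochner_Integration.integral_add[symmetric])
         (intro integrable_inner_left integrable_mult_left integrable_grad_hk_times integrable_dt_hk_times t0)+
    finally show ?thesis by (simp add: algebra_simps)
  qed
  ultimately show ?thesis by (simp add: hflow_def)
qed

lemma hflow_has_derivative_space:
  assumes "t > 0"
  shows "(hflow f t has_derivative (\<lambda>h. hgrad f t x \<bullet> h)) (at x)"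
proof -
  have 1: "((\<lambda>y. (y, t)) has_derivative (\<lambda>h. (h, 0))) (at x)"
    by (auto intro!: derivative_eq_intros)
  show ?thesis
    using has_derivative_compose[OF 1 hflow_has_derivative[OF assms]] by simp
qed

lemma hflow_has_derivative_time:
  assumes "t > 0"
  shows "((\<lambda>t. hflow f t x) has_real_derivative hlap f t x) (at t)"
proof -
  have 1: "((\<lambda>s. (x, s)) has_derivative (\<lambda>h. (0, h))) (at t)"
    by (auto intro!: derivative_eq_intros)
  show ?thesis
    using has_derivative_compose[OF 1 hflow_has_derivative[OF assms]]
    by (simp add: has_field_derivative_def)
qed

lemma hgrad_has_derivative:
  assumes t: "t > 0"
  shows "(hgrad f t has_derivative hhess f t x0) (at x0)"
proof -
  obtain w where w: "integrable lborel w" "\<And>z. 0 \<le> w z"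
    "\<And>x s z. norm (x - x0) < 1 \<Longrightarrow> t / 2 < s \<Longrightarrow> s < 2 * t \<Longrightarrow> \<bar>f z\<bar> * hk_major s (x - z) \<le> w z"
    using dominating_weight[OF t, of x0] by blast
  have "((\<lambda>x. LINT z|lborel. f z *\<^sub>R grad_hk t (x - z)) has_derivative
         (\<lambda>h. LINT z|lborel. f z *\<^sub>R hess_hk t (x0 - z) h)) (at x0)"
  proof (rule has_derivative_integral_dominated[of "ball x0 1" _ _ _ "\<lambda>x z h. f z *\<^sub>R hess_hk t (x - z) h", OF _ _ _ _ _ w(1,2)])
    show "integrable lborel (\<lambda>z. f z *\<^sub>R grad_hk t (x - z))" for x
      by (rule integrable_grad_hk_times[OF t])
    show "norm (f z *\<^sub>R hess_hk t (x - z) h) \<le> w z * norm h" if "x \<in> ball x0 1" for x z h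
    proof -
      have "norm (f z *\<^sub>R hess_hk t (x - z) h) \<le> \<bar>f z\<bar> * (hk_major t (x - z) * norm h)"
        by (simp add: mult_left_mono hess_hk_le_major[OF t])
      also have "\<dots> \<le> w z * norm h"
        unfolding mult.assoc[symmetric] using that t
        by (intro mult_right_mono w) (auto simp: dist_norm norm_minus_commute)
      finally show ?thesis .
    qed
    show "((\<lambda>x. f z *\<^sub>R grad_hk t (x - z)) has_derivative (\<lambda>h. f z *\<^sub>R hess_hk t (x - z) h)) (at x)" for x z
    proof -
      have 1: "((\<lambda>x. x - z) has_derivative (\<lambda>h. h)) (at x)" by (auto intro!: derivative_eq_intros)
      show ?thesis
        by (intro has_derivative_scaleR_right has_derivative_compose[OF 1 grad_hk_has_derivative[OF t]])
    qed
  qed auto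
  then show ?thesis by (simp add: hgrad_def[abs_def] hhess_def[abs_def])
qed

lemma heat_equation:
  assumes t: "t > 0"
  shows "(\<Sum>b\<in>Basis. hhess f t x b \<bullet> b) = hlap f t x"
proof -
  have "(\<Sum>b\<in>Basis. hhess f t x b \<bullet> b) = (\<Sum>b\<in>Basis. LINT z|lborel. (f z *\<^sub>R hess_hk t (x - z) b) \<bullet> b)"
    unfolding hhess_def by (intro sum.cong integral_inner_left[symmetric] integrable_hess_hk_times[OF t] refl)
  also have "\<dots> = (LINT z|lborel. (\<Sum>b\<in>Basis. (f z *\<^sub>R hess_hk t (x - z) b) \<bullet> b))"
    by (rule Bochner_Integration.integral_sum[symmetric]) (intro integrable_inner_left integrable_hess_hk_times[OF t])
  also have "\<dots> = (LINT z|lborel. f z * (\<Sum>b\<in>Basis. hess_hk t (x - z) b \<bullet> b))"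
    by (simp add: sum_distrib_left)
  finally show ?thesis by (simp add: sum_hess_hk[OF t] hlap_def)
qed

lemma hflow_cont: "t > 0 \<Longrightarrow> continuous_on S (hflow f t)"
  by (rule continuous_on_subset[of UNIV])
     (use hflow_has_derivative_space in \<open>auto intro!: continuous_at_imp_continuous_on has_derivative_continuous\<close>)

lemma hgrad_cont: "t > 0 \<Longrightarrow> continuous_on S (hgrad f t)"
  by (rule continuous_on_subset[of UNIV])
     (use hgrad_has_derivative in \<open>auto intro!: continuous_at_imp_continuous_on has_derivative_continuous\<close>)

lemma hlap_cont: "t > 0 \<Longrightarrow> continuous_on S (hlap f t)"
  by (rule continuous_on_compose2[OF continuous_on_hlap, of S "\<lambda>x. (x, t)", simplified])
     (auto intro!: continuous_intros)

lemma hhess_cont: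
  assumes b: "b \<in> Basis" and t: "t > 0"
  shows "continuous_on S (\<lambda>x. hhess f t x b)"
proof -
  have "continuous_on (UNIV \<times> {0<..}) (\<lambda>p. LINT z|lborel. f z *\<^sub>R hess_hk (snd p) (fst p - z) b)"
  proof (rule continuous_on_convolution)
    fix t :: real and y assume t: "t > 0"
    show "norm (hess_hk t y b) \<le> hk_major t y"
      using hess_hk_le_major[OF t, of y b] b by simp
    show "isCont (\<lambda>p. hess_hk (snd p) (fst p) b) (y, t)"
      unfolding hess_hk_def hk_def using t by (auto intro!: continuous_intros)
  qed simp
  then have "continuous_on S (\<lambda>x. LINT z|lborel. f z *\<^sub>R hess_hk (snd (x, t)) (fst (x, t) - z) b)"
    by (rule continuous_on_compose2) (use t in \<open>auto intro!: continuous_intros\<close>)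
  then show ?thesis by (simp add: hhess_def)
qed

end

section \<open>Integration by parts and the localized energy\<close>

lemma integrable_compact_support:
  fixes g :: "'a::euclidean_space \<Rightarrow> 'b::{banach, second_countable_topology}"
  assumes "continuous_on UNIV g" "\<And>x. norm x > R \<Longrightarrow> g x = 0"
  shows "integrable lborel g"
proof -
  have "integrable lborel (\<lambda>x. indicator (cball 0 R) x *\<^sub>R g x)"
    by (rule borel_integrable_compact) (auto intro: continuous_on_subset[OF assms(1)])
  also have "(\<lambda>x. indicator (cball 0 R) x *\<^sub>R g x) = g"
    using assms(2) by (auto simp: fun_eq_iff indicator_def not_le)
  finally show ?thesis .
qed

lemma integrable_indicator_bounded:
  "integrable lborel (\<lambda>x. B * indicator (cball (0::'a::euclidean_space) R) x :: real)"
  by (intro integrable_mult_right integrable_real_indicator emeasure_bounded_finite) auto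

text \<open>The integral of \<open>F\<close> is invariant under translation by \<open>p v\<close>. Differentiating this constant
function of \<open>p\<close> at 0 under the integral sign gives the claim, without iterated integrals
over coordinates.\<close>

lemma integral_directional_derivative_eq_0:
  fixes F :: "'a::euclidean_space \<Rightarrow> real"
  assumes deriv: "\<And>x. (F has_derivative F' x) (at x)"
    and cont: "continuous_on UNIV (\<lambda>x. F' x v)"
    and supp: "\<And>x. norm x > R \<Longrightarrow> F x = 0"
  shows "(LINT x|lborel. F' x v) = 0"
proof -
  have contF: "continuous_on UNIV F"
    using deriv by (auto intro!: continuous_at_imp_continuous_on has_derivative_continuous)
  have supp': "F' x v = 0" if x: "norm x > R" for x
  proof -
    have "open {x::'a. norm x > R}" by (intro open_Collect_less continuous_intros)
    then have "((\<lambda>_. 0::real) has_derivative F' x) (at x)"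
      using x supp by (intro has_derivative_transform_within_open[OF deriv]) auto
    then have "F' x = (\<lambda>_. 0)"
      using has_derivative_unique has_derivative_const by blast
    then show ?thesis by simp
  qed
  have "bounded ((\<lambda>x. F' x v) ` cball 0 R)"
    by (intro compact_imp_bounded compact_continuous_image) (auto intro: continuous_on_subset[OF cont])
  then obtain B where B: "B > 0" "\<And>x. norm x \<le> R \<Longrightarrow> \<bar>F' x v\<bar> \<le> B"
    unfolding bounded_pos by auto
  then have bd: "\<bar>F' x v\<bar> \<le> B * indicator (cball 0 R) x" for x
    using supp'[of x] by (auto simp: indicator_def)
  define R' where "R' = R + norm v"
  have "((\<lambda>p. LINT x|lborel. F (x + p *\<^sub>R v)) has_derivative (\<lambda>q. LINT x|lborel. q * F' (x + 0 *\<^sub>R v) v)) (at 0)"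
  proof (rule has_derivative_integral_dominated[of "ball 0 1" "0::real" lborel "\<lambda>p x. F (x + p *\<^sub>R v)"
        "\<lambda>p x q. q * F' (x + p *\<^sub>R v) v" "\<lambda>x. B * indicator (cball 0 R') x"])
    show "integrable lborel (\<lambda>x. F (x + p *\<^sub>R v))" if "p \<in> ball 0 1" for p
    proof (rule integrable_compact_support)
      show "continuous_on UNIV (\<lambda>x. F (x + p *\<^sub>R v))"
        by (rule continuous_on_compose2[OF contF]) (auto intro!: continuous_intros)
      show "F (x + p *\<^sub>R v) = 0" if "norm x > R + \<bar>p\<bar> * norm v" for x
        using norm_triangle_ineq2[of x "- (p *\<^sub>R v)"] that by (intro supp) simp
    qed
    show "(\<lambda>x. h * F' (x + 0 *\<^sub>R v) v) \<in> borel_measurable lborel" for h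
      using borel_measurable_continuous_onI[OF cont] by simp
    show "integrable lborel (\<lambda>x. B * indicator (cball 0 R') (x::'a) :: real)"
      by (rule integrable_indicator_bounded)
    show "0 \<le> B * indicator (cball 0 R') (x::'a)" for x using B(1) by simp
    show "norm (q * F' (x + p *\<^sub>R v) v) \<le> B * indicator (cball 0 R') x * norm q" if "p \<in> ball 0 1" for p x q
    proof -
      have "\<bar>p\<bar> * norm v \<le> norm v" using that by (simp add: mult_left_le_one_le)
      then have "(indicator (cball 0 R) (x + p *\<^sub>R v)::real) \<le> indicator (cball 0 R') x"
        using norm_triangle_ineq2[of x "- (p *\<^sub>R v)"] by (auto simp: indicator_def R'_def)
      then have "\<bar>F' (x + p *\<^sub>R v) v\<bar> \<le> B * indicator (cball 0 R') x"
        using bd[of "x + p *\<^sub>R v"] B(1) by (meson mult_left_mono less_imp_le order_trans)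
      then show ?thesis
        by (simp add: abs_mult mult.commute[of "\<bar>q\<bar>"] mult_right_mono)
    qed
    show "((\<lambda>p. F (x + p *\<^sub>R v)) has_derivative (\<lambda>q. q * F' (x + p *\<^sub>R v) v)) (at p)" for p x
    proof -
      have 1: "((\<lambda>p. x + p *\<^sub>R v) has_derivative (\<lambda>q. q *\<^sub>R v)) (at p)"
        by (auto intro!: derivative_eq_intros)
      have "((\<lambda>p. F (x + p *\<^sub>R v)) has_derivative (\<lambda>q. F' (x + p *\<^sub>R v) (q *\<^sub>R v))) (at p)"
        by (rule has_derivative_compose[OF 1 deriv])
      then show ?thesis
        by (simp add: linear_cmul[OF has_derivative_linear[OF deriv]])
    qed
  qed auto
  moreover have "(LINT x|lborel. F (x + p *\<^sub>R v)) = (LINT x|lborel. F x)" for p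
    using borel_measurable_continuous_onI[OF contF] by (rule integral_lborel_translate)
  ultimately have "((\<lambda>_. LINT x|lborel. F x) has_derivative (\<lambda>q. LINT x|lborel. q * F' x v)) (at 0)"
    by simp
  then have "(\<lambda>q. LINT x|lborel. q * F' x v) = (\<lambda>_. 0)"
    using has_derivative_unique has_derivative_const by blast
  from fun_cong[OF this, of 1] show ?thesis by simp
qed

text \<open>The bound on the gradient of the cutoff by its square root lets the cross term of the energy
computation be absorbed; it holds for squares of Lipschitz functions. Allowing \<open>d\<eta>\<close> to be
supported in a smaller set \<open>K\<close> matters, because near the origin the flow of self-similar data
is not controlled in \<open>L\<^sup>2\<close> uniformly for small times.\<close>

locale cutoff =
  fixes \<eta> :: "plane \<Rightarrow> real" and d\<eta> :: "plane \<Rightarrow> plane" and K :: "plane set" and R C :: real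
  assumes cutoff_deriv: "\<And>x. (\<eta> has_derivative (\<lambda>h. d\<eta> x \<bullet> h)) (at x)"
    and dcutoff_cont: "continuous_on UNIV d\<eta>"
    and cutoff_nonneg: "\<And>x. 0 \<le> \<eta> x"
    and cutoff_supp: "\<And>x. norm x > R \<Longrightarrow> \<eta> x = 0"
    and dcutoff_bound: "\<And>x. (norm (d\<eta> x))\<^sup>2 \<le> C * \<eta> x"
    and dcutoff_supp: "\<And>x. x \<notin> K \<Longrightarrow> d\<eta> x = 0"
    and K_compact: "compact K" and C_nonneg: "C \<ge> 0"
begin

lemma cutoff_cont: "continuous_on UNIV \<eta>"
  using cutoff_deriv by (auto intro!: continuous_at_imp_continuous_on has_derivative_continuous)

end

locale cutoff_flow = gauss_integrable f + cutoff \<eta> d\<eta> K R C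
  for f \<eta> d\<eta> K R C
begin

lemma integrable_cutoff_times:
  "continuous_on UNIV g \<Longrightarrow> integrable lborel (\<lambda>x. \<eta> x * g x :: real)"
  by (rule integrable_compact_support[of _ R]) (auto intro!: continuous_intros cutoff_cont simp: cutoff_supp)

lemma dcutoff_outside: "norm x > R \<Longrightarrow> d\<eta> x = 0"
  using dcutoff_bound[of x] cutoff_supp[of x] by simp

lemma integrable_cross_term: "t > 0 \<Longrightarrow> integrable lborel (\<lambda>x. hflow f t x * (d\<eta> x \<bullet> hgrad f t x))"
  by (rule integrable_compact_support[of _ R])
     (auto intro!: continuous_intros dcutoff_cont hflow_cont hgrad_cont simp: dcutoff_outside)

lemma integrable_local_dirichlet: "t > 0 \<Longrightarrow> integrable lborel (\<lambda>x. \<eta> x * (norm (hgrad f t x))\<^sup>2)"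
  by (intro integrable_cutoff_times continuous_intros hgrad_cont)

lemma energy_has_derivative:
  assumes t0: "t0 > 0"
  shows "((\<lambda>t. LINT x|lborel. \<eta> x * (hflow f t x)\<^sup>2) has_real_derivative
           (LINT x|lborel. 2 * (\<eta> x * (hflow f t0 x * hlap f t0 x)))) (at t0)"
proof -
  let ?U = "{t0 / 2 <..< 2 * t0}"
  let ?V = "cball (0::plane) R \<times> {t0 / 2 .. 2 * t0}"
  let ?g = "\<lambda>p. 2 * (\<eta> (fst p) * (hflow f (snd p) (fst p) * hlap f (snd p) (fst p)))"
  have V: "?V \<subseteq> UNIV \<times> {0<..}" using t0 by auto
  have "continuous_on ?V (\<lambda>p. \<eta> (fst p))"
    by (rule continuous_on_compose2[OF cutoff_cont]) (auto intro!: continuous_intros)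
  then have "continuous_on ?V ?g"
    by (intro continuous_intros continuous_on_subset[OF continuous_on_hflow V] continuous_on_subset[OF continuous_on_hlap V])
  then have "bounded (?g ` ?V)"
    by (intro compact_imp_bounded compact_continuous_image compact_Times) auto
  then obtain B where B: "B > 0" "\<And>p. p \<in> ?V \<Longrightarrow> \<bar>?g p\<bar> \<le> B"
    unfolding bounded_pos by (auto simp del: mem_Times_iff SigmaI)
  have "((\<lambda>t. LINT x|lborel. \<eta> x * (hflow f t x)\<^sup>2) has_derivative
          (\<lambda>q. LINT x|lborel. q * ?g (x, t0))) (at t0)"
  proof (rule has_derivative_integral_dominated[of ?U t0 lborel "\<lambda>t x. \<eta> x * (hflow f t x)\<^sup>2"
        "\<lambda>t x q. q * ?g (x, t)" "\<lambda>x. B * indicator (cball 0 R) x"])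
    show "integrable lborel (\<lambda>x. \<eta> x * (hflow f t x)\<^sup>2)" if "t \<in> ?U" for t
      using that t0 by (intro integrable_cutoff_times continuous_intros hflow_cont) auto
    show "(\<lambda>x. q * ?g (x, t0)) \<in> borel_measurable lborel" for q
      using cutoff_cont hflow_cont[OF t0] hlap_cont[OF t0]
      by (simp, intro borel_measurable_continuous_onI continuous_intros) auto
    show "norm (q * ?g (x, t)) \<le> B * indicator (cball 0 R) x * norm q" if t: "t \<in> ?U" for t x q
    proof (cases "norm x \<le> R")
      case True
      then have "\<bar>?g (x, t)\<bar> \<le> B" using t by (intro B) auto
      with True show ?thesis by (simp add: abs_mult mult.commute[of "\<bar>q\<bar>"] mult_right_mono)
    next
      case False
      then show ?thesis by (simp add: cutoff_supp)
    qed
    show "((\<lambda>t. \<eta> x * (hflow f t x)\<^sup>2) has_derivative (\<lambda>q. q * ?g (x, t))) (at t)" if "t \<in> ?U" for t x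
    proof -
      have "t > 0" using that t0 by auto
      have "((\<lambda>t. \<eta> x * (hflow f t x)\<^sup>2) has_real_derivative ?g (x, t)) (at t)"
        by (rule derivative_eq_intros hflow_has_derivative_time[OF \<open>t > 0\<close>] refl | simp)+
      then show ?thesis by (simp add: has_field_derivative_def mult_commute_abs)
    qed
    show "integrable lborel (\<lambda>x. B * indicator (cball (0::plane) R) x :: real)"
      by (rule integrable_indicator_bounded)
  qed (use t0 B(1) in auto)
  moreover have "(LINT x|lborel. q * ?g (x, t0)) = (LINT x|lborel. 2 * (\<eta> x * (hflow f t0 x * hlap f t0 x))) * q" for q
    by (subst integral_mult_left_zero[symmetric]) (simp add: mult_ac)
  ultimately show ?thesis by (simp add: has_field_derivative_def mult_commute_abs)
qed

text \<open>Integration by parts for the vector field \<open>\<eta> u grad u\<close>, one coordinate \<open>b\<close> at a time: \<open>G b x b\<close>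
is the derivative of its \<open>b\<close>-component in direction \<open>b\<close>, and the divergence contains the Laplacian,
which the heat equation identifies with the time derivative of \<open>u\<close>.\<close>

lemma integral_cutoff_flow_laplacian:
  assumes t: "t > 0"
  shows "(LINT x|lborel. \<eta> x * (hflow f t x * hlap f t x)) =
         - (LINT x|lborel. \<eta> x * (norm (hgrad f t x))\<^sup>2) - (LINT x|lborel. hflow f t x * (d\<eta> x \<bullet> hgrad f t x))"
proof -
  note [continuous_intros] = cutoff_cont dcutoff_cont hflow_cont[OF t] hgrad_cont[OF t] hlap_cont[OF t] hhess_cont[OF _ t]
  define G where "G b x h = (d\<eta> x \<bullet> h) * (hflow f t x * (hgrad f t x \<bullet> b)) +
      \<eta> x * ((hgrad f t x \<bullet> h) * (hgrad f t x \<bullet> b) + hflow f t x * (hhess f t x h \<bullet> b))" for b x h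
  have 0: "(LINT x|lborel. G b x b) = 0" if b: "b \<in> Basis" for b
  proof (rule integral_directional_derivative_eq_0[of "\<lambda>x. \<eta> x * (hflow f t x * (hgrad f t x \<bullet> b))" "G b" b R])
    show "((\<lambda>x. \<eta> x * (hflow f t x * (hgrad f t x \<bullet> b))) has_derivative G b x) (at x)" for x
      by (rule derivative_eq_intros cutoff_deriv hflow_has_derivative_space[OF t] hgrad_has_derivative[OF t] refl)+
         (simp add: G_def fun_eq_iff algebra_simps)
    show "continuous_on UNIV (\<lambda>x. G b x b)"
      unfolding G_def by (intro continuous_intros b)
  qed (simp add: cutoff_supp)
  have int: "integrable lborel (\<lambda>x. G b x b)" if b: "b \<in> Basis" for b
  proof (rule integrable_compact_support[of _ R])
    show "continuous_on UNIV (\<lambda>x. G b x b)"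
      unfolding G_def by (intro continuous_intros b)
  qed (simp add: G_def cutoff_supp dcutoff_outside)
  note i1 = integrable_cross_term[OF t] and i2 = integrable_local_dirichlet[OF t]
  have i3: "integrable lborel (\<lambda>x. \<eta> x * (hflow f t x * hlap f t x))"
    by (intro integrable_cutoff_times continuous_intros)
  have "(\<Sum>b\<in>Basis. G b x b) = hflow f t x * (d\<eta> x \<bullet> hgrad f t x) + \<eta> x * (norm (hgrad f t x))\<^sup>2 + \<eta> x * (hflow f t x * hlap f t x)" for x
  proof -
    have "(\<Sum>b\<in>Basis. G b x b) = hflow f t x * (\<Sum>b\<in>Basis. (d\<eta> x \<bullet> b) * (hgrad f t x \<bullet> b))
        + \<eta> x * (\<Sum>b\<in>Basis. (hgrad f t x \<bullet> b)\<^sup>2) + \<eta> x * (hflow f t x * (\<Sum>b\<in>Basis. hhess f t x b \<bullet> b))"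
      unfolding G_def sum_distrib_left sum.distrib[symmetric]
      by (rule sum.cong) (auto simp: algebra_simps power2_eq_square)
    then show ?thesis
      by (simp add: heat_equation[OF t] norm2_eq_sum[symmetric] euclidean_inner[symmetric])
  qed
  then have "(LINT x|lborel. hflow f t x * (d\<eta> x \<bullet> hgrad f t x) + \<eta> x * (norm (hgrad f t x))\<^sup>2 + \<eta> x * (hflow f t x * hlap f t x))
      = (LINT x|lborel. (\<Sum>b\<in>Basis. G b x b))" by simp
  also have "\<dots> = (\<Sum>b\<in>Basis. (LINT x|lborel. G b x b))"
    by (rule Bochner_Integration.integral_sum) (rule int)
  also have "\<dots> = 0" by (simp add: 0)
  finally show ?thesis using i1 i2 i3 by simp
qed

text \<open>Integration by parts writes the dissipation as twice the local Dirichlet energy plus the cross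
term \<open>2 \<integral>u grad \<eta> \<bullet> grad u\<close>. By Young's inequality the cross term is at most the local
Dirichlet energy plus \<open>C \<integral>\<^sub>K u\<^sup>2\<close>, which leaves between one and three times that energy.\<close>

lemma
  assumes t: "t > 0"
  shows energy_derivative_upper: "(LINT x|lborel. \<eta> x * (norm (hgrad f t x))\<^sup>2) \<le>
      - (LINT x|lborel. 2 * (\<eta> x * (hflow f t x * hlap f t x))) + C * (LINT x|lborel. indicator K x * (hflow f t x)\<^sup>2)"
    and energy_derivative_lower: "- (LINT x|lborel. 2 * (\<eta> x * (hflow f t x * hlap f t x))) \<le>
      3 * (LINT x|lborel. \<eta> x * (norm (hgrad f t x))\<^sup>2) + C * (LINT x|lborel. indicator K x * (hflow f t x)\<^sup>2)"
proof -
  let ?D = "LINT x|lborel. \<eta> x * (norm (hgrad f t x))\<^sup>2"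
  let ?U = "LINT x|lborel. indicator K x * (hflow f t x)\<^sup>2"
  let ?E = "LINT x|lborel. 2 * (\<eta> x * (hflow f t x * hlap f t x))"
  let ?c = "\<lambda>x. 2 * (hflow f t x * (d\<eta> x \<bullet> hgrad f t x))"
  note i1 = integrable_cross_term[OF t] and i2 = integrable_local_dirichlet[OF t]
  have i3: "integrable lborel (\<lambda>x. indicator K x * (hflow f t x)\<^sup>2)"
    using borel_integrable_compact[OF K_compact, of "\<lambda>x. (hflow f t x)\<^sup>2"] by (auto intro!: continuous_intros hflow_cont t)
  have pt: "\<bar>?c x\<bar> \<le>
      \<eta> x * (norm (hgrad f t x))\<^sup>2 + C * (indicator K x * (hflow f t x)\<^sup>2)" for x
  proof (cases "x \<in> K")
    case False
    then show ?thesis using dcutoff_supp[of x] cutoff_nonneg[of x] by simp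
  next
    case True
    define u g s r where "u = \<bar>hflow f t x\<bar>" and "g = norm (hgrad f t x)" and "s = sqrt (\<eta> x)" and "r = sqrt C"
    have "norm (d\<eta> x) \<le> r * s"
      unfolding r_def s_def real_sqrt_mult[symmetric] by (rule real_le_rsqrt[OF dcutoff_bound])
    then have "\<bar>d\<eta> x \<bullet> hgrad f t x\<bar> \<le> r * s * g"
      unfolding g_def by (intro order_trans[OF Cauchy_Schwarz_ineq2] mult_right_mono) auto
    then have "\<bar>?c x\<bar> \<le> 2 * (u * (r * s * g))"
      by (simp add: abs_mult u_def mult_left_mono)
    also have "\<dots> \<le> s\<^sup>2 * g\<^sup>2 + r\<^sup>2 * u\<^sup>2"
      using zero_le_power2[of "s * g - r * u"] by (simp add: power2_diff power_mult_distrib mult_ac)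
    also have "\<dots> = \<eta> x * (norm (hgrad f t x))\<^sup>2 + C * (indicator K x * (hflow f t x)\<^sup>2)"
      using True cutoff_nonneg C_nonneg by (simp add: s_def r_def g_def u_def)
    finally show ?thesis .
  qed
  have "\<bar>LINT x|lborel. ?c x\<bar>
      \<le> (LINT x|lborel. \<bar>?c x\<bar>)"
    by (rule integral_abs_bound)
  also have "\<dots> \<le> (LINT x|lborel. \<eta> x * (norm (hgrad f t x))\<^sup>2 + C * (indicator K x * (hflow f t x)\<^sup>2))"
    by (rule integral_mono) (auto intro!: i1 i2 i3 pt integrable_abs integrable_mult_right Bochner_Integration.integrable_add simp del: abs_mult)
  also have "\<dots> = ?D + C * ?U"
    using i2 i3 by simp
  finally have "\<bar>2 * (LINT x|lborel. hflow f t x * (d\<eta> x \<bullet> hgrad f t x))\<bar> \<le>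
      ?D + C * ?U"
    by simp
  moreover have "- ?E =
      2 * ?D + 2 * (LINT x|lborel. hflow f t x * (d\<eta> x \<bullet> hgrad f t x))"
    using integral_cutoff_flow_laplacian[OF t] by simp
  ultimately show "?D \<le>
      - ?E + C * ?U"
    "- ?E \<le>
      3 * ?D + C * ?U"
    by linarith+
qed

end

section \<open>Gaussian averages and the decay of the Dirichlet energy\<close>

text \<open>Jensen's inequality for the probability density \<open>hk t (x - p)\<close>, obtained from the
nonnegativity of the variance of \<open>norm (g p)\<close>. If the right-hand side is infinite there is
nothing to prove; otherwise it makes \<open>norm (g p)\<close> integrable, so that the variance makes sense.\<close>

lemma norm_hk_average_sq_le:
  fixes g :: "plane \<Rightarrow> 'b::{banach, second_countable_topology}"
  assumes t: "t > 0" and [measurable]: "g \<in> borel_measurable borel"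
  shows "ennreal ((norm (LINT p|lborel. hk t (x - p) *\<^sub>R g p))\<^sup>2) \<le> (\<integral>\<^sup>+p. ennreal (hk t (x - p) * (norm (g p))\<^sup>2) \<partial>lborel)"
proof (cases "(\<integral>\<^sup>+p. ennreal (hk t (x - p) * (norm (g p))\<^sup>2) \<partial>lborel) = \<infinity>")
  case False
  let ?n = "norm (LINT p|lborel. hk t (x - p) *\<^sub>R g p)"
  let ?ha = "\<lambda>p. hk t (x - p) * norm (g p)"
  let ?hb = "\<lambda>p. hk t (x - p) * (norm (g p))\<^sup>2"
  have hk: "integrable lborel (\<lambda>p. hk t (x - p))" "(LINT p|lborel. hk t (x - p)) = 1"
    using integrable_hk[OF t, of x] integral_hk[OF t, of x] by (simp_all add: hk_minus_commute[of t x])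
  have nn: "0 \<le> hk t y" for y using hk_pos[OF t, of y] by simp
  have i2: "integrable lborel (\<lambda>p. ?hb p)"
    using False by (intro integrableI_nonneg) (auto simp: nn less_top)
  have i1: "integrable lborel (\<lambda>p. ?ha p)"
  proof (rule Bochner_Integration.integrable_bound[OF Bochner_Integration.integrable_add[OF hk(1) i2]])
    have "norm (?ha p) \<le> norm (hk t (x - p) + ?hb p)" for p
    proof -
      have "norm (g p) \<le> 1 + (norm (g p))\<^sup>2"
        by (simp add: le_one_plus_sq)
      from mult_left_mono[OF this nn[of "x - p"]] show ?thesis
        using nn[of "x - p"] by (simp add: distrib_left)
    qed
    then show "AE p in lborel. norm (?ha p) \<le> norm (hk t (x - p) + ?hb p)"
      by simp
  qed measurable
  define m where "m = (LINT p|lborel. ?ha p)"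
  have "?n \<le> (LINT p|lborel. norm (hk t (x - p) *\<^sub>R g p))"
    by (rule integral_norm_bound)
  also have "\<dots> = m" using nn by (simp add: m_def)
  finally have le: "?n \<le> m" .
  have "0 \<le> (LINT p|lborel. hk t (x - p) * (norm (g p) - m)\<^sup>2)"
    by (rule integral_nonneg_AE) (simp add: nn)
  also have "(LINT p|lborel. hk t (x - p) * (norm (g p) - m)\<^sup>2) =
    (LINT p|lborel. ?hb p - (2 * m) * (?ha p) + m\<^sup>2 * hk t (x - p))"
    by (simp add: power2_diff algebra_simps)
  also have "\<dots> = (LINT p|lborel. ?hb p) - (2 * m) * m + m\<^sup>2"
    using hk i1 i2 by (simp add: m_def)
  finally have "m\<^sup>2 \<le> (LINT p|lborel. ?hb p)"
    by (simp add: power2_eq_square)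
  then have "(?n)\<^sup>2 \<le> (LINT p|lborel. ?hb p)"
    using power_mono[OF le norm_ge_zero, of 2] by linarith
  then show ?thesis
    using i2 nn by (simp add: nn_integral_eq_integral)
qed simp

lemma L2_hk_average_le:
  fixes g :: "plane \<Rightarrow> 'b::{banach, second_countable_topology}"
  assumes t: "t > 0" and [measurable]: "g \<in> borel_measurable borel"
  shows "(\<integral>\<^sup>+x. ennreal ((norm (LINT p|lborel. hk t (x - p) *\<^sub>R g p))\<^sup>2) \<partial>lborel) \<le> (\<integral>\<^sup>+p. ennreal ((norm (g p))\<^sup>2) \<partial>lborel)"
proof -
  have nn: "0 \<le> hk t y" for y using hk_pos[OF t, of y] by simp
  have "(\<integral>\<^sup>+x. ennreal ((norm (LINT p|lborel. hk t (x - p) *\<^sub>R g p))\<^sup>2) \<partial>lborel)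
      \<le> (\<integral>\<^sup>+x. (\<integral>\<^sup>+p. ennreal (hk t (x - p) * (norm (g p))\<^sup>2) \<partial>lborel) \<partial>lborel)"
    by (intro nn_integral_mono norm_hk_average_sq_le t assms)
  also have "\<dots> = (\<integral>\<^sup>+p. (\<integral>\<^sup>+x. ennreal (hk t (x - p) * (norm (g p))\<^sup>2) \<partial>lborel) \<partial>lborel)"
    by (rule lborel_pair.Fubini'[symmetric]) measurable
  also have "\<dots> = (\<integral>\<^sup>+p. ennreal ((norm (g p))\<^sup>2) \<partial>lborel)"
    by (simp add: ennreal_mult'' nn_integral_multc nn_integral_hk[OF t])
  finally show ?thesis .
qed

lemma integrable_exp_norm_sq:
  assumes "c > 0"
  shows "integrable lborel (\<lambda>z::plane. exp (- c * (norm z)\<^sup>2))"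
proof -
  have "integrable lborel (\<lambda>z. pi / c * hk (1 / (4 * c)) (z - 0))"
    using assms by (intro integrable_mult_right integrable_hk) simp
  then show ?thesis using assms by (simp add: hk_def mult.commute)
qed

lemma integrable_grad_hk:
  assumes t: "t > 0"
  shows "integrable lborel (grad_hk t)"
proof -
  obtain C c where C: "C \<ge> 0" "c > 0" "\<And>z. hk_major t (0 - z) \<le> C * exp (- c * (norm z)\<^sup>2)"
    using hk_major_decay[of t t 0] t by auto
  show ?thesis
  proof (rule Bochner_Integration.integrable_bound[OF integrable_mult_right[OF integrable_exp_norm_sq[OF C(2)], of C]])
    have "norm (grad_hk t z) \<le> norm (C * exp (- c * (norm z)\<^sup>2))" for z
      using grad_dt_hk_le_major[OF t, of z] norm_ge_zero[of "dt_hk t z"] C(3)[of "- z"] C(1) by simp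
    then show "AE z in lborel. norm (grad_hk t z) \<le> norm (C * exp (- c * (norm z)\<^sup>2))" by simp
  qed measurable
qed

text \<open>The centred first moment vanishes by reflection; it is expressed through \<open>grad_hk\<close>, whose
integrability is already known.\<close>

lemma has_bochner_integral_hk_mean:
  assumes t: "t > 0"
  shows "has_bochner_integral lborel (\<lambda>p. hk t (p - m) *\<^sub>R p) m"
proof -
  have i: "integrable lborel (\<lambda>p. grad_hk t (- m + 1 *\<^sub>R p))"
    by (intro integrable_lborel_affine integrable_grad_hk t) simp
  have "(LINT p|lborel. grad_hk t p) = (LINT p|lborel. grad_hk t (0 + (-1) *\<^sub>R p))"
    by (subst integral_lborel_affine[of "-1" "grad_hk t" 0]) simp_all
  also have "\<dots> = - (LINT p|lborel. grad_hk t p)"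
    by (simp add: grad_hk_def)
  finally have "2 *\<^sub>R (LINT p|lborel. grad_hk t p) = 0"
    unfolding eq_neg_iff_add_eq_0 by (simp only: scaleR_2)
  then have "(LINT p|lborel. grad_hk t p) = 0" by simp
  then have "(LINT p|lborel. grad_hk t (- m + 1 *\<^sub>R p)) = 0"
    using integral_lborel_affine[of 1 "grad_hk t" "- m"] by simp
  then have "has_bochner_integral lborel (\<lambda>p. grad_hk t (- m + 1 *\<^sub>R p)) 0"
    using i by (simp add: has_bochner_integral_iff)
  then have 1: "has_bochner_integral lborel (\<lambda>p. (- 2 * t) *\<^sub>R grad_hk t (- m + 1 *\<^sub>R p)) ((- 2 * t) *\<^sub>R 0)"
    by (rule has_bochner_integral_scaleR_right)
  have 2: "has_bochner_integral lborel (\<lambda>p. hk t (p - m) *\<^sub>R m) (1 *\<^sub>R m)"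
    by (intro has_bochner_integral_scaleR_left) (simp add: has_bochner_integral_iff integrable_hk integral_hk t)
  have "(- 2 * t) *\<^sub>R grad_hk t (- m + 1 *\<^sub>R p) + hk t (p - m) *\<^sub>R m = hk t (p - m) *\<^sub>R p" for p
    using t by (simp add: grad_hk_def scaleR_diff_right)
  with has_bochner_integral_add[OF 1 2] show ?thesis by simp
qed

lemma integral_hk_grad_hk:
  assumes r: "r > 0" and s: "s > 0"
  shows "(LINT p|lborel. hk r (x - p) *\<^sub>R grad_hk s (p - z)) = grad_hk (r + s) (x - z)"
proof -
  have "(LINT p|lborel. hk r (x - p) *\<^sub>R grad_hk s (p - z)) = (LINT p|lborel. hk r (x - (z + 1 *\<^sub>R p)) *\<^sub>R grad_hk s (z + 1 *\<^sub>R p - z))"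
    by (subst integral_lborel_affine[of 1 _ z]) simp_all
  also have "\<dots> = (LINT p|lborel. hk r ((x - z) - p) *\<^sub>R grad_hk s p)"
    by (simp add: algebra_simps)
  also have "\<dots> = (LINT p|lborel. (- hk (r + s) (x - z) / (2 * s)) *\<^sub>R (hk (r * s / (r + s)) (p - (s / (r + s)) *\<^sub>R (x - z)) *\<^sub>R p))"
    by (rule Bochner_Integration.integral_cong) (use hk_product[OF r s, of "x - z"] in \<open>simp_all add: grad_hk_def\<close>)
  also have "\<dots> = (- hk (r + s) (x - z) / (2 * s)) *\<^sub>R (s / (r + s)) *\<^sub>R (x - z)"
    by (subst integral_scaleR_right, subst has_bochner_integral_integral_eq[OF has_bochner_integral_hk_mean])
       (use r s in auto)
  also have "\<dots> = grad_hk (r + s) (x - z)"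
    using r s by (simp add: grad_hk_def)
  finally show ?thesis .
qed

lemma nn_integral_hk_hk:
  assumes r: "r > 0" and s: "s > 0"
  shows "(\<integral>\<^sup>+p. ennreal (hk r (x - p) * hk s (p - z)) \<partial>lborel) = ennreal (hk (r + s) (x - z))"
proof -
  have nn: "0 \<le> hk (r + s) y" for y using hk_pos[of "r + s" y] r s by simp
  have "(\<integral>\<^sup>+p. ennreal (hk r (x - p) * hk s (p - z)) \<partial>lborel) = (\<integral>\<^sup>+p. ennreal (hk r ((x - z) - (p - z)) * hk s (p - z)) \<partial>lborel)"
    by simp
  also have "\<dots> = (\<integral>\<^sup>+p. ennreal (hk r ((x - z) - p) * hk s p) \<partial>lborel)"
    by (rule nn_integral_lborel_translate) measurable
  also have "\<dots> = ennreal (hk (r + s) (x - z))"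
    unfolding hk_product[OF r s] using r s by (simp add: ennreal_mult' nn nn_integral_cmult nn_integral_hk)
  finally show ?thesis .
qed

lemma norm_grad_hk_le:
  assumes s: "s > 0"
  shows "norm (grad_hk s y) \<le> (1 + 8 * s) / s * hk (2 * s) y"
proof -
  define n where "n = norm y"
  have "n \<le> 1 + n\<^sup>2" by (simp add: n_def le_one_plus_sq)
  also have "\<dots> \<le> (1 + 8 * s) * exp (n\<^sup>2 / (8 * s))"
    using one_plus_le_exp[of "1 / (8 * s)" "n\<^sup>2"] s by simp
  finally have "exp (- n\<^sup>2 / (4 * s)) / (4 * pi * s) / (2 * s) * n \<le> exp (- n\<^sup>2 / (4 * s)) / (4 * pi * s) / (2 * s) * ((1 + 8 * s) * exp (n\<^sup>2 / (8 * s)))"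
    using s by (intro mult_left_mono) auto
  also have "\<dots> = (1 + 8 * s) / (8 * pi * s * s) * (exp (- n\<^sup>2 / (4 * s)) * exp (n\<^sup>2 / (8 * s)))"
    using s by (simp add: field_simps)
  also have "exp (- n\<^sup>2 / (4 * s)) * exp (n\<^sup>2 / (8 * s)) = exp (- n\<^sup>2 / (8 * s))"
    using s by (simp add: exp_add[symmetric] field_simps)
  finally show ?thesis
    using s by (simp add: grad_hk_def hk_def n_def[symmetric] field_simps)
qed

context gauss_integrable begin

text \<open>The semigroup law, applied directly to gradients. Absolute convergence of the double integral
comes from bounding \<open>grad_hk s\<close> by a multiple of the heat kernel at time \<open>2 s\<close>.\<close>

lemma hgrad_semigroup:
  assumes r: "r > 0" and s: "s > 0"
  shows "hgrad f (r + s) x = (LINT p|lborel. hk r (x - p) *\<^sub>R hgrad f s p)"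
proof -
  let ?I = "\<integral>\<^sup>+w. ennreal (norm (case w of (z, p) \<Rightarrow> f z *\<^sub>R (hk r (x - p) *\<^sub>R grad_hk s (p - z)))) \<partial>(lborel \<Otimes>\<^sub>M lborel)"
  let ?F = "\<lambda>z p. f z *\<^sub>R (hk r (x - p) *\<^sub>R grad_hk s (p - z))"
  define B where "B = (1 + 8 * s) / s"
  have B: "B \<ge> 0" using s by (simp add: B_def)
  have nn: "0 \<le> hk r y" for y using hk_pos[OF r, of y] by simp
  have "integrable (lborel \<Otimes>\<^sub>M lborel) (\<lambda>(z, p). ?F z p)"
  proof (rule integrableI_bounded)
    show "(\<lambda>(z, p). ?F z p) \<in> borel_measurable (lborel \<Otimes>\<^sub>M lborel)"
      by measurable
    have "?I
       = (\<integral>\<^sup>+z. \<integral>\<^sup>+p. ennreal (norm (?F z p)) \<partial>lborel \<partial>lborel)"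
      by (subst lborel.nn_integral_fst[symmetric]) simp_all
    also have "\<dots> \<le> (\<integral>\<^sup>+z. \<integral>\<^sup>+p. ennreal (\<bar>f z\<bar> * B) * ennreal (hk r (x - p) * hk (2 * s) (p - z)) \<partial>lborel \<partial>lborel)"
    proof (intro nn_integral_mono)
      fix z p
      have "norm (?F z p) = \<bar>f z\<bar> * (hk r (x - p) * norm (grad_hk s (p - z)))"
        using nn by (simp add: abs_mult)
      also have "\<dots> \<le> \<bar>f z\<bar> * (hk r (x - p) * (B * hk (2 * s) (p - z)))"
        unfolding B_def by (intro mult_left_mono norm_grad_hk_le s nn) auto
      finally show "ennreal (norm (?F z p)) \<le> ennreal (\<bar>f z\<bar> * B) * ennreal (hk r (x - p) * hk (2 * s) (p - z))"
        using B by (subst ennreal_mult'[symmetric]) (auto intro!: ennreal_leI simp: mult_ac)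
    qed
    also have "\<dots> = (\<integral>\<^sup>+z. ennreal (\<bar>f z\<bar> * B) * ennreal (hk (r + 2 * s) (x - z)) \<partial>lborel)"
      using r s by (simp add: nn_integral_cmult nn_integral_hk_hk)
    also have "\<dots> = (\<integral>\<^sup>+z. ennreal (norm (B * (f z * hk (r + 2 * s) (x - z)))) \<partial>lborel)"
      using B hk_pos[of "r + 2 * s"] r s
      by (intro nn_integral_cong) (simp add: ennreal_mult'[symmetric] abs_mult mult_ac less_imp_le)
    also have "\<dots> < \<infinity>"
    proof -
      have "integrable lborel (\<lambda>z. B * (f z * hk (r + 2 * s) (x - z)))"
        using r s by (intro integrable_mult_right integrable_hk_times) simp
      then show ?thesis by (simp only: integrable_iff_bounded)
    qed
    finally show "?I < \<infinity>" .
  qed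
  then have "(LINT p|lborel. LINT z|lborel. ?F z p) = (LINT z|lborel. LINT p|lborel. ?F z p)"
    by (rule lborel_pair.Fubini_integral)
  moreover have "(LINT p|lborel. ?F z p) = f z *\<^sub>R grad_hk (r + s) (x - z)" for z
    unfolding integral_scaleR_right by (simp only: integral_hk_grad_hk[OF r s])
  moreover have "(LINT z|lborel. ?F z p) = hk r (x - p) *\<^sub>R hgrad f s p" for p
  proof -
    have "(LINT z|lborel. ?F z p) = (LINT z|lborel. hk r (x - p) *\<^sub>R (f z *\<^sub>R grad_hk s (p - z)))"
      by (simp add: mult.commute)
    then show ?thesis unfolding hgrad_def by (simp only: integral_scaleR_right)
  qed
  ultimately show ?thesis by (simp add: hgrad_def)
qed

lemma hgrad_measurable [measurable]: "t > 0 \<Longrightarrow> hgrad f t \<in> borel_measurable borel"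
  by (rule borel_measurable_continuous_onI[OF hgrad_cont])

lemma hflow_measurable [measurable]: "t > 0 \<Longrightarrow> hflow f t \<in> borel_measurable borel"
  by (rule borel_measurable_continuous_onI[OF hflow_cont])

lemma dirichlet_antimono:
  assumes s: "0 < s" and st: "s \<le> t"
  shows "(\<integral>\<^sup>+x. ennreal ((norm (hgrad f t x))\<^sup>2) \<partial>lborel) \<le> (\<integral>\<^sup>+x. ennreal ((norm (hgrad f s x))\<^sup>2) \<partial>lborel)"
proof (cases "s = t")
  case False
  then have r: "t - s > 0" using st by simp
  have "hgrad f t x = (LINT p|lborel. hk (t - s) (x - p) *\<^sub>R hgrad f s p)" for x
    using hgrad_semigroup[OF r s, of x] by simp
  then show ?thesis using L2_hk_average_le[OF r hgrad_measurable[OF s]] by simp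
qed simp

end

section \<open>Discretely self-similar data\<close>

text \<open>Substitution \<open>z \<mapsto> c z\<close>: the area factor \<open>c\<^sup>2\<close> cancels the normalization of the kernel, and the
remaining factor \<open>1 / c\<close> comes from \<open>f\<close>. Homogeneity may fail at the origin, which is a null set.\<close>

lemma hflow_rescale:
  assumes [measurable]: "f \<in> borel_measurable borel" and c: "c > 0"
    and f: "\<And>z. z \<noteq> 0 \<Longrightarrow> f (c *\<^sub>R z) = f z / c"
  shows "hflow f (c\<^sup>2 * t) (c *\<^sub>R x) = hflow f t x / c"
proof -
  let ?F = "\<lambda>z. f (c *\<^sub>R z) * hk (c\<^sup>2 * t) (c *\<^sub>R x - c *\<^sub>R z)"
  have "hflow f (c\<^sup>2 * t) (c *\<^sub>R x) =
      c\<^sup>2 *\<^sub>R (LINT z|lborel. ?F z)"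
    unfolding hflow_def using c by (subst integral_lborel_affine[of c _ 0]) simp_all
  also have "(LINT z|lborel. ?F z) =
      (LINT z|lborel. (1 / c ^ 3) * (f z * hk t (x - z)))"
  proof (rule integral_cong_AE)
    have eq: "?F z = (1 / c ^ 3) * (f z * hk t (x - z))" if "z \<noteq> 0" for z
      using c unfolding scaleR_diff_right[symmetric] f[OF that] hk_def power2_norm_scaleR
      by (simp add: field_simps power2_eq_square power3_eq_cube)
    show "AE z in lborel. ?F z = (1 / c ^ 3) * (f z * hk t (x - z))"
      using AE_lborel_singleton[of "0::plane"] by eventually_elim (rule eq)
  qed measurable
  finally show ?thesis using c by (simp add: hflow_def power2_eq_square power3_eq_cube)
qed

lemma hgrad_rescale:
  assumes [measurable]: "f \<in> borel_measurable borel" and c: "c > 0"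
    and f: "\<And>z. z \<noteq> 0 \<Longrightarrow> f (c *\<^sub>R z) = f z / c"
  shows "hgrad f (c\<^sup>2 * t) (c *\<^sub>R x) = (1 / c\<^sup>2) *\<^sub>R hgrad f t x"
proof -
  let ?F = "\<lambda>z. f (c *\<^sub>R z) *\<^sub>R grad_hk (c\<^sup>2 * t) (c *\<^sub>R x - c *\<^sub>R z)"
  have "hgrad f (c\<^sup>2 * t) (c *\<^sub>R x) =
      c\<^sup>2 *\<^sub>R (LINT z|lborel. ?F z)"
    unfolding hgrad_def using c by (subst integral_lborel_affine[of c _ 0]) simp_all
  also have "(LINT z|lborel. ?F z) =
      (LINT z|lborel. (1 / c ^ 4) *\<^sub>R (f z *\<^sub>R grad_hk t (x - z)))"
  proof (rule integral_cong_AE)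
    have "grad_hk (c\<^sup>2 * t) (c *\<^sub>R y) = (1 / c ^ 3) *\<^sub>R grad_hk t y" for y
      using c unfolding grad_hk_def hk_def power2_norm_scaleR
      by (simp add: field_simps power2_eq_square power3_eq_cube)
    then have eq: "?F z = (1 / c ^ 4) *\<^sub>R (f z *\<^sub>R grad_hk t (x - z))" if "z \<noteq> 0" for z
      using c unfolding scaleR_diff_right[symmetric] f[OF that]
      by (simp add: power3_eq_cube power4_eq_xxxx mult_ac)
    show "AE z in lborel. ?F z = (1 / c ^ 4) *\<^sub>R (f z *\<^sub>R grad_hk t (x - z))"
      using AE_lborel_singleton[of "0::plane"] by eventually_elim (rule eq)
  qed measurable
  also have "\<dots> = (1 / c ^ 4) *\<^sub>R hgrad f t x"
    unfolding hgrad_def by (rule integral_scaleR_right)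
  finally show ?thesis using c by (simp add: power2_eq_square power4_eq_xxxx)
qed

lemma nn_integral_plane_scale:
  fixes h :: "plane \<Rightarrow> ennreal"
  assumes "c > 0" and [measurable]: "h \<in> borel_measurable borel"
  shows "(\<integral>\<^sup>+x. h x \<partial>lborel) = ennreal (c\<^sup>2) * (\<integral>\<^sup>+x. h (c *\<^sub>R x) \<partial>lborel)"
  using assms by (subst nn_integral_lborel_affine[of h c 0]) simp_all

lemma dss_powi:
  fixes f :: "'a::real_vector \<Rightarrow> real"
  assumes l: "l > 0" and dss: "\<And>x. x \<noteq> 0 \<Longrightarrow> f (l *\<^sub>R x) = f x / l" and x: "x \<noteq> 0"
  shows "f ((l powi k) *\<^sub>R x) = f x / (l powi k)"
proof -
  have nat: "f ((l ^ n) *\<^sub>R y) = f y / l ^ n" if "y \<noteq> 0" for n y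
  proof (induction n)
    case (Suc n)
    then show ?case
      using dss[of "(l ^ n) *\<^sub>R y"] that l by (simp add: mult.commute)
  qed simp
  show ?thesis
  proof (cases "k \<ge> 0")
    case True
    then obtain n where "k = int n" using nonneg_int_cases by blast
    with nat[OF x, of n] show ?thesis by simp
  next
    case False
    define n where "n = nat (- k)"
    have k: "k = - int n" using False by (simp add: n_def)
    have "f ((l ^ n) *\<^sub>R ((l powi k) *\<^sub>R x)) = f ((l powi k) *\<^sub>R x) / l ^ n"
      using x l by (intro nat) simp
    then show ?thesis using l by (simp add: k power_int_minus divide_simps)
  qed
qed

locale dss_L2 =
  fixes l :: real and f :: "plane \<Rightarrow> real"
  assumes l_gt_1: "l > 1"
    and f_borel [measurable]: "f \<in> borel_measurable borel"
    and f_dss: "\<And>x. x \<noteq> 0 \<Longrightarrow> f (l *\<^sub>R x) = f x / l"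
    and f_L2: "integrable lborel (\<lambda>x. indicator (annulus l) x * (f x)\<^sup>2)"
begin

text \<open>The shells are the images of the annulus under the powers of the scaling; they tile the
punctured plane.\<close>

definition shell :: "int \<Rightarrow> plane set" where
  "shell k = {x. l powi k \<le> norm x \<and> norm x < l powi (k + 1)}"

lemma shell_measurable [measurable]: "shell k \<in> sets borel"
  unfolding shell_def by measurable

lemma shell_0: "shell 0 = annulus l"
  by (auto simp: shell_def annulus_def)

lemma l_pos: "l > 0" and powi_pos: "l powi k > 0"
  using l_gt_1 by auto

lemma shell_scale: "(l powi k) *\<^sub>R x \<in> shell (k + j) \<longleftrightarrow> x \<in> shell j"
  using powi_pos[of k] l_pos by (simp add: shell_def power_int_add mult.assoc)

lemma f_powi_scale: "x \<noteq> 0 \<Longrightarrow> f ((l powi k) *\<^sub>R x) = f x / (l powi k)"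
  by (intro dss_powi l_pos f_dss)

lemma nn_integral_shell:
  fixes h :: "plane \<Rightarrow> ennreal"
  assumes [measurable]: "h \<in> borel_measurable borel"
  shows "(\<integral>\<^sup>+x. indicator (shell k) x * h x \<partial>lborel) =
    (\<integral>\<^sup>+x. indicator (shell 0) x * (ennreal ((l powi k)\<^sup>2) * h ((l powi k) *\<^sub>R x)) \<partial>lborel)"
  using shell_scale[of k _ 0]
  by (subst nn_integral_plane_scale[OF powi_pos[of k]])
     (simp_all add: indicator_def nn_integral_cmult[symmetric] mult.left_commute)

lemma shell_nonzero: "x \<in> shell k \<Longrightarrow> x \<noteq> 0"
  using powi_pos[of k] by (auto simp: shell_def)

definition mass :: ennreal where
  "mass = (\<integral>\<^sup>+x. indicator (shell 0) x * ennreal ((f x)\<^sup>2) \<partial>lborel)"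

lemma mass_eq: "mass = ennreal (LINT x|lborel. indicator (annulus l) x * (f x)\<^sup>2)"
proof -
  have "mass = (\<integral>\<^sup>+x. ennreal (indicator (annulus l) x * (f x)\<^sup>2) \<partial>lborel)"
    unfolding mass_def shell_0 by (intro nn_integral_cong) (auto simp: indicator_def)
  then show ?thesis using f_L2 by (simp add: nn_integral_eq_integral)
qed

text \<open>In two dimensions the area factor of the scaling cancels the homogeneity of \<open>f\<^sup>2\<close>, so every
shell carries the same mass. In particular \<open>f\<close> is square integrable neither at 0 nor at
infinity, unless it vanishes.\<close>

lemma nn_integral_shell_sq: "(\<integral>\<^sup>+x. indicator (shell k) x * ennreal ((f x)\<^sup>2) \<partial>lborel) = mass"
proof -
  let ?h = "\<lambda>x. ennreal ((l powi k)\<^sup>2) * ennreal ((f ((l powi k) *\<^sub>R x))\<^sup>2)"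
  have "(\<integral>\<^sup>+x. indicator (shell k) x * ennreal ((f x)\<^sup>2) \<partial>lborel) =
      (\<integral>\<^sup>+x. indicator (shell 0) x * (?h x) \<partial>lborel)"
    by (rule nn_integral_shell) measurable
  also have "\<dots> = mass"
    unfolding mass_def
  proof (rule nn_integral_cong)
    fix x show "indicator (shell 0) x * (?h x) =
        indicator (shell 0) x * ennreal ((f x)\<^sup>2)"
    proof (cases "x \<in> shell 0")
      case True
      then show ?thesis
        using f_powi_scale[OF shell_nonzero[OF True], of k] powi_pos[of k] l_pos
        by (simp add: ennreal_mult[symmetric] power_divide)
    qed simp
  qed
  finally show ?thesis .
qed

lemma nn_integral_shell_abs_finite: "(\<integral>\<^sup>+x. indicator (shell 0) x * ennreal \<bar>f x\<bar> \<partial>lborel) < \<infinity>"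
proof -
  have [measurable]: "cball (0::plane) l \<in> sets borel" by (intro borel_closed closed_cball)
  have "(\<integral>\<^sup>+x. indicator (shell 0) x * ennreal \<bar>f x\<bar> \<partial>lborel)
      \<le> (\<integral>\<^sup>+x. indicator (cball 0 l) x + indicator (shell 0) x * ennreal ((f x)\<^sup>2) \<partial>lborel)"
  proof (rule nn_integral_mono)
    fix x
    show "indicator (shell 0) x * ennreal \<bar>f x\<bar> \<le> indicator (cball 0 l) x + indicator (shell 0) x * ennreal ((f x)\<^sup>2)"
    proof (cases "x \<in> shell 0")
      case True
      then have "x \<in> cball 0 l" by (simp add: shell_def)
      moreover have "ennreal \<bar>f x\<bar> \<le> ennreal (1 + (f x)\<^sup>2)"
        using le_one_plus_sq[of "\<bar>f x\<bar>"] by (intro ennreal_leI) simp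
      ultimately show ?thesis using True by simp
    qed simp
  qed
  also have "\<dots> = emeasure lborel (cball (0::plane) l) + mass"
    unfolding mass_def by (subst nn_integral_add) auto
  also have "\<dots> < \<infinity>"
    using emeasure_bounded_finite[OF bounded_cball[of "0::plane" l]] by (simp add: mass_eq)
  finally show ?thesis .
qed

lemma shell_exhaust:
  assumes "x \<noteq> 0"
  obtains k where "x \<in> shell k"
proof
  let ?k = "\<lfloor>log l (norm x)\<rfloor>"
  have "l powr (of_int ?k) \<le> l powr (log l (norm x))" "l powr (log l (norm x)) < l powr (of_int (?k + 1))"
    using l_gt_1 by (auto intro!: powr_mono powr_less_mono)
  moreover have "l powr (log l (norm x)) = norm x" using assms l_gt_1 by simp
  ultimately have "l powi ?k \<le> norm x" "norm x < l powi (?k + 1)"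
    using l_gt_1 by (simp_all only: powr_real_of_int'[OF less_imp_le[OF l_pos] disjI1[OF less_imp_neq[OF l_pos, symmetric]]])
  then show "x \<in> shell ?k" by (simp add: shell_def)
qed

lemma nn_integral_shell_gauss_le:
  assumes c: "c > 0"
  shows "(\<integral>\<^sup>+x. indicator (shell k) x * ennreal \<bar>exp (- c * (norm x)\<^sup>2) * f x\<bar> \<partial>lborel)
    \<le> ennreal (l powi k * exp (- c * (l powi k)\<^sup>2)) * (\<integral>\<^sup>+x. indicator (shell 0) x * ennreal \<bar>f x\<bar> \<partial>lborel)"
proof -
  let ?e = "\<lambda>x. \<bar>exp (- c * (norm x)\<^sup>2) * f x\<bar>"
  let ?a = "ennreal (l powi k * exp (- c * (l powi k)\<^sup>2))"
  have "(\<integral>\<^sup>+x. indicator (shell k) x * ennreal (?e x) \<partial>lborel) =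
      (\<integral>\<^sup>+x. indicator (shell 0) x * (ennreal ((l powi k)\<^sup>2) * ennreal (?e ((l powi k) *\<^sub>R x))) \<partial>lborel)"
    by (rule nn_integral_shell) measurable
  also have "\<dots> \<le> (\<integral>\<^sup>+x. ?a * (indicator (shell 0) x * ennreal \<bar>f x\<bar>) \<partial>lborel)"
  proof (rule nn_integral_mono)
    fix x
    define s where "s = l powi k"
    have s: "s > 0" by (simp add: s_def powi_pos)
    show "indicator (shell 0) x * (ennreal ((l powi k)\<^sup>2) * ennreal (?e ((l powi k) *\<^sub>R x)))
      \<le> ?a * (indicator (shell 0) x * ennreal \<bar>f x\<bar>)"
    proof (cases "x \<in> shell 0")
      case True
      then have "1 \<le> norm x" by (simp add: shell_def)
      then have "s\<^sup>2 * 1\<^sup>2 \<le> s\<^sup>2 * (norm x)\<^sup>2" by (intro mult_left_mono power_mono) auto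
      then have e: "exp (- c * (norm (s *\<^sub>R x))\<^sup>2) \<le> exp (- c * s\<^sup>2)"
        unfolding power2_norm_scaleR using c by simp
      have "s\<^sup>2 * \<bar>exp (- c * (norm (s *\<^sub>R x))\<^sup>2) * f (s *\<^sub>R x)\<bar> = s * \<bar>f x\<bar> * exp (- c * (norm (s *\<^sub>R x))\<^sup>2)"
        using f_powi_scale[OF shell_nonzero[OF True], of k] s
        by (simp add: s_def[symmetric] abs_mult power2_eq_square)
      also have "\<dots> \<le> s * \<bar>f x\<bar> * exp (- c * s\<^sup>2)"
        using s by (intro mult_left_mono e) auto
      finally show ?thesis
        using True s unfolding s_def[symmetric]
        by (simp add: ennreal_mult[symmetric] mult_ac)
    qed simp
  qed
  also have "\<dots> = ?a * (\<integral>\<^sup>+x. indicator (shell 0) x * ennreal \<bar>f x\<bar> \<partial>lborel)"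
    by (rule nn_integral_cmult) measurable
  finally show ?thesis .
qed

text \<open>The integral of \<open>|f|\<close> over the shell of size \<open>s\<close> is \<open>s\<close> times that over the annulus. This is
summable over small shells, and over large shells the Gaussian weight makes it so. The shell
of index 0 is counted in both sums.\<close>

lemma gauss_integrable_f: "gauss_integrable f"
proof
  show "f \<in> borel_measurable borel" by measurable
  fix c :: real assume c: "c > 0"
  define h where "h k x = indicator (shell k) x * ennreal \<bar>exp (- c * (norm x)\<^sup>2) * f x\<bar>" for k x
  have [measurable]: "h k \<in> borel_measurable borel" for k unfolding h_def by measurable
  define N where "N = enn2real (\<integral>\<^sup>+x. indicator (shell 0) x * ennreal \<bar>f x\<bar> \<partial>lborel)"
  have N: "(\<integral>\<^sup>+x. indicator (shell 0) x * ennreal \<bar>f x\<bar> \<partial>lborel) = ennreal N" "N \<ge> 0"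
    using nn_integral_shell_abs_finite by (auto simp: N_def less_top)
  have hk: "(\<integral>\<^sup>+x. h k x \<partial>lborel) \<le> ennreal ((l powi k * exp (- c * (l powi k)\<^sup>2)) * N)" for k
    using nn_integral_shell_gauss_le[OF c, of k] powi_pos[of k] N(2)
    unfolding N(1) h_def by (subst ennreal_mult) simp_all
  have sm: "summable (\<lambda>n. inverse l ^ n)"
    using l_gt_1 by (intro summable_geometric) (simp add: inverse_eq_divide)
  have fin: "(\<integral>\<^sup>+x. (\<Sum>n. h (q n) x) \<partial>lborel) < \<infinity>"
    if q: "\<And>n. l powi (q n) * exp (- c * (l powi (q n))\<^sup>2) \<le> B * inverse l ^ n" and B: "B \<ge> 0" for q :: "nat \<Rightarrow> int" and B
  proof -
    have "(\<integral>\<^sup>+x. (\<Sum>n. h (q n) x) \<partial>lborel) = (\<Sum>n. \<integral>\<^sup>+x. h (q n) x \<partial>lborel)"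
      by (rule nn_integral_suminf) measurable
    also have "\<dots> \<le> (\<Sum>n. ennreal (B * N * inverse l ^ n))"
    proof (intro suminf_le summableI)
      fix n
      have "l powi (q n) * exp (- c * (l powi (q n))\<^sup>2) * N \<le> B * inverse l ^ n * N"
        by (rule mult_right_mono[OF q N(2)])
      then show "(\<integral>\<^sup>+x. h (q n) x \<partial>lborel) \<le> ennreal (B * N * inverse l ^ n)"
        by (intro order_trans[OF hk] ennreal_leI) (simp add: mult_ac)
    qed
    also have "\<dots> < \<infinity>"
    proof -
      have "(\<Sum>n. ennreal (B * N * inverse l ^ n)) \<noteq> top"
        by (rule ennreal_suminf_neq_top) (use B N(2) l_pos sm in \<open>auto intro: summable_mult\<close>)
      then show ?thesis by (simp add: less_top)
    qed
    finally show ?thesis .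
  qed
  have "(\<integral>\<^sup>+x. ennreal (norm (exp (- c * (norm x)\<^sup>2) * f x)) \<partial>lborel)
      \<le> (\<integral>\<^sup>+x. (\<Sum>n. h (int n) x) + (\<Sum>n. h (- int n) x) \<partial>lborel)"
  proof (rule nn_integral_mono_AE)
    have eq: "ennreal (norm (exp (- c * (norm x)\<^sup>2) * f x)) \<le> (\<Sum>n. h (int n) x) + (\<Sum>n. h (- int n) x)" if nz: "x \<noteq> 0" for x
    proof -
      obtain k where k: "x \<in> shell k" using shell_exhaust[OF nz] .
      then have e: "ennreal (norm (exp (- c * (norm x)\<^sup>2) * f x)) = h k x" by (simp add: h_def)
      obtain n where "k = int n \<or> k = - int n" by (cases k rule: int_cases2) auto
      then show ?thesis
      proof
        assume "k = int n"
        then have "h k x \<le> (\<Sum>n. h (int n) x)"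
          using sum_le_suminf[of "\<lambda>n. h (int n) x" "{n}"] by simp
        then show ?thesis unfolding e by (simp add: add_increasing2)
      next
        assume "k = - int n"
        then have "h k x \<le> (\<Sum>n. h (- int n) x)"
          using sum_le_suminf[of "\<lambda>n. h (- int n) x" "{n}"] by simp
        then show ?thesis unfolding e by (simp add: add_increasing)
      qed
    qed
    show "AE x in lborel. ennreal (norm (exp (- c * (norm x)\<^sup>2) * f x)) \<le> (\<Sum>n. h (int n) x) + (\<Sum>n. h (- int n) x)"
      using AE_lborel_singleton[of "0::plane"] by eventually_elim (rule eq)
  qed
  also have "\<dots> = (\<integral>\<^sup>+x. (\<Sum>n. h (int n) x) \<partial>lborel) + (\<integral>\<^sup>+x. (\<Sum>n. h (- int n) x) \<partial>lborel)"
    by (rule nn_integral_add) measurable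
  also have "\<dots> < \<infinity>"
  proof -
    have "(\<integral>\<^sup>+x. (\<Sum>n. h (int n) x) \<partial>lborel) < \<infinity>"
    proof (rule fin[where B = "1 / c"])
      fix n
      have s: "l ^ n > 0" using l_pos by simp
      have exp_le: "exp (- X) \<le> 1 / X" if "X > 0" for X :: real
        unfolding exp_minus inverse_eq_divide[symmetric] using that exp_ge_add_one_self[of X]
        by (intro le_imp_inverse_le) linarith+
      have "exp (- c * (l ^ n)\<^sup>2) \<le> 1 / (c * (l ^ n)\<^sup>2)"
        using exp_le[OF mult_pos_pos[OF c zero_less_power[OF s, of 2]]] by simp
      then have "l ^ n * exp (- c * (l ^ n)\<^sup>2) \<le> l ^ n * (1 / (c * (l ^ n)\<^sup>2))"
        using s by (intro mult_left_mono) auto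
      also have "\<dots> = 1 / c * inverse l ^ n" using c s l_pos by (simp add: power2_eq_square field_simps)
      finally show "l powi int n * exp (- c * (l powi int n)\<^sup>2) \<le> 1 / c * inverse l ^ n" by simp
    qed (use c in simp)
    moreover have "(\<integral>\<^sup>+x. (\<Sum>n. h (- int n) x) \<partial>lborel) < \<infinity>"
    proof (rule fin[where B = 1])
      fix n
      have "l powi - int n = inverse l ^ n" by (simp add: power_int_minus power_inverse)
      moreover have "exp (- c * (l powi - int n)\<^sup>2) \<le> 1" using c by simp
      ultimately show "l powi - int n * exp (- c * (l powi - int n)\<^sup>2) \<le> 1 * inverse l ^ n"
        using l_pos by (simp add: mult_left_le)
    qed simp
    ultimately show ?thesis by simp
  qed
  finally show "integrable lborel (\<lambda>z. exp (- c * (norm z)\<^sup>2) * f z)"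
    by (intro integrableI_bounded) simp_all
qed

sublocale gauss_integrable f by (rule gauss_integrable_f)

lemma hflow_dss: "hflow f ((l powi k)\<^sup>2 * t) ((l powi k) *\<^sub>R x) = hflow f t x / (l powi k)"
  by (intro hflow_rescale powi_pos f_powi_scale) measurable

lemma hgrad_dss: "hgrad f ((l powi k)\<^sup>2 * t) ((l powi k) *\<^sub>R x) = (1 / (l powi k)\<^sup>2) *\<^sub>R hgrad f t x"
  by (intro hgrad_rescale powi_pos f_powi_scale) measurable

text \<open>The Dirichlet energy is taken in the extended reals, since its finiteness is part of
what has to be proved.\<close>

definition dirichlet :: "real \<Rightarrow> ennreal" where
  "dirichlet t = (\<integral>\<^sup>+x. ennreal ((norm (hgrad f t x))\<^sup>2) \<partial>lborel)"

lemma dirichlet_dss: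
  assumes t: "t > 0"
  shows "dirichlet t = ennreal ((l powi k)\<^sup>2) * dirichlet ((l powi k)\<^sup>2 * t)"
proof -
  let ?c = "l powi k"
  have [measurable]: "hgrad f (?c\<^sup>2 * t) \<in> borel_measurable borel" "hgrad f t \<in> borel_measurable borel"
    by (intro hgrad_measurable mult_pos_pos zero_less_power t powi_pos)+
  have "dirichlet (?c\<^sup>2 * t) = ennreal (?c\<^sup>2) * (\<integral>\<^sup>+x. ennreal ((norm (hgrad f (?c\<^sup>2 * t) (?c *\<^sub>R x)))\<^sup>2) \<partial>lborel)"
    unfolding dirichlet_def by (rule nn_integral_plane_scale[OF powi_pos]) measurable
  also have "(\<integral>\<^sup>+x. ennreal ((norm (hgrad f (?c\<^sup>2 * t) (?c *\<^sub>R x)))\<^sup>2) \<partial>lborel) = (\<integral>\<^sup>+x. ennreal (1 / ?c ^ 4) * ennreal ((norm (hgrad f t x))\<^sup>2) \<partial>lborel)"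
    unfolding hgrad_dss power2_norm_scaleR using powi_pos[of k]
    by (intro nn_integral_cong) (simp add: ennreal_mult[symmetric] power_divide)
  also have "\<dots> = ennreal (1 / ?c ^ 4) * dirichlet t"
    unfolding dirichlet_def by (rule nn_integral_cmult) measurable
  finally have "ennreal (?c\<^sup>2) * dirichlet (?c\<^sup>2 * t) = ennreal (?c\<^sup>2 * (?c\<^sup>2 * (1 / ?c ^ 4))) * dirichlet t"
    using powi_pos[of k] by (simp only: ennreal_mult zero_le_power2 zero_le_divide_1_iff zero_le_even_power even_numeral mult_nonneg_nonneg mult.assoc)
  also have "?c\<^sup>2 * (?c\<^sup>2 * (1 / ?c ^ 4)) = 1"
    using powi_pos[of k] l_pos by (simp add: power2_eq_square power4_eq_xxxx)
  finally show ?thesis by simp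
qed

end

section \<open>Small times away from the origin\<close>

text \<open>After the parabolic substitution \<open>x = z + sqrt t w\<close> the kernel no longer depends on time and
dominated convergence applies.\<close>

lemma hflow_tendsto_continuous:
  assumes cont: "continuous_on UNIV \<phi>" and B: "\<And>x. \<bar>\<phi> x\<bar> \<le> B"
    and t: "\<And>k. t k > 0" "t \<longlonglongrightarrow> 0"
  shows "(\<lambda>k. hflow \<phi> (t k) z) \<longlonglongrightarrow> \<phi> z"
proof -
  let ?g = "\<lambda>s w. \<phi> (z + sqrt s *\<^sub>R w) * hk 1 (w - 0)"
  have [measurable]: "\<phi> \<in> borel_measurable borel"
    using cont by (rule borel_measurable_continuous_onI)
  have eq: "hflow \<phi> s z = (LINT w|lborel. ?g s w)" if s: "s > 0" for s
  proof -
    have "hflow \<phi> s z = s *\<^sub>R (LINT w|lborel. \<phi> (z + sqrt s *\<^sub>R w) * hk s (z - (z + sqrt s *\<^sub>R w)))"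
      unfolding hflow_def using s by (subst integral_lborel_affine[of "sqrt s" _ z]) simp_all
    also have "\<dots> = (LINT w|lborel. s *\<^sub>R (\<phi> (z + sqrt s *\<^sub>R w) * hk s (z - (z + sqrt s *\<^sub>R w))))"
      by (rule integral_scaleR_right[symmetric])
    also have "\<dots> = (LINT w|lborel. ?g s w)"
      using s by (intro Bochner_Integration.integral_cong) (auto simp: hk_def power_mult_distrib)
    finally show ?thesis .
  qed
  have "(\<lambda>k. LINT w|lborel. ?g (t k) w) \<longlonglongrightarrow> (LINT w|lborel. \<phi> z * hk 1 (w - 0))"
  proof (rule integral_dominated_convergence[where w = "\<lambda>w. B * hk 1 (w - 0)"])
    show "integrable lborel (\<lambda>w. B * hk 1 (w - 0))" by (intro integrable_mult_right integrable_hk) simp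
    show "AE w in lborel. norm (?g (t k) w) \<le> B * hk 1 (w - 0)" for k
      using hk_pos[of 1] by (auto simp: abs_mult less_imp_le intro!: mult_right_mono B)
    show "AE w in lborel. (\<lambda>k. ?g (t k) w) \<longlonglongrightarrow> \<phi> z * hk 1 (w - 0)"
    proof (rule AE_I2)
      fix w
      have "(\<lambda>k. z + sqrt (t k) *\<^sub>R w) \<longlonglongrightarrow> z + sqrt 0 *\<^sub>R w"
        by (intro tendsto_intros t)
      then have "(\<lambda>k. \<phi> (z + sqrt (t k) *\<^sub>R w)) \<longlonglongrightarrow> \<phi> (z + sqrt 0 *\<^sub>R w)"
        by (rule isCont_tendsto_compose[rotated]) (use cont in \<open>simp add: continuous_on_eq_continuous_at\<close>)
      then show "(\<lambda>k. ?g (t k) w) \<longlonglongrightarrow> \<phi> z * hk 1 (w - 0)"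
        by (intro tendsto_mult_right) simp
    qed
  qed measurable
  moreover have "(LINT w|lborel. \<phi> z * hk 1 (w - 0)) = \<phi> z"
    using integral_hk[of 1 0] by simp
  ultimately show ?thesis by (simp only: eq[OF t(1)])
qed

lemma hflow_bounded:
  assumes [measurable]: "\<phi> \<in> borel_measurable borel" and B: "\<And>x. \<bar>\<phi> x\<bar> \<le> B" and t: "t > 0"
  shows "\<bar>hflow \<phi> t z\<bar> \<le> B"
proof -
  have i: "integrable lborel (\<lambda>x. B * hk t (x - z))" using integrable_hk[OF t, of z] by simp
  have "norm (hflow \<phi> t z) \<le> (LINT x|lborel. norm (\<phi> x * hk t (z - x)))"
    unfolding hflow_def by (rule integral_norm_bound)
  also have "\<dots> \<le> (LINT x|lborel. B * hk t (x - z))"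
  proof (rule integral_mono[OF _ i])
    have *: "norm (\<phi> x * hk t (z - x)) \<le> B * hk t (x - z)" for x
      using hk_pos[OF t] by (auto simp: abs_mult hk_minus_commute[of t z] less_imp_le intro!: mult_right_mono B)
    show "integrable lborel (\<lambda>x. norm (\<phi> x * hk t (z - x)))"
      by (rule Bochner_Integration.integrable_bound[OF i]) (use * in \<open>auto intro: order_trans[OF _ abs_ge_self]\<close>)
    show "norm (\<phi> x * hk t (z - x)) \<le> B * hk t (x - z)" for x by (rule *)
  qed
  also have "\<dots> = B" using integral_hk[OF t, of z] by simp
  finally show ?thesis by simp
qed

text \<open>The heat kernel is symmetric; it is also bounded for fixed \<open>t\<close>, which makes the double integral
absolutely convergent for integrable functions.\<close>

lemma hflow_adjoint:
  assumes f: "integrable lborel f" and g: "integrable lborel g" and t: "t > 0"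
  shows "(LINT x|lborel. g x * hflow f t x) = (LINT z|lborel. f z * hflow g t z)"
proof -
  let ?I = "\<integral>\<^sup>+w. ennreal (norm (case w of (x, z) \<Rightarrow> g x * (f z * hk t (x - z)))) \<partial>(lborel \<Otimes>\<^sub>M lborel)"
  let ?F = "\<lambda>x z. g x * (f z * hk t (x - z))"
  have [measurable]: "f \<in> borel_measurable borel" "g \<in> borel_measurable borel"
    using f g by auto
  have le: "hk t y \<le> 1 / (4 * pi * t)" for y
    using t by (simp add: hk_def divide_simps)
  have nn: "0 \<le> hk t y" for y using hk_pos[OF t, of y] by simp
  have "integrable (lborel \<Otimes>\<^sub>M lborel) (\<lambda>(x, z). ?F x z)"
  proof (rule integrableI_bounded)
    show "(\<lambda>(x, z). ?F x z) \<in> borel_measurable (lborel \<Otimes>\<^sub>M lborel)" by measurable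
    have "?I
       = (\<integral>\<^sup>+x. \<integral>\<^sup>+z. ennreal (norm (?F x z)) \<partial>lborel \<partial>lborel)"
      by (subst lborel.nn_integral_fst[symmetric]) simp_all
    also have "\<dots> \<le> (\<integral>\<^sup>+x. \<integral>\<^sup>+z. ennreal (norm (g x) / (4 * pi * t)) * ennreal (norm (f z)) \<partial>lborel \<partial>lborel)"
    proof (intro nn_integral_mono)
      fix x z
      have "norm (?F x z) = \<bar>g x\<bar> * (\<bar>f z\<bar> * hk t (x - z))" using nn by (simp add: abs_mult)
      also have "\<dots> \<le> \<bar>g x\<bar> * (\<bar>f z\<bar> * (1 / (4 * pi * t)))" by (intro mult_left_mono le) auto
      finally show "ennreal (norm (?F x z)) \<le> ennreal (norm (g x) / (4 * pi * t)) * ennreal (norm (f z))"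
        using t by (subst ennreal_mult[symmetric]) (auto intro!: ennreal_leI simp: mult_ac)
    qed
    also have "\<dots> = (\<integral>\<^sup>+x. ennreal (norm (g x / (4 * pi * t))) \<partial>lborel) * (\<integral>\<^sup>+z. ennreal (norm (f z)) \<partial>lborel)"
      using t by (simp add: nn_integral_cmult nn_integral_multc abs_mult)
    also have "\<dots> < \<infinity>"
    proof -
      have "integrable lborel (\<lambda>x. g x / (4 * pi * t))" using g by simp
      then show ?thesis using f unfolding integrable_iff_bounded by (simp add: ennreal_mult_less_top)
    qed
    finally show "?I < \<infinity>" .
  qed
  then have "(LINT z|lborel. LINT x|lborel. ?F x z) = (LINT x|lborel. LINT z|lborel. ?F x z)"
    by (rule lborel_pair.Fubini_integral)
  moreover have "(LINT x|lborel. ?F x z) = f z * hflow g t z" for z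
    unfolding hflow_def by (subst integral_mult_right_zero[symmetric]) (simp add: hk_minus_commute[of t z] mult_ac)
  moreover have "(LINT z|lborel. ?F x z) = g x * hflow f t x" for x
    unfolding hflow_def by simp
  ultimately show ?thesis by (simp only:)
qed

lemma (in gauss_integrable) restrict:
  assumes [measurable]: "S \<in> sets borel"
  shows "gauss_integrable (\<lambda>z. indicator S z * f z)"
proof
  fix c :: real assume c: "c > 0"
  have "integrable lborel (\<lambda>z. indicator S z *\<^sub>R (exp (- c * (norm z)\<^sup>2) * f z))"
    by (intro integrable_mult_indicator f_integrable c) simp
  then show "integrable lborel (\<lambda>z. exp (- c * (norm z)\<^sup>2) * (indicator S z * f z))"
    by (simp add: mult_ac)
qed measurable

context dss_L2 begin

text \<open>The annulus on which the energy balance is evaluated, and a larger one around it. Data outside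
\<open>ring\<close> influence the flow on \<open>K\<close> only through the Gaussian tail, so for small times only
finitely many shells matter.\<close>

definition K :: "plane set" where "K = {x. 1 / l \<le> norm x \<and> norm x \<le> l}"

definition ring :: "plane set" where "ring = {x. l powi (-2) \<le> norm x \<and> norm x < l powi 2}"

lemma ring_measurable [measurable]: "ring \<in> sets borel"
  unfolding ring_def by measurable

lemma compact_K: "compact K"
proof -
  have "K = cball 0 l - ball 0 (1 / l)" by (auto simp: K_def)
  then show ?thesis by (simp add: compact_diff)
qed

lemma K_subset_ring: "K \<subseteq> ring"
proof -
  have "l * 1 < l * l" using l_gt_1 by (intro mult_strict_left_mono) auto
  moreover have "1 / l * (1 / l) \<le> 1 / l * 1" using l_gt_1 by (intro mult_left_mono) auto
  ultimately show ?thesis by (auto simp: K_def ring_def power_int_minus power2_eq_square inverse_eq_divide)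
qed

definition near :: "plane \<Rightarrow> real" where "near z = indicator ring z * f z"
definition far :: "plane \<Rightarrow> real" where "far z = indicator (- ring) z * f z"

sublocale near: gauss_integrable near
  unfolding near_def[abs_def] by (rule restrict) measurable

sublocale far: gauss_integrable far
  unfolding far_def[abs_def] by (rule restrict) measurable

lemma hflow_near_far: "t > 0 \<Longrightarrow> hflow f t x = hflow near t x + hflow far t x"
proof -
  assume t: "t > 0"
  have "f z = near z + far z" for z by (simp add: near_def far_def indicator_def)
  then have "hflow f t x = (LINT z|lborel. near z * hk t (x - z) + far z * hk t (x - z))"
    unfolding hflow_def by (simp add: distrib_right[symmetric])
  then show ?thesis
    unfolding hflow_def using near.integrable_hk_times[OF t] far.integrable_hk_times[OF t] by simp
qed

lemma near_L2: "(\<integral>\<^sup>+z. ennreal ((near z)\<^sup>2) \<partial>lborel) \<le> 4 * mass"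
proof -
  let ?S = "\<lambda>z. \<Sum>k\<in>{-2, -1, 0, 1}. indicator (shell k) z * ennreal ((f z)\<^sup>2)"
  have "(\<integral>\<^sup>+z. ennreal ((near z)\<^sup>2) \<partial>lborel) \<le>
     (\<integral>\<^sup>+z. ?S z \<partial>lborel)"
  proof (rule nn_integral_mono)
    fix z
    show "ennreal ((near z)\<^sup>2) \<le> ?S z"
    proof (cases "z \<in> ring")
      case True
      then have "z \<in> shell (-2) \<or> z \<in> shell (-1) \<or> z \<in> shell 0 \<or> z \<in> shell 1"
        by (auto simp: ring_def shell_def)
      then obtain k where k: "k \<in> {-2, -1, 0, 1::int}" "z \<in> shell k" by auto
      have "ennreal ((near z)\<^sup>2) = indicator (shell k) z * ennreal ((f z)\<^sup>2)"
        using True k by (simp add: near_def)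
      also have "\<dots> \<le> ?S z"
        using k by (intro member_le_sum) auto
      finally show ?thesis .
    qed (simp add: near_def)
  qed
  also have "\<dots> = (\<Sum>k\<in>{-2, -1, 0, 1::int}. \<integral>\<^sup>+z. indicator (shell k) z * ennreal ((f z)\<^sup>2) \<partial>lborel)"
    by (rule nn_integral_sum) measurable
  also have "\<dots> = 4 * mass" by (simp add: nn_integral_shell_sq)
  finally show ?thesis .
qed

lemma near_sq_integrable: "integrable lborel (\<lambda>z. (near z)\<^sup>2)"
  using near_L2 by (intro integrableI_bounded) (auto simp: mass_eq ennreal_mult_less_top intro: order.strict_trans1)

lemma near_integrable: "integrable lborel near"
proof -
  show ?thesis
  proof (rule Bochner_Integration.integrable_bound[OF Bochner_Integration.integrable_add[OF integrable_indicator_bounded[of 1 "l powi 2"] near_sq_integrable]])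
    have "norm (near z) \<le> norm (1 * indicator (cball 0 (l powi 2)) z + (near z)\<^sup>2)" for z
    proof (cases "z \<in> ring")
      case True
      then have "z \<in> cball 0 (l powi 2)" by (simp add: ring_def)
      then show ?thesis using le_one_plus_sq[of "\<bar>near z\<bar>"] by simp
    qed (simp add: near_def)
    then show "AE z in lborel. norm (near z) \<le> norm (1 * indicator (cball 0 (l powi 2)) z + (near z)\<^sup>2)" by simp
  qed measurable
qed

text \<open>A lower bound proportional to \<open>1 + norm z\<close> is needed to keep enough Gaussian decay at infinity
and, at the same time, a fixed distance that gives smallness for small times. The constant is
dictated by the points inside the hole of \<open>ring\<close>.\<close>

lemma dist_K_far:
  assumes x: "x \<in> K" and z: "z \<notin> ring"
  shows "norm (x - z) \<ge> (l - 1) / (2 * l\<^sup>2) * (1 + norm z)"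
proof -
  have l2: "l powi (-2) = 1 / l\<^sup>2" "l powi 2 = l\<^sup>2" by (simp_all add: power_int_minus inverse_eq_divide)
  have lp: "l > 0" using l_pos .
  consider "norm z < 1 / l\<^sup>2" | "norm z \<ge> l\<^sup>2" using z by (auto simp: ring_def l2)
  then show ?thesis
  proof cases
    case 1
    have "1 / l\<^sup>2 \<le> 1" using l_gt_1 by (simp add: divide_simps)
    then have "1 + norm z \<le> 2" using 1 by linarith
    then have "(l - 1) / (2 * l\<^sup>2) * (1 + norm z) \<le> (l - 1) / (2 * l\<^sup>2) * 2"
      using l_gt_1 by (intro mult_left_mono) auto
    also have "\<dots> = 1 / l - 1 / l\<^sup>2" using lp by (simp add: field_simps power2_eq_square)
    also have "\<dots> \<le> norm x - norm z" using x 1 by (simp add: K_def)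
    also have "\<dots> \<le> norm (x - z)" by (rule norm_triangle_ineq2)
    finally show ?thesis .
  next
    case 2
    have l1: "1 \<le> l\<^sup>2" "l \<le> l\<^sup>2" using l_gt_1 by (simp, simp add: power2_eq_square)
    then have "1 + norm z \<le> 2 * norm z" using 2 by linarith
    then have "(l - 1) / (2 * l\<^sup>2) * (1 + norm z) \<le> (l - 1) / (2 * l\<^sup>2) * (2 * norm z)"
      using l_gt_1 by (intro mult_left_mono) auto
    also have "\<dots> = (l - 1) / l\<^sup>2 * norm z" using lp by simp
    also have "\<dots> \<le> (l - 1) / l * norm z"
      using l1 l_gt_1 by (intro mult_right_mono divide_left_mono) auto
    also have "\<dots> = norm z - norm z / l" using lp by (simp add: field_simps)
    also have "\<dots> \<le> norm z - norm x"
    proof -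
      have "norm x \<le> l\<^sup>2 / l" using x lp by (simp add: K_def power2_eq_square)
      also have "\<dots> \<le> norm z / l" using 2 lp by (intro divide_right_mono) auto
      finally show ?thesis by simp
    qed
    also have "\<dots> \<le> norm (x - z)" by (subst norm_minus_commute) (rule norm_triangle_ineq2)
    finally show ?thesis .
  qed
qed

text \<open>Part of the exponent gives \<open>exp (- a / t)\<close>, which is \<open>O(t\<^sup>2)\<close> and beats the factor \<open>1 / t\<close> of the
kernel; the other part leaves a fixed Gaussian weight against which \<open>f\<close> is integrable.\<close>

lemma hflow_far_small:
  obtains B where "B \<ge> 0" "\<And>t x. 0 < t \<Longrightarrow> t \<le> 1 \<Longrightarrow> x \<in> K \<Longrightarrow> \<bar>hflow far t x\<bar> \<le> B * t"
proof -
  define a where "a = ((l - 1) / (2 * l\<^sup>2))\<^sup>2 / 4"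
  have a: "a > 0" using l_gt_1 by (simp add: a_def)
  let ?w = "\<lambda>z. \<bar>exp (- a * (norm z)\<^sup>2) * f z\<bar>"
  define W where "W = (LINT z|lborel. ?w z)"
  have iW: "integrable lborel (\<lambda>z. ?w z)"
    by (intro integrable_abs f_integrable a)
  have W: "W \<ge> 0" unfolding W_def by (rule integral_nonneg_AE) simp
  \<comment> \<open>This is the constant in \<open>exp (- a / t) / (4 pi t) \<le> A t\<close>.\<close>
  define A where "A = 2 / (a\<^sup>2 * (4 * pi))"
  have A: "A \<ge> 0" by (simp add: A_def)
  have bound: "\<bar>hflow far t x\<bar> \<le> A * W * t" if t: "0 < t" "t \<le> 1" and x: "x \<in> K" for t x
  proof -
    have hk_le: "hk t (x - z) \<le> A * t * exp (- a * (norm z)\<^sup>2)" if z: "z \<notin> ring" for z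
    proof -
      have "((l - 1) / (2 * l\<^sup>2) * (1 + norm z))\<^sup>2 \<le> (norm (x - z))\<^sup>2"
        using l_gt_1 by (intro power_mono dist_K_far x z) auto
      moreover have "4 * a * (1 + norm z)\<^sup>2 = ((l - 1) / (2 * l\<^sup>2) * (1 + norm z))\<^sup>2"
        by (simp add: a_def power_mult_distrib power_divide)
      moreover have "4 * a * (1 + (norm z)\<^sup>2) \<le> 4 * a * (1 + norm z)\<^sup>2"
        using a by (intro mult_left_mono) (auto simp: power2_sum)
      ultimately have "4 * a * (1 + (norm z)\<^sup>2) \<le> (norm (x - z))\<^sup>2" by linarith
      then have "a * (1 + (norm z)\<^sup>2) / t \<le> (norm (x - z))\<^sup>2 / (4 * t)"
        using divide_right_mono[of "4 * a * (1 + (norm z)\<^sup>2)" "(norm (x - z))\<^sup>2" "4 * t"] t by (simp add: mult.assoc)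
      moreover have "a * (norm z)\<^sup>2 \<le> a * (norm z)\<^sup>2 / t"
        using t a by (simp add: le_divide_eq mult_left_le)
      moreover have "a * (1 + (norm z)\<^sup>2) / t = a / t + a * (norm z)\<^sup>2 / t"
        by (simp add: add_divide_distrib distrib_left)
      ultimately have "exp (- (norm (x - z))\<^sup>2 / (4 * t)) \<le> exp (- (a / t) + - (a * (norm z)\<^sup>2))"
        by simp
      also have "\<dots> = exp (- (a / t)) * exp (- a * (norm z)\<^sup>2)" by (subst exp_add) simp
      also have "\<dots> \<le> 2 * t\<^sup>2 / a\<^sup>2 * exp (- a * (norm z)\<^sup>2)"
      proof (rule mult_right_mono)
        have p: "a / t > 0" using a t by simp
        have "(a / t)\<^sup>2 / 2 \<le> exp (a / t)"
          using exp_lower_Taylor_quadratic[of "a / t"] p by linarith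
        then have "inverse (exp (a / t)) \<le> inverse ((a / t)\<^sup>2 / 2)"
          using p by (intro le_imp_inverse_le) auto
        then show "exp (- (a / t)) \<le> 2 * t\<^sup>2 / a\<^sup>2"
          by (simp add: exp_minus power_divide mult.commute)
      qed simp
      finally have "hk t (x - z) \<le> 2 * t\<^sup>2 / a\<^sup>2 * exp (- a * (norm z)\<^sup>2) / (4 * pi * t)"
        unfolding hk_def using t by (intro divide_right_mono) auto
      also have "\<dots> = A * t * exp (- a * (norm z)\<^sup>2)"
        using t by (simp add: A_def power2_eq_square)
      finally show ?thesis .
    qed
    have "norm (hflow far t x) \<le> (LINT z|lborel. norm (far z * hk t (x - z)))"
      unfolding hflow_def by (rule integral_norm_bound)
    also have "\<dots> \<le> (LINT z|lborel. A * t * ?w z)"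
    proof (rule integral_mono)
      show "integrable lborel (\<lambda>z. norm (far z * hk t (x - z)))"
        by (intro integrable_norm far.integrable_hk_times t)
      show "integrable lborel (\<lambda>z. A * t * ?w z)"
        by (intro integrable_mult_right iW)
      show "norm (far z * hk t (x - z)) \<le> A * t * ?w z" for z
      proof (cases "z \<in> ring")
        case True
        then show ?thesis using A t by (simp add: far_def)
      next
        case False
        have "norm (far z * hk t (x - z)) = \<bar>f z\<bar> * hk t (x - z)"
          using False hk_pos[OF t(1), of "x - z"] by (simp add: far_def abs_mult)
        also have "\<dots> \<le> \<bar>f z\<bar> * (A * t * exp (- a * (norm z)\<^sup>2))"
          by (intro mult_left_mono hk_le False) simp
        finally show ?thesis by (simp add: abs_mult mult_ac)
      qed
    qed
    also have "\<dots> = A * W * t" by (simp add: W_def)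
    finally show ?thesis by simp
  qed
  show ?thesis using that[of "A * W"] A W bound by simp
qed

definition rmass :: real where
  "rmass = (LINT x|lborel. indicator (annulus l) x * (f x)\<^sup>2)"

lemma rmass_nonneg: "rmass \<ge> 0"
  unfolding rmass_def by (rule integral_nonneg_AE) simp

lemma mass_rmass: "mass = ennreal rmass"
  by (simp add: mass_eq rmass_def)

lemma integrable_K_sq: "t > 0 \<Longrightarrow> integrable lborel (\<lambda>x. indicator K x * (hflow f t x)\<^sup>2)"
proof -
  assume t: "t > 0"
  have "continuous_on K (\<lambda>x. (hflow f t x)\<^sup>2)"
    by (intro continuous_intros hflow_cont t)
  from borel_integrable_compact[OF compact_K this] show ?thesis by simp
qed

text \<open>The near part is controlled by the \<open>L\<^sup>2\<close> contraction and the mass of the four shells in \<open>ring\<close>;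
the factor 2 from squaring a sum gives \<open>8 rmass\<close>. The constant \<open>B\<close> may depend on \<open>f\<close>, since
\<open>t\<close> will tend to 0.\<close>

lemma hflow_L2_K:
  obtains B where "B \<ge> 0"
    "\<And>t. 0 < t \<Longrightarrow> t \<le> 1 \<Longrightarrow> (LINT x|lborel. indicator K x * (hflow f t x)\<^sup>2) \<le> 8 * rmass + B * t"
proof -
  let ?N = "\<lambda>t. \<integral>\<^sup>+x. ennreal ((hflow near t x)\<^sup>2) \<partial>lborel"
  let ?U = "\<lambda>t. LINT x|lborel. indicator K x * (hflow f t x)\<^sup>2"
  obtain B where B: "B \<ge> 0" "\<And>t x. 0 < t \<Longrightarrow> t \<le> 1 \<Longrightarrow> x \<in> K \<Longrightarrow> \<bar>hflow far t x\<bar> \<le> B * t"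
    using hflow_far_small by blast
  have [measurable]: "K \<in> sets borel" using compact_K by (intro borel_compact)
  define V where "V = measure lborel K"
  have V: "emeasure lborel K = ennreal V" "V \<ge> 0"
    unfolding V_def using emeasure_bounded_finite[OF compact_imp_bounded[OF compact_K]]
    by (auto simp: emeasure_eq_ennreal_measure less_top)
  have "(?U t) \<le> 8 * rmass + 2 * B\<^sup>2 * V * t"
    if t: "0 < t" "t \<le> 1" for t
  proof -
    have [measurable]: "hflow near t \<in> borel_measurable borel" using t by (intro near.hflow_measurable)
    have "ennreal (?U t) = (\<integral>\<^sup>+x. ennreal (indicator K x * (hflow f t x)\<^sup>2) \<partial>lborel)"
      by (rule nn_integral_eq_integral[symmetric]) (use integrable_K_sq[OF t(1)] in auto)
    also have "\<dots> \<le> (\<integral>\<^sup>+x. 2 * ennreal ((hflow near t x)\<^sup>2) + ennreal (2 * B\<^sup>2 * t) * indicator K x \<partial>lborel)"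
    proof (rule nn_integral_mono)
      fix x
      show "ennreal (indicator K x * (hflow f t x)\<^sup>2) \<le> 2 * ennreal ((hflow near t x)\<^sup>2) + ennreal (2 * B\<^sup>2 * t) * indicator K x"
      proof (cases "x \<in> K")
        case True
        define p q where "p = hflow near t x" and "q = hflow far t x"
        have "\<bar>q\<bar> \<le> B * t" using B(2)[OF t True] by (simp add: q_def)
        then have "q\<^sup>2 \<le> (B * t)\<^sup>2" by (metis abs_ge_zero power2_abs power_mono)
        also have "\<dots> = B\<^sup>2 * (t * t)" by (simp add: power2_eq_square mult_ac)
        also have "\<dots> \<le> B\<^sup>2 * t" using t by (intro mult_left_mono) (auto intro: mult_left_le)
        finally have q: "q\<^sup>2 \<le> B\<^sup>2 * t" .
        have "0 \<le> (p - q)\<^sup>2" by simp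
        then have "(p + q)\<^sup>2 \<le> 2 * p\<^sup>2 + 2 * B\<^sup>2 * t" using q unfolding power2_sum power2_diff by linarith
        then have "ennreal ((p + q)\<^sup>2) \<le> ennreal (2 * p\<^sup>2 + 2 * B\<^sup>2 * t)" by (rule ennreal_leI)
        also have "\<dots> = 2 * ennreal (p\<^sup>2) + ennreal (2 * B\<^sup>2 * t)"
          using t by (subst ennreal_plus) (simp_all add: ennreal_mult)
        finally show ?thesis using True hflow_near_far[OF t(1), of x] by (simp add: p_def q_def)
      qed simp
    qed
    also have "\<dots> = 2 * ?N t + ennreal (2 * B\<^sup>2 * t) * emeasure lborel K"
      by (subst nn_integral_add) (simp_all add: nn_integral_cmult)
    also have "\<dots> \<le> 2 * (4 * mass) + ennreal (2 * B\<^sup>2 * t) * ennreal V"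
    proof -
      have "?N t \<le> (\<integral>\<^sup>+z. ennreal ((near z)\<^sup>2) \<partial>lborel)"
        using L2_hk_average_le[OF t(1) near.f_measurable] by (simp add: hflow_def mult.commute)
      also have "\<dots> \<le> 4 * mass" by (rule near_L2)
      finally show ?thesis unfolding V(1) by (intro add_mono mult_left_mono) auto
    qed
    also have "\<dots> = ennreal (8 * rmass + 2 * B\<^sup>2 * V * t)"
    proof -
      have "2 * (4 * mass) = ennreal (8 * rmass)"
        using rmass_nonneg by (simp add: mass_rmass ennreal_mult mult.assoc[symmetric])
      moreover have "ennreal (2 * B\<^sup>2 * t) * ennreal V = ennreal (2 * B\<^sup>2 * V * t)"
        using t V(2) by (subst ennreal_mult[symmetric]) (auto simp: mult_ac)
      ultimately show ?thesis using t V(2) rmass_nonneg by (subst ennreal_plus) auto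
    qed
    finally show ?thesis
      using t V(2) rmass_nonneg by (subst (asm) ennreal_le_iff) auto
  qed
  then show ?thesis using that[of "2 * B\<^sup>2 * V"] V(2) by simp
qed

lemma supported_in_K_bounded:
  fixes \<phi> :: "plane \<Rightarrow> real"
  assumes cont: "continuous_on UNIV \<phi>" and supp: "\<And>x. x \<notin> K \<Longrightarrow> \<phi> x = 0"
  obtains B where "B > 0" "\<And>x. \<bar>\<phi> x\<bar> \<le> B"
proof -
  have "bounded (\<phi> ` K)"
    by (intro compact_imp_bounded compact_continuous_image continuous_on_subset[OF cont] compact_K) simp
  then obtain B where "B > 0" "\<And>x. x \<in> K \<Longrightarrow> \<bar>\<phi> x\<bar> \<le> B"
    unfolding bounded_pos by auto
  then have "\<bar>\<phi> x\<bar> \<le> B" for x using supp[of x] by (cases "x \<in> K") auto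
  with \<open>B > 0\<close> show ?thesis using that by blast
qed

lemma supported_in_K_integrable:
  fixes \<phi> :: "plane \<Rightarrow> real"
  assumes "continuous_on UNIV \<phi>" and "\<And>x. x \<notin> K \<Longrightarrow> \<phi> x = 0"
  shows "integrable lborel \<phi>"
  by (rule integrable_compact_support[of _ l]) (use assms in \<open>auto simp: K_def\<close>)

text \<open>Weak convergence to the initial data: by symmetry of the kernel the flow can be moved to the
continuous test function, where it converges pointwise and boundedly.\<close>

lemma pairing_tendsto:
  assumes cont: "continuous_on UNIV \<phi>" and supp: "\<And>x. x \<notin> K \<Longrightarrow> \<phi> x = 0"
    and t: "\<And>k. 0 < t k" "\<And>k. t k \<le> 1" "t \<longlonglongrightarrow> 0"
  shows "(\<lambda>k. LINT x|lborel. \<phi> x * hflow f (t k) x) \<longlonglongrightarrow> (LINT x|lborel. \<phi> x * f x)"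
proof -
  let ?P = "LINT x|lborel. \<bar>\<phi> x\<bar>"
  let ?N = "\<lambda>k. LINT x|lborel. \<phi> x * hflow near (t k) x"
  let ?F = "\<lambda>k. LINT x|lborel. \<phi> x * hflow far (t k) x"
  obtain B where B: "B > 0" "\<And>x. \<bar>\<phi> x\<bar> \<le> B" using supported_in_K_bounded[OF cont supp] by blast
  obtain C where C: "C \<ge> 0" "\<And>t x. 0 < t \<Longrightarrow> t \<le> 1 \<Longrightarrow> x \<in> K \<Longrightarrow> \<bar>hflow far t x\<bar> \<le> C * t"
    using hflow_far_small by blast
  have i\<phi>: "integrable lborel \<phi>" by (rule supported_in_K_integrable[OF cont supp])
  have [measurable]: "\<phi> \<in> borel_measurable borel" using i\<phi> by auto
  have meas[measurable]: "hflow \<phi> (t k) \<in> borel_measurable borel" for k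
    unfolding hflow_def[abs_def] by measurable
  have contn: "continuous_on UNIV (hflow near s)" "continuous_on UNIV (hflow far s)" if "s > 0" for s
    by (intro near.hflow_cont far.hflow_cont that)+
  have "(\<lambda>k. LINT z|lborel. near z * hflow \<phi> (t k) z) \<longlonglongrightarrow> (LINT z|lborel. near z * \<phi> z)"
  proof (rule integral_dominated_convergence[where w = "\<lambda>z. B * \<bar>near z\<bar>"])
    show "integrable lborel (\<lambda>z. B * \<bar>near z\<bar>)"
      by (intro integrable_mult_right integrable_abs near_integrable)
    show "AE z in lborel. (\<lambda>k. near z * hflow \<phi> (t k) z) \<longlonglongrightarrow> near z * \<phi> z"
      by (intro AE_I2 tendsto_mult_left hflow_tendsto_continuous[OF cont B(2)] t)
    show "AE z in lborel. norm (near z * hflow \<phi> (t k) z) \<le> B * \<bar>near z\<bar>" for k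
    proof (rule AE_I2)
      fix z
      have "\<bar>hflow \<phi> (t k) z\<bar> \<le> B" by (rule hflow_bounded) (use B t in auto)
      from mult_left_mono[OF this abs_ge_zero[of "near z"]]
      show "norm (near z * hflow \<phi> (t k) z) \<le> B * \<bar>near z\<bar>" by (simp add: abs_mult mult.commute)
    qed
  qed measurable
  moreover have "(LINT z|lborel. near z * hflow \<phi> (t k) z) = ?N k" for k
    by (rule hflow_adjoint[OF near_integrable i\<phi> t(1), symmetric])
  ultimately have 1: "(\<lambda>k. LINT x|lborel. \<phi> x * hflow near (t k) x) \<longlonglongrightarrow> (LINT z|lborel. near z * \<phi> z)"
    by (simp only:)
  have 2: "(\<lambda>k. ?F k) \<longlonglongrightarrow> 0"
  proof (rule tendsto_rabs_zero_cancel, rule tendsto_sandwich[of "\<lambda>_. 0"])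
    show "(\<lambda>k. (C * ?P) * t k) \<longlonglongrightarrow> 0"
      using tendsto_mult_left[OF t(3), of "C * ?P"] by simp
    have "\<bar>?F k\<bar> \<le> (C * ?P) * t k" for k
    proof -
      have "\<bar>?F k\<bar> \<le> (LINT x|lborel. \<bar>\<phi> x * hflow far (t k) x\<bar>)"
        by (rule integral_abs_bound)
      also have "\<dots> \<le> (LINT x|lborel. (C * t k) * \<bar>\<phi> x\<bar>)"
      proof (rule integral_mono)
        show "integrable lborel (\<lambda>x. \<bar>\<phi> x * hflow far (t k) x\<bar>)"
          by (intro integrable_abs supported_in_K_integrable continuous_intros cont contn t) (simp add: supp)
        show "integrable lborel (\<lambda>x. (C * t k) * \<bar>\<phi> x\<bar>)"
          by (intro integrable_mult_right integrable_abs i\<phi>)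
        show "\<bar>\<phi> x * hflow far (t k) x\<bar> \<le> (C * t k) * \<bar>\<phi> x\<bar>" for x
        proof (cases "x \<in> K")
          case True
          from mult_left_mono[OF C(2)[OF t(1,2) True] abs_ge_zero[of "\<phi> x"], of k]
          show ?thesis by (simp add: abs_mult mult_ac)
        qed (simp add: supp)
      qed
      finally show ?thesis by (simp add: mult_ac)
    qed
    then show "eventually (\<lambda>k. \<bar>?F k\<bar> \<le> (C * ?P) * t k) sequentially"
      by simp
  qed simp_all
  have "(LINT x|lborel. \<phi> x * hflow f (t k) x) = ?N k + ?F k" for k
  proof -
    have "integrable lborel (\<lambda>x. \<phi> x * hflow near (t k) x)" "integrable lborel (\<lambda>x. \<phi> x * hflow far (t k) x)"
      by (intro supported_in_K_integrable continuous_intros cont contn t; simp add: supp)+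
    then show ?thesis
      by (simp add: hflow_near_far[OF t(1)] distrib_left)
  qed
  moreover have "(LINT z|lborel. near z * \<phi> z) = (LINT x|lborel. \<phi> x * f x)"
  proof (rule Bochner_Integration.integral_cong)
    fix z show "near z * \<phi> z = \<phi> z * f z"
      using supp[of z] K_subset_ring by (cases "z \<in> K") (auto simp: near_def)
  qed simp
  ultimately show ?thesis using tendsto_add[OF 1 2] by simp
qed

text \<open>Expanding \<open>0 \<le> \<integral>\<psi> (u - g)\<^sup>2\<close> gives \<open>2 \<integral>\<psi> g u - \<integral>\<psi> g\<^sup>2 \<le> \<integral>\<psi> u\<^sup>2\<close>. In this
inequality \<open>g\<close> is first a fixed continuous function, so that the limit in \<open>t\<close> is the weak limit
above; then \<open>g\<close> approaches a truncation of \<open>f\<close>, and finally \<open>f\<close> itself, for which the left-hand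
side is \<open>\<integral>\<psi> f\<^sup>2\<close>.\<close>

lemma flow_L2_lower_semicontinuous:
  assumes cont: "continuous_on UNIV \<psi>" and supp: "\<And>x. x \<notin> K \<Longrightarrow> \<psi> x = 0" and nonneg: "\<And>x. 0 \<le> \<psi> x"
    and t: "\<And>k. 0 < t k" "\<And>k. t k \<le> 1" "t \<longlonglongrightarrow> 0"
    and L: "\<And>k. (LINT x|lborel. \<psi> x * (hflow f (t k) x)\<^sup>2) \<le> L k" "L \<longlonglongrightarrow> L0"
  shows "(LINT x|lborel. \<psi> x * (f x)\<^sup>2) \<le> L0"
proof -
  let ?J = "\<lambda>g. 2 * (LINT x|lborel. \<psi> x * g x * f x) - (LINT x|lborel. \<psi> x * (g x)\<^sup>2)"
  let ?Jk = "\<lambda>k g. 2 * (LINT x|lborel. \<psi> x * g x * hflow f (t k) x) - (LINT x|lborel. \<psi> x * (g x)\<^sup>2)"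
  obtain B where B: "B > 0" "\<And>x. \<bar>\<psi> x\<bar> \<le> B" using supported_in_K_bounded[OF cont supp] by blast
  have i\<psi>: "integrable lborel \<psi>" by (rule supported_in_K_integrable[OF cont supp])
  have [measurable]: "\<psi> \<in> borel_measurable borel" using i\<psi> by auto
  have near: "\<psi> x * f x = \<psi> x * near x" for x
    using supp[of x] K_subset_ring by (cases "x \<in> K") (auto simp: near_def)
  have near2: "\<psi> x * (f x)\<^sup>2 = \<psi> x * (near x)\<^sup>2" for x
    using supp[of x] K_subset_ring by (cases "x \<in> K") (auto simp: near_def)
  have i1: "integrable lborel (\<lambda>x. \<psi> x * \<bar>f x\<bar>)"
  proof (rule Bochner_Integration.integrable_bound[OF integrable_mult_right[OF near_integrable, of B]])
    have "norm (\<psi> x * \<bar>f x\<bar>) \<le> norm (B * near x)" for x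
    proof -
      have "norm (\<psi> x * \<bar>f x\<bar>) = \<bar>\<psi> x * f x\<bar>" by (simp add: abs_mult)
      also have "\<dots> = \<bar>\<psi> x\<bar> * \<bar>near x\<bar>" unfolding near by (rule abs_mult)
      also have "\<dots> \<le> B * \<bar>near x\<bar>" by (intro mult_right_mono B) simp
      finally show ?thesis using B(1) by (simp add: abs_mult)
    qed
    then show "AE x in lborel. norm (\<psi> x * \<bar>f x\<bar>) \<le> norm (B * near x)" by simp
  qed measurable
  have i2: "integrable lborel (\<lambda>x. \<psi> x * (f x)\<^sup>2)"
  proof (rule Bochner_Integration.integrable_bound[OF integrable_mult_right[OF near_sq_integrable, of B]])
    have "norm (\<psi> x * (f x)\<^sup>2) \<le> norm (B * (near x)\<^sup>2)" for x
      unfolding near2 using B by (simp add: abs_mult mult_right_mono)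
    then show "AE x in lborel. norm (\<psi> x * (f x)\<^sup>2) \<le> norm (B * (near x)\<^sup>2)" by simp
  qed measurable
  have test: "?J g \<le> L0"
    if g: "continuous_on UNIV g" for g
  proof (rule LIMSEQ_le[OF _ L(2)])
    have "(\<lambda>k. LINT x|lborel. \<psi> x * g x * hflow f (t k) x) \<longlonglongrightarrow> (LINT x|lborel. \<psi> x * g x * f x)"
      by (rule pairing_tendsto) (auto intro!: continuous_intros cont g t simp: supp)
    then show "(\<lambda>k. ?Jk k g)
        \<longlonglongrightarrow> ?J g"
      by (intro tendsto_intros)
    have "?Jk k g \<le> L k" for k
    proof -
      let ?u = "hflow f (t k)"
      have a: "integrable lborel (\<lambda>x. \<psi> x * g x * ?u x)" "integrable lborel (\<lambda>x. \<psi> x * (g x)\<^sup>2)"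
        "integrable lborel (\<lambda>x. \<psi> x * (?u x)\<^sup>2)"
        by (intro supported_in_K_integrable continuous_intros cont g hflow_cont t; simp add: supp)+
      have "0 \<le> (LINT x|lborel. \<psi> x * (?u x - g x)\<^sup>2)"
        by (rule integral_nonneg_AE) (simp add: nonneg)
      also have "\<dots> = (LINT x|lborel. \<psi> x * (?u x)\<^sup>2 - 2 * (\<psi> x * g x * ?u x) + \<psi> x * (g x)\<^sup>2)"
        by (simp add: power2_diff algebra_simps)
      also have "\<dots> = (LINT x|lborel. \<psi> x * (?u x)\<^sup>2) - 2 * (LINT x|lborel. \<psi> x * g x * ?u x) + (LINT x|lborel. \<psi> x * (g x)\<^sup>2)"
        using a by simp
      finally show ?thesis using L(1)[of k] by linarith
    qed
    then show "\<exists>N. \<forall>k\<ge>N. ?Jk k g \<le> L k"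
      by blast
  qed
  define clip where "clip M y = max (- M) (min M y)" for M y :: real
  have clip_abs: "\<bar>clip M y\<bar> \<le> M" if "M \<ge> 0" for M y using that by (auto simp: clip_def)
  have clip_le: "\<bar>clip M y\<bar> \<le> \<bar>y\<bar>" if "M \<ge> 0" for M y using that by (auto simp: clip_def)
  have clip_cont: "continuous_on UNIV (clip M)" for M unfolding clip_def by (intro continuous_intros)
  have [measurable]: "clip M \<in> borel_measurable borel" for M
    using clip_cont by (rule borel_measurable_continuous_onI)
  \<comment> \<open>A Lebesgue measurable function is an almost everywhere limit of continuous functions.\<close>
  have "f measurable_on UNIV"
    by (rule lebesgue_measurable_imp_measurable_on) (auto intro: measurable_completion)
  then obtain N g where N: "negligible N" "\<And>n. continuous_on UNIV (g n)"
    "\<And>x. x \<notin> N \<Longrightarrow> (\<lambda>n. g n x) \<longlonglongrightarrow> f x"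
    unfolding measurable_on_def by auto
  have "AE x in lebesgue. x \<notin> N" using N(1) by (intro AE_not_in) (simp add: negligible_iff_null_sets)
  then have AE_N: "AE x in lborel. x \<notin> N" by (simp add: AE_completion_iff)
  have [measurable]: "g n \<in> borel_measurable borel" for n using N(2) by (rule borel_measurable_continuous_onI)
  have clipped: "?J (\<lambda>x. clip M (f x)) \<le> L0"
    if M: "M \<ge> 0" for M
  proof (rule LIMSEQ_le_const2)
    have lim: "(\<lambda>n. clip M (g n x)) \<longlonglongrightarrow> clip M (f x)" if "x \<notin> N" for x
      by (rule isCont_tendsto_compose[OF _ N(3)[OF that]])
         (use clip_cont in \<open>simp add: continuous_on_eq_continuous_at\<close>)
    have "(\<lambda>n. LINT x|lborel. \<psi> x * clip M (g n x) * f x) \<longlonglongrightarrow> (LINT x|lborel. \<psi> x * clip M (f x) * f x)"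
    proof (rule integral_dominated_convergence[where w = "\<lambda>x. M * (\<psi> x * \<bar>f x\<bar>)"])
      show "AE x in lborel. (\<lambda>n. \<psi> x * clip M (g n x) * f x) \<longlonglongrightarrow> \<psi> x * clip M (f x) * f x"
        using AE_N by eventually_elim (intro tendsto_intros lim)
      have "\<psi> x * \<bar>f x\<bar> * \<bar>clip M (g n x)\<bar> \<le> \<psi> x * \<bar>f x\<bar> * M" for n x
        using nonneg by (intro mult_left_mono clip_abs M) auto
      then show "AE x in lborel. norm (\<psi> x * clip M (g n x) * f x) \<le> M * (\<psi> x * \<bar>f x\<bar>)" for n
        using nonneg by (intro AE_I2) (simp add: abs_mult mult_ac)
      show "integrable lborel (\<lambda>x. M * (\<psi> x * \<bar>f x\<bar>))" using i1 by simp
    qed measurable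
    moreover have "(\<lambda>n. LINT x|lborel. \<psi> x * (clip M (g n x))\<^sup>2) \<longlonglongrightarrow> (LINT x|lborel. \<psi> x * (clip M (f x))\<^sup>2)"
    proof (rule integral_dominated_convergence[where w = "\<lambda>x. M\<^sup>2 * \<psi> x"])
      show "AE x in lborel. (\<lambda>n. \<psi> x * (clip M (g n x))\<^sup>2) \<longlonglongrightarrow> \<psi> x * (clip M (f x))\<^sup>2"
        using AE_N by eventually_elim (intro tendsto_intros lim)
      have "\<psi> x * \<bar>clip M (g n x)\<bar>\<^sup>2 \<le> \<psi> x * M\<^sup>2" for n x
        using nonneg by (intro mult_left_mono power_mono clip_abs M) auto
      then show "AE x in lborel. norm (\<psi> x * (clip M (g n x))\<^sup>2) \<le> M\<^sup>2 * \<psi> x" for n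
        using nonneg by (intro AE_I2) (simp add: abs_mult mult_ac)
      show "integrable lborel (\<lambda>x. M\<^sup>2 * \<psi> x)" using i\<psi> by simp
    qed measurable
    ultimately show "(\<lambda>n. ?J (\<lambda>x. clip M (g n x)))
       \<longlonglongrightarrow> ?J (\<lambda>x. clip M (f x))"
      by (intro tendsto_intros)
    have "continuous_on UNIV (\<lambda>x. clip M (g n x))" for n
      by (rule continuous_on_compose2[OF clip_cont N(2)]) simp
    from test[OF this] show "\<exists>N. \<forall>n\<ge>N. ?J (\<lambda>x. clip M (g n x)) \<le> L0"
      by blast
  qed
  have "2 * (LINT x|lborel. \<psi> x * (f x)\<^sup>2) - (LINT x|lborel. \<psi> x * (f x)\<^sup>2) \<le> L0"
  proof (rule LIMSEQ_le_const2)
    have lim: "(\<lambda>n. clip (real n) y) \<longlonglongrightarrow> y" for y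
    proof (rule tendsto_eventually)
      show "eventually (\<lambda>n. clip (real n) y = y) sequentially"
        using eventually_ge_at_top[of "nat \<lceil>\<bar>y\<bar>\<rceil>"]
      proof eventually_elim
        case (elim n)
        then have "\<bar>y\<bar> \<le> real n" by linarith
        then show ?case by (auto simp: clip_def)
      qed
    qed
    have "(\<lambda>n. LINT x|lborel. \<psi> x * clip (real n) (f x) * f x) \<longlonglongrightarrow> (LINT x|lborel. \<psi> x * (f x)\<^sup>2)"
    proof (rule integral_dominated_convergence[where w = "\<lambda>x. \<psi> x * (f x)\<^sup>2"])
      show "AE x in lborel. (\<lambda>n. \<psi> x * clip (real n) (f x) * f x) \<longlonglongrightarrow> \<psi> x * (f x)\<^sup>2"
        unfolding power2_eq_square mult.assoc[symmetric] by (intro AE_I2 tendsto_intros lim)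
      have "\<psi> x * \<bar>f x\<bar> * \<bar>clip (real n) (f x)\<bar> \<le> \<psi> x * \<bar>f x\<bar> * \<bar>f x\<bar>" for n x
        using nonneg by (intro mult_left_mono clip_le) auto
      then show "AE x in lborel. norm (\<psi> x * clip (real n) (f x) * f x) \<le> \<psi> x * (f x)\<^sup>2" for n
        using nonneg by (intro AE_I2) (simp add: abs_mult mult_ac power2_eq_square)
    qed (use i2 in measurable)
    moreover have "(\<lambda>n. LINT x|lborel. \<psi> x * (clip (real n) (f x))\<^sup>2) \<longlonglongrightarrow> (LINT x|lborel. \<psi> x * (f x)\<^sup>2)"
    proof (rule integral_dominated_convergence[where w = "\<lambda>x. \<psi> x * (f x)\<^sup>2"])
      show "AE x in lborel. (\<lambda>n. \<psi> x * (clip (real n) (f x))\<^sup>2) \<longlonglongrightarrow> \<psi> x * (f x)\<^sup>2"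
        by (intro AE_I2 tendsto_intros lim)
      have "\<psi> x * \<bar>clip (real n) (f x)\<bar>\<^sup>2 \<le> \<psi> x * \<bar>f x\<bar>\<^sup>2" for n x
        using nonneg by (intro mult_left_mono power_mono clip_le) auto
      then show "AE x in lborel. norm (\<psi> x * (clip (real n) (f x))\<^sup>2) \<le> \<psi> x * (f x)\<^sup>2" for n
        using nonneg by (intro AE_I2) (simp add: abs_mult)
    qed (use i2 in measurable)
    ultimately show "(\<lambda>n. ?J (\<lambda>x. clip (real n) (f x)))
       \<longlonglongrightarrow> 2 * (LINT x|lborel. \<psi> x * (f x)\<^sup>2) - (LINT x|lborel. \<psi> x * (f x)\<^sup>2)"
      by (intro tendsto_intros)
    from clipped[OF of_nat_0_le_iff] show "\<exists>N. \<forall>n\<ge>N. ?J (\<lambda>x. clip (real n) (f x)) \<le> L0"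
      by blast
  qed
  then show ?thesis by simp
qed

end

section \<open>The energy drop over one period\<close>

text \<open>A continuously differentiable ramp. Composing two of them gives a cutoff that is flat both
inside the unit ball and outside the ball of radius \<open>l\<close>.\<close>

definition pos_sq :: "real \<Rightarrow> real" where "pos_sq s = (max 0 s)\<^sup>2"

lemma pos_sq_has_derivative: "(pos_sq has_real_derivative 2 * max 0 s) (at s)"
proof -
  consider "s < 0" | "s = 0" | "s > 0" by linarith
  then show ?thesis
  proof cases
    case 1
    have "((\<lambda>_. 0) has_real_derivative 2 * max 0 s) (at s)" using 1 by simp
    then show ?thesis
      by (rule has_field_derivative_transform_within_open[of _ _ _ "{..<0}"]) (use 1 in \<open>auto simp: pos_sq_def\<close>)
  next
    case 2
    have "isCont (max (0::real)) 0" by (intro continuous_intros)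
    then show ?thesis unfolding 2 CARAT_DERIV
      by (intro exI[of _ "max 0"]) (auto simp: pos_sq_def max_def power2_eq_square)
  next
    case 3
    have "((\<lambda>s. s\<^sup>2) has_real_derivative 2 * max 0 s) (at s)"
      using 3 by (auto intro!: derivative_eq_intros)
    then show ?thesis
      by (rule has_field_derivative_transform_within_open[of _ _ _ "{0<..}"]) (use 3 in \<open>auto simp: pos_sq_def\<close>)
  qed
qed

context dss_L2 begin

definition etav :: "plane \<Rightarrow> real" where "etav x = (x \<bullet> x - 1) / (l\<^sup>2 - 1)"

definition eta :: "plane \<Rightarrow> real" where "eta x = pos_sq (1 - pos_sq (etav x))"

definition deta :: "plane \<Rightarrow> plane" where
  "deta x = (- (2 * max 0 (1 - pos_sq (etav x))) * (2 * max 0 (etav x)) * (2 / (l\<^sup>2 - 1))) *\<^sub>R x"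

lemma l2_gt_1: "l\<^sup>2 > 1"
  using l_gt_1 by simp

lemma etav_inside: "norm x \<le> 1 \<Longrightarrow> etav x \<le> 0"
  using power_mono[of "norm x" 1 2] l2_gt_1
  by (simp add: etav_def power2_norm_eq_inner[symmetric] divide_le_0_iff)

lemma pos_sq_etav_outside: "norm x \<ge> l \<Longrightarrow> pos_sq (etav x) \<ge> 1"
proof -
  assume "norm x \<ge> l"
  then have "l\<^sup>2 \<le> (norm x)\<^sup>2" using l_pos by (intro power_mono) auto
  then have "etav x \<ge> 1" using l2_gt_1 by (simp add: etav_def power2_norm_eq_inner[symmetric])
  then show ?thesis by (simp add: pos_sq_def)
qed

lemma eta_inside: "norm x \<le> 1 \<Longrightarrow> eta x = 1"
  using etav_inside[of x] by (simp add: eta_def pos_sq_def)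

lemma eta_outside: "norm x \<ge> l \<Longrightarrow> eta x = 0"
  using pos_sq_etav_outside[of x] by (simp add: eta_def pos_sq_def[of "1 - _"])

lemma eta_nonneg: "0 \<le> eta x" and eta_le_1: "eta x \<le> 1"
  by (auto simp: eta_def pos_sq_def intro!: power_le_one)

lemma eta_deriv: "(eta has_derivative (\<lambda>h. deta x \<bullet> h)) (at x)"
proof -
  have v: "(etav has_derivative (\<lambda>h. 2 / (l\<^sup>2 - 1) * (x \<bullet> h))) (at x)"
    unfolding etav_def[abs_def] using l2_gt_1
    by (auto intro!: derivative_eq_intros simp: inner_commute fun_eq_iff)
  have p: "(pos_sq has_derivative (\<lambda>y. (2 * max 0 s) * y)) (at s)" for s
    using pos_sq_has_derivative by (simp add: has_field_derivative_def)
  have 1: "((\<lambda>x. pos_sq (etav x)) has_derivative (\<lambda>h. (2 * max 0 (etav x)) * (2 / (l\<^sup>2 - 1) * (x \<bullet> h)))) (at x)"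
    by (rule has_derivative_compose[OF v p])
  have 2: "((\<lambda>x. 1 - pos_sq (etav x)) has_derivative (\<lambda>h. - ((2 * max 0 (etav x)) * (2 / (l\<^sup>2 - 1) * (x \<bullet> h))))) (at x)"
    by (rule derivative_eq_intros 1 refl)+ simp
  have "(eta has_derivative (\<lambda>h. (2 * max 0 (1 - pos_sq (etav x))) * - ((2 * max 0 (etav x)) * (2 / (l\<^sup>2 - 1) * (x \<bullet> h))))) (at x)"
    unfolding eta_def[abs_def] by (rule has_derivative_compose[OF 2 p])
  then show ?thesis by (simp add: deta_def mult.assoc)
qed

lemma deta_cont: "continuous_on UNIV deta"
  unfolding deta_def[abs_def] etav_def pos_sq_def using l2_gt_1 by (intro continuous_intros) auto

lemma deta_supp: "x \<notin> K \<Longrightarrow> deta x = 0"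
proof -
  assume "x \<notin> K"
  then have "norm x < 1 / l \<or> norm x > l" by (auto simp: K_def)
  moreover have "1 / l \<le> 1" using l_gt_1 by simp
  ultimately have "norm x \<le> 1 \<or> norm x \<ge> l" by linarith
  then show ?thesis
    using etav_inside[of x] pos_sq_etav_outside[of x] by (auto simp: deta_def)
qed

definition C_eta :: real where "C_eta = (8 * l / (l\<^sup>2 - 1))\<^sup>2"

lemma C_eta_nonneg: "C_eta \<ge> 0"
  by (simp add: C_eta_def)

text \<open>\<open>eta\<close> is the square of \<open>max 0 (1 - pos_sq (etav x))\<close>, and its gradient is that factor times a
quantity of size at most \<open>8 l / (l\<^sup>2 - 1)\<close>.\<close>

lemma deta_bound: "(norm (deta x))\<^sup>2 \<le> C_eta * eta x"
proof (cases "norm x < l \<and> 0 < 1 - pos_sq (etav x)")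
  case True
  define s v where "s = max 0 (1 - pos_sq (etav x))" and "v = max 0 (etav x)"
  have s: "0 \<le> s" and v: "0 \<le> v" by (auto simp: s_def v_def)
  have "v\<^sup>2 \<le> 1\<^sup>2" using True by (simp add: pos_sq_def v_def)
  then have v1: "v \<le> 1" by (rule power2_le_imp_le) simp
  have "norm (deta x) = s * (8 / (l\<^sup>2 - 1)) * (v * norm x)"
    using l2_gt_1 s v by (simp add: deta_def s_def[symmetric] v_def[symmetric] abs_mult)
  also have "\<dots> \<le> s * (8 / (l\<^sup>2 - 1)) * (1 * l)"
    using True s v v1 l2_gt_1 by (intro mult_left_mono mult_mono) auto
  finally have "(norm (deta x))\<^sup>2 \<le> (s * (8 / (l\<^sup>2 - 1)) * (1 * l))\<^sup>2" by (intro power_mono) auto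
  also have "\<dots> = C_eta * eta x"
    by (simp add: C_eta_def eta_def pos_sq_def s_def power_mult_distrib power_divide)
  finally show ?thesis .
next
  case False
  have "deta x = 0"
    using False pos_sq_etav_outside[of x] by (auto simp: deta_def not_less)
  then show ?thesis using eta_nonneg by (simp add: C_eta_def)
qed

sublocale cutoff_flow f eta deta K l C_eta
proof
  show "eta x = 0" if "norm x > l" for x using that by (intro eta_outside) simp
qed (auto intro: eta_deriv deta_cont eta_nonneg deta_bound deta_supp compact_K C_eta_nonneg)

definition psi :: "plane \<Rightarrow> real" where "psi x = eta x - eta (l *\<^sub>R x)"

lemma eta_measurable [measurable]: "eta \<in> borel_measurable borel"
  using cutoff_cont by (rule borel_measurable_continuous_onI)

lemma psi_cont: "continuous_on UNIV psi"
  unfolding psi_def[abs_def]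
  by (intro continuous_intros cutoff_cont continuous_on_compose2[OF cutoff_cont, of _ "\<lambda>x. l *\<^sub>R x"]) auto

lemma psi_nonneg: "0 \<le> psi x" and psi_le_1: "psi x \<le> 1"
proof -
  show "psi x \<le> 1" using eta_le_1[of x] eta_nonneg[of "l *\<^sub>R x"] by (simp add: psi_def)
  show "0 \<le> psi x"
  proof (cases "norm x \<le> 1")
    case True
    then show ?thesis using eta_inside eta_le_1[of "l *\<^sub>R x"] by (simp add: psi_def)
  next
    case False
    then have "norm (l *\<^sub>R x) \<ge> l" using l_gt_1 by simp
    then show ?thesis using eta_nonneg[of x] by (simp add: psi_def eta_outside)
  qed
qed

lemma psi_supp: "x \<notin> K \<Longrightarrow> psi x = 0"
proof -
  assume "x \<notin> K"
  then consider "norm x < 1 / l" | "norm x > l" unfolding K_def by force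
  then show ?thesis
  proof cases
    case 1
    then have "norm (l *\<^sub>R x) \<le> 1" using l_pos by (simp add: field_simps)
    moreover have "norm x \<le> 1"
    proof -
      have "1 / l \<le> 1" using l_gt_1 by simp
      with 1 show ?thesis by linarith
    qed
    ultimately show ?thesis by (simp add: psi_def eta_inside)
  next
    case 2
    then have "l * l \<le> l * norm x" using l_pos by (intro mult_left_mono) auto
    moreover have "l \<le> l * l" using l_gt_1 by simp
    ultimately have "norm (l *\<^sub>R x) \<ge> l" using l_pos by simp
    with 2 show ?thesis by (simp add: psi_def eta_outside)
  qed
qed

text \<open>\<open>psi\<close> equals \<open>eta\<close> on the annulus and \<open>1 - eta (l x)\<close> on the shell inside it. Moving the inner
shell onto the annulus by scaling, the two weights add up to 1.\<close>

lemma integral_psi_sq: "(LINT x|lborel. psi x * (f x)\<^sup>2) = rmass"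
proof -
  let ?A = "\<lambda>x. indicator (shell 0) x * ennreal (eta x * (f x)\<^sup>2)"
  let ?Ac = "\<lambda>x. indicator (shell 0) x * ennreal ((1 - eta x) * (f x)\<^sup>2)"
  let ?B = "\<lambda>x. indicator (shell (-1)) x * ennreal ((1 - eta (l *\<^sub>R x)) * (f x)\<^sup>2)"
  let ?Bs = "\<lambda>x. indicator (shell 0) x * (ennreal ((1 / l)\<^sup>2) * ennreal ((1 - eta (l *\<^sub>R ((1 / l) *\<^sub>R x))) * (f ((1 / l) *\<^sub>R x))\<^sup>2))"
  have [measurable]: "psi \<in> borel_measurable borel"
    using psi_cont by (rule borel_measurable_continuous_onI)
  have lm1: "l powi (-1) = 1 / l" by (simp add: power_int_minus inverse_eq_divide)
  have "(\<integral>\<^sup>+x. ennreal (psi x * (f x)\<^sup>2) \<partial>lborel) =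
     (\<integral>\<^sup>+x. ?A x + ?B x \<partial>lborel)"
  proof (rule nn_integral_cong)
    fix x
    have s0: "x \<in> shell 0 \<longleftrightarrow> 1 \<le> norm x \<and> norm x < l" and s1: "x \<in> shell (-1) \<longleftrightarrow> 1 / l \<le> norm x \<and> norm x < 1"
      by (simp_all add: shell_def inverse_eq_divide)
    consider "x \<in> shell 0" "x \<notin> shell (-1)" "psi x = eta x" | "x \<in> shell (-1)" "x \<notin> shell 0" "psi x = 1 - eta (l *\<^sub>R x)"
      | "x \<notin> shell 0" "x \<notin> shell (-1)" "psi x = 0"
    proof -
      consider "norm x \<ge> l" | "1 \<le> norm x" "norm x < l" | "1 / l \<le> norm x" "norm x < 1" | "norm x < 1 / l"
        by linarith
      then show ?thesis
      proof cases
        case 1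
        moreover have "l \<le> l * norm x" using 1 l_gt_1 by simp
        ultimately have "psi x = 0" using l_pos by (simp add: psi_def eta_outside)
        then show ?thesis using 1 l_gt_1 that(3) by (simp add: s0 s1)
      next
        case 2
        then have "norm (l *\<^sub>R x) \<ge> l" using l_pos by simp
        then show ?thesis using 2 that(1) by (simp add: s0 s1 psi_def eta_outside)
      next
        case 3
        then show ?thesis using that(2) by (simp add: s0 s1 psi_def eta_inside)
      next
        case 4
        then have "x \<notin> K" by (simp add: K_def)
        moreover have "1 / l \<le> 1" using l_gt_1 by simp
        ultimately show ?thesis using 4 that(3) by (auto simp: s0 s1 psi_supp)
      qed
    qed
    then show "ennreal (psi x * (f x)\<^sup>2) = ?A x +
        ?B x"
      by cases simp_all
  qed
  also have "\<dots> = (\<integral>\<^sup>+x. ?A x \<partial>lborel) +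
      (\<integral>\<^sup>+x. ?B x \<partial>lborel)"
    by (rule nn_integral_add) measurable
  also have "(\<integral>\<^sup>+x. ?B x \<partial>lborel) =
      (\<integral>\<^sup>+x. ?Bs x \<partial>lborel)"
    using nn_integral_shell[of "\<lambda>x. ennreal ((1 - eta (l *\<^sub>R x)) * (f x)\<^sup>2)" "-1"] unfolding lm1 by simp
  also have "\<dots> = (\<integral>\<^sup>+x. ?Ac x \<partial>lborel)"
  proof (rule nn_integral_cong)
    fix x
    show "?Bs x =
        ?Ac x"
    proof (cases "x \<in> shell 0")
      case True
      have "f ((1 / l) *\<^sub>R x) = l * f x"
        using f_powi_scale[OF shell_nonzero[OF True], of "-1"] by (simp add: inverse_eq_divide mult.commute)
      then show ?thesis
        using True l_pos eta_le_1[of x] by (simp add: ennreal_mult[symmetric] power_mult_distrib power_divide)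
    qed simp
  qed
  also have "(\<integral>\<^sup>+x. ?A x \<partial>lborel) + \<dots> =
      (\<integral>\<^sup>+x. ?A x + ?Ac x \<partial>lborel)"
    by (rule nn_integral_add[symmetric]) measurable
  also have "\<dots> = mass"
    unfolding mass_def
  proof (rule nn_integral_cong)
    fix x
    have "ennreal (eta x * (f x)\<^sup>2) + ennreal ((1 - eta x) * (f x)\<^sup>2) = ennreal ((f x)\<^sup>2)"
    proof -
      have a: "0 \<le> eta x * (f x)\<^sup>2" and b: "0 \<le> (1 - eta x) * (f x)\<^sup>2"
        using eta_nonneg[of x] eta_le_1[of x] by simp_all
      show ?thesis unfolding ennreal_plus[OF a b, symmetric] by (simp add: algebra_simps)
    qed
    then show "?A x + ?Ac x
        = indicator (shell 0) x * ennreal ((f x)\<^sup>2)"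
      by (cases "x \<in> shell 0") auto
  qed
  finally have "(\<integral>\<^sup>+x. ennreal (psi x * (f x)\<^sup>2) \<partial>lborel) = ennreal rmass" by (simp add: mass_rmass)
  then show ?thesis
    using rmass_nonneg psi_nonneg by (subst integral_eq_nn_integral) auto
qed

definition energy :: "real \<Rightarrow> real" where
  "energy t = (LINT x|lborel. eta x * (hflow f t x)\<^sup>2)"

definition energy' :: "real \<Rightarrow> real" where
  "energy' t = (LINT x|lborel. 2 * (eta x * (hflow f t x * hlap f t x)))"

text \<open>Scaling turns the energy at the end of a period into the energy at its beginning, measured
with the contracted cutoff.\<close>

lemma energy_drop:
  assumes t: "t > 0"
  shows "energy t - energy (l\<^sup>2 * t) = (LINT x|lborel. psi x * (hflow f t x)\<^sup>2)"
proof -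
  have t2: "l\<^sup>2 * t > 0" using t l_pos by simp
  have [measurable]: "hflow f (l\<^sup>2 * t) \<in> borel_measurable borel" by (rule hflow_measurable[OF t2])
  have contf: "continuous_on UNIV (hflow f t)" by (rule hflow_cont[OF t])
  have "energy (l\<^sup>2 * t) = l\<^sup>2 *\<^sub>R (LINT x|lborel. eta (0 + l *\<^sub>R x) * (hflow f (l\<^sup>2 * t) (0 + l *\<^sub>R x))\<^sup>2)"
    unfolding energy_def using l_pos by (subst integral_lborel_affine[of l _ 0]) simp_all
  also have "\<dots> = (LINT x|lborel. l\<^sup>2 *\<^sub>R (eta (0 + l *\<^sub>R x) * (hflow f (l\<^sup>2 * t) (0 + l *\<^sub>R x))\<^sup>2))"
    by (rule integral_scaleR_right[symmetric])
  also have "\<dots> = (LINT x|lborel. eta (l *\<^sub>R x) * (hflow f t x)\<^sup>2)"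
    using hflow_dss[of 1 t] l_pos
    by (intro Bochner_Integration.integral_cong) (auto simp: power_divide)
  finally have e: "energy (l\<^sup>2 * t) = (LINT x|lborel. eta (l *\<^sub>R x) * (hflow f t x)\<^sup>2)" .
  have i1: "integrable lborel (\<lambda>x. eta x * (hflow f t x)\<^sup>2)"
    by (intro integrable_cutoff_times continuous_intros contf)
  have i2: "integrable lborel (\<lambda>x. psi x * (hflow f t x)\<^sup>2)"
    by (intro supported_in_K_integrable continuous_intros psi_cont contf) (simp add: psi_supp)
  have "(LINT x|lborel. eta (l *\<^sub>R x) * (hflow f t x)\<^sup>2) = (LINT x|lborel. eta x * (hflow f t x)\<^sup>2 - psi x * (hflow f t x)\<^sup>2)"
    by (simp add: psi_def algebra_simps)
  also have "\<dots> = energy t - (LINT x|lborel. psi x * (hflow f t x)\<^sup>2)"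
    unfolding energy_def by (rule Bochner_Integration.integral_diff[OF i1 i2])
  finally show ?thesis unfolding e by simp
qed

lemma energy_mean_value:
  assumes t: "t > 0"
  shows "\<exists>\<tau>>t. \<tau> < l\<^sup>2 * t \<and> (LINT x|lborel. psi x * (hflow f t x)\<^sup>2) = (l\<^sup>2 - 1) * t * (- energy' \<tau>)"
proof -
  have "t < l\<^sup>2 * t" using t l2_gt_1 by simp
  moreover have "(energy has_real_derivative energy' s) (at s)" if "t \<le> s" for s
    unfolding energy_def[abs_def] energy'_def using that t by (intro energy_has_derivative) simp
  ultimately obtain \<tau> where "t < \<tau>" "\<tau> < l\<^sup>2 * t" "energy (l\<^sup>2 * t) - energy t = (l\<^sup>2 * t - t) * energy' \<tau>"
    using MVT2[of t "l\<^sup>2 * t" energy energy'] by blast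
  then show ?thesis
    unfolding energy_drop[OF t, symmetric] by (intro exI[of _ \<tau>]) (simp add: algebra_simps)
qed

lemma psi_sq_le_K:
  assumes t: "t > 0"
  shows "(LINT x|lborel. psi x * (hflow f t x)\<^sup>2) \<le> (LINT x|lborel. indicator K x * (hflow f t x)\<^sup>2)"
proof (rule integral_mono[OF _ integrable_K_sq[OF t]])
  show "integrable lborel (\<lambda>x. psi x * (hflow f t x)\<^sup>2)"
    by (intro supported_in_K_integrable continuous_intros psi_cont hflow_cont[OF t]) (simp add: psi_supp)
  show "psi x * (hflow f t x)\<^sup>2 \<le> indicator K x * (hflow f t x)\<^sup>2" for x
    using psi_supp[of x] psi_le_1[of x] by (intro mult_right_mono) (auto simp: indicator_def)
qed

lemma local_dirichlet_eq:
  assumes t: "t > 0"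
  shows "ennreal (LINT x|lborel. eta x * (norm (hgrad f t x))\<^sup>2) = (\<integral>\<^sup>+x. ennreal (eta x * (norm (hgrad f t x))\<^sup>2) \<partial>lborel)"
  by (rule nn_integral_eq_integral[symmetric])
     (auto intro: integrable_local_dirichlet t simp: eta_nonneg)

lemma dirichlet_powi:
  "ennreal ((l powi k)\<^sup>2) * dirichlet ((l powi k)\<^sup>2) = dirichlet 1"
  using dirichlet_dss[of 1 k] by simp

text \<open>Starting at exponent \<open>-1\<close> keeps the whole time interval from \<open>(zoom n)\<^sup>2\<close> to \<open>(l * zoom n)\<^sup>2\<close> inside
\<open>(0, 1]\<close>, where the estimates on \<open>K\<close> hold.\<close>

definition zoom :: "nat \<Rightarrow> real" where "zoom n = l powi (- int (Suc n))"

lemma zoom_pos: "zoom n > 0"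
  by (simp add: zoom_def powi_pos)

lemma zoom_eq: "zoom n = inverse l ^ Suc n"
  unfolding zoom_def by (simp only: power_int_minus power_int_of_nat power_inverse)

lemma zoom_lim: "zoom \<longlonglongrightarrow> 0"
  unfolding zoom_eq[abs_def] using l_gt_1
  by (intro LIMSEQ_Suc LIMSEQ_power_zero) (simp add: inverse_eq_divide)

definition eps :: "nat \<Rightarrow> real" where "eps n = (zoom n)\<^sup>2"

lemma eps_pos: "eps n > 0"
  using zoom_pos[of n] by (simp add: eps_def)

lemma eps_lim: "eps \<longlonglongrightarrow> 0"
  unfolding eps_def[abs_def] using tendsto_power[OF zoom_lim, of 2] by simp

lemma l_eps_le: "l\<^sup>2 * eps n \<le> 1"
proof -
  have "l * zoom n = inverse l ^ n" using l_pos by (simp add: zoom_eq)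
  also have "\<dots> \<le> 1" using l_gt_1 by (intro power_le_one) (auto simp: inverse_eq_divide)
  finally have "(l * zoom n)\<^sup>2 \<le> 1\<^sup>2" using l_pos zoom_pos[of n] by (intro power_mono) auto
  then show ?thesis by (simp add: eps_def power_mult_distrib)
qed

lemma eps_le: "eps n \<le> 1"
  using l_eps_le[of n] eps_pos[of n] l2_gt_1 mult_right_mono[of 1 "l\<^sup>2" "eps n"] by linarith

text \<open>The dissipation at the intermediate time bounds the Dirichlet energy inside the cutoff. Scaled
back by \<open>zoom n\<close>, the cutoff exhausts the plane while the times \<open>\<sigma> n\<close> stay in \<open>[1, l\<^sup>2]\<close>. Fatou's
lemma along a convergent subsequence bounds the full Dirichlet energy at some time in
this interval, hence at \<open>l\<^sup>2\<close> by monotonicity, hence at 1 by scaling.\<close>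

lemma dirichlet_upper: "dirichlet 1 \<le> ennreal (8 * l\<^sup>2 / (l\<^sup>2 - 1) * rmass)"
proof -
  let ?G = "\<lambda>t. LINT x|lborel. eta x * (norm (hgrad f t x))\<^sup>2"
  let ?Q = "\<lambda>t. LINT x|lborel. psi x * (hflow f t x)\<^sup>2"
  let ?U = "\<lambda>t. LINT x|lborel. indicator K x * (hflow f t x)\<^sup>2"
  obtain B where B: "B \<ge> 0"
    "\<And>t. 0 < t \<Longrightarrow> t \<le> 1 \<Longrightarrow> (LINT x|lborel. indicator K x * (hflow f t x)\<^sup>2) \<le> 8 * rmass + B * t"
    using hflow_L2_K by blast
  have "\<forall>n. \<exists>\<tau>. eps n < \<tau> \<and> \<tau> < l\<^sup>2 * eps n \<and>
      ?Q (eps n) = (l\<^sup>2 - 1) * eps n * (- energy' \<tau>)"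
    using energy_mean_value[OF eps_pos] by blast
  from choice[OF this] obtain \<tau> where \<tau>: "eps n < \<tau> n" "\<tau> n < l\<^sup>2 * eps n"
    "?Q (eps n) = (l\<^sup>2 - 1) * eps n * (- energy' (\<tau> n))" for n
    by blast
  have \<tau>_pos: "\<tau> n > 0" for n using \<tau>(1)[of n] eps_pos[of n] by linarith
  have \<tau>_le: "\<tau> n \<le> 1" for n using \<tau>(2)[of n] l_eps_le[of n] by linarith
  define \<sigma> where "\<sigma> n = \<tau> n / eps n" for n
  have \<sigma>: "\<sigma> n \<in> {1..l\<^sup>2}" for n
    using \<tau>(1,2)[of n] eps_pos[of n] by (simp add: \<sigma>_def divide_simps)
  have \<sigma>_pos: "\<sigma> n > 0" for n using \<sigma>[of n] by simp
  have \<tau>\<sigma>: "\<tau> n = (zoom n)\<^sup>2 * \<sigma> n" for n using zoom_pos[of n] by (simp add: \<sigma>_def eps_def)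
  define R where "R n = (8 * rmass + B * eps n) / (l\<^sup>2 - 1) + eps n * (C_eta * (8 * rmass + B))" for n
  have bound: "eps n * ?G (\<tau> n) \<le> R n" for n
  proof -
    have "?U (\<tau> n) \<le> 8 * rmass + B"
      using B(2)[OF \<tau>_pos \<tau>_le, of n] mult_left_mono[OF \<tau>_le B(1), of n] by simp
    then have "C_eta * ?U (\<tau> n) \<le> C_eta * (8 * rmass + B)"
      by (rule mult_left_mono[OF _ C_eta_nonneg])
    then have "?G (\<tau> n) \<le> - energy' (\<tau> n) + C_eta * (8 * rmass + B)"
      using energy_derivative_upper[OF \<tau>_pos, of n] unfolding energy'_def by linarith
    then have "eps n * ?G (\<tau> n) \<le> eps n * (- energy' (\<tau> n) + C_eta * (8 * rmass + B))"
      using eps_pos[of n] by (intro mult_left_mono) auto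
    also have "\<dots> = eps n * (- energy' (\<tau> n)) + eps n * (C_eta * (8 * rmass + B))"
      by (rule distrib_left)
    also have "eps n * (- energy' (\<tau> n)) = ?Q (eps n) / (l\<^sup>2 - 1)"
      unfolding \<tau>(3) using l2_gt_1 by simp
    also have "\<dots> \<le> (8 * rmass + B * eps n) / (l\<^sup>2 - 1)"
      using psi_sq_le_K[OF eps_pos, of n] B(2)[OF eps_pos eps_le, of n] l2_gt_1
      by (intro divide_right_mono) auto
    finally show ?thesis by (simp add: R_def)
  qed
  have [measurable]: "hgrad f (\<sigma> n) \<in> borel_measurable borel" "hgrad f (\<tau> n) \<in> borel_measurable borel" for n
    by (intro hgrad_measurable \<sigma>_pos \<tau>_pos)+
  let ?h = "\<lambda>n y. ennreal (eta (zoom n *\<^sub>R y) * (norm (hgrad f (\<sigma> n) y))\<^sup>2)"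
  let ?hs = "\<lambda>n y. ennreal (eta (zoom n *\<^sub>R y) * (norm (hgrad f (\<tau> n) (zoom n *\<^sub>R y)))\<^sup>2)"
  have scaled: "(\<integral>\<^sup>+y. ?h n y \<partial>lborel) \<le> ennreal (R n)" for n
  proof -
    have "ennreal (eps n * ?G (\<tau> n)) =
        ennreal (eps n) * (\<integral>\<^sup>+x. ennreal (eta x * (norm (hgrad f (\<tau> n) x))\<^sup>2) \<partial>lborel)"
      using eps_pos[of n] by (simp only: ennreal_mult' local_dirichlet_eq[OF \<tau>_pos] less_imp_le)
    also have "\<dots> = ennreal (eps n) * (ennreal ((zoom n)\<^sup>2) * (\<integral>\<^sup>+y. ?hs n y \<partial>lborel))"
      by (subst nn_integral_plane_scale[OF zoom_pos[of n]]) simp_all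
    also have "\<dots> = (\<integral>\<^sup>+y. ennreal (eps n * (zoom n)\<^sup>2) * ?hs n y \<partial>lborel)"
      using eps_pos[of n] by (subst nn_integral_cmult) (simp_all add: ennreal_mult mult.assoc)
    also have "\<dots> = (\<integral>\<^sup>+y. ?h n y \<partial>lborel)"
    proof (rule nn_integral_cong)
      fix y
      have "hgrad f (\<tau> n) (zoom n *\<^sub>R y) = (1 / (zoom n)\<^sup>2) *\<^sub>R hgrad f (\<sigma> n) y"
        unfolding \<tau>\<sigma> zoom_def by (rule hgrad_dss)
      then have "(norm (hgrad f (\<tau> n) (zoom n *\<^sub>R y)))\<^sup>2 = (1 / (zoom n)\<^sup>2)\<^sup>2 * (norm (hgrad f (\<sigma> n) y))\<^sup>2"
        by (simp only: power2_norm_scaleR)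
      then show "ennreal (eps n * (zoom n)\<^sup>2) * ?hs n y =
          ?h n y"
        using zoom_pos[of n] eta_nonneg by (simp add: ennreal_mult[symmetric] eps_def power2_eq_square)
    qed
    finally show ?thesis using ennreal_leI[OF bound[of n]] by simp
  qed
  have R_lim: "R \<longlonglongrightarrow> 8 * rmass / (l\<^sup>2 - 1)"
  proof -
    have "R \<longlonglongrightarrow> (8 * rmass + B * 0) / (l\<^sup>2 - 1) + 0 * (C_eta * (8 * rmass + B))"
      unfolding R_def[abs_def] using l2_gt_1 by (intro tendsto_intros eps_lim) auto
    then show ?thesis by simp
  qed
  obtain s r where s: "s \<in> {1..l\<^sup>2}" and r: "strict_mono r" and lim: "(\<sigma> \<circ> r) \<longlonglongrightarrow> s"
    using seq_compactE[OF compact_imp_seq_compact[OF compact_Icc], of \<sigma> 1 "l\<^sup>2"] \<sigma> by blast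
  have s_pos: "s > 0" using s by simp
  have "dirichlet s = (\<integral>\<^sup>+y. liminf (\<lambda>n. ?h (r n) y) \<partial>lborel)"
    unfolding dirichlet_def
  proof (rule nn_integral_cong)
    fix y :: plane
    have "(\<lambda>n. zoom (r n) *\<^sub>R y) \<longlonglongrightarrow> 0 *\<^sub>R y"
      using LIMSEQ_subseq_LIMSEQ[OF zoom_lim r] by (intro tendsto_intros) (simp add: comp_def)
    then have "(\<lambda>n. eta (zoom (r n) *\<^sub>R y)) \<longlonglongrightarrow> eta (0 *\<^sub>R y)"
      by (rule isCont_tendsto_compose[rotated]) (use cutoff_cont in \<open>simp add: continuous_on_eq_continuous_at\<close>)
    moreover have "(\<lambda>n. hgrad f (snd (y, \<sigma> (r n))) (fst (y, \<sigma> (r n)))) \<longlonglongrightarrow> hgrad f (snd (y, s)) (fst (y, s))"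
    proof (rule isCont_tendsto_compose[of "(y, s)" "\<lambda>p. hgrad f (snd p) (fst p)"])
      have "open ((UNIV :: plane set) \<times> {0::real<..})" by (intro open_Times) auto
      then show "isCont (\<lambda>p. hgrad f (snd p) (fst p)) (y, s)"
        using continuous_on_hgrad s_pos by (auto simp: continuous_on_eq_continuous_at)
      show "(\<lambda>n. (y, \<sigma> (r n))) \<longlonglongrightarrow> (y, s)"
        using lim by (intro tendsto_intros) (simp add: comp_def)
    qed
    ultimately have "(\<lambda>n. eta (zoom (r n) *\<^sub>R y) * (norm (hgrad f (\<sigma> (r n)) y))\<^sup>2) \<longlonglongrightarrow> eta (0 *\<^sub>R y) * (norm (hgrad f s y))\<^sup>2"
      unfolding fst_conv snd_conv by (intro tendsto_intros)
    then have "(\<lambda>n. ?h (r n) y) \<longlonglongrightarrow> ennreal ((norm (hgrad f s y))\<^sup>2)"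
      by (intro tendsto_ennrealI) (simp add: eta_inside)
    then show "ennreal ((norm (hgrad f s y))\<^sup>2) = liminf (\<lambda>n. ?h (r n) y)"
      by (intro lim_imp_Liminf[symmetric]) auto
  qed
  also have "\<dots> \<le> liminf (\<lambda>n. \<integral>\<^sup>+y. ?h (r n) y \<partial>lborel)"
    by (rule nn_integral_liminf) measurable
  also have "\<dots> \<le> liminf (\<lambda>n. ennreal (R (r n)))"
    by (intro Liminf_mono always_eventually allI scaled)
  also have "\<dots> = ennreal (8 * rmass / (l\<^sup>2 - 1))"
    using LIMSEQ_subseq_LIMSEQ[OF R_lim r] by (intro lim_imp_Liminf tendsto_ennrealI) (auto simp: comp_def)
  finally have "dirichlet s \<le> ennreal (8 * rmass / (l\<^sup>2 - 1))" .
  moreover have "dirichlet (l\<^sup>2) \<le> dirichlet s"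
    unfolding dirichlet_def using s s_pos by (intro dirichlet_antimono) auto
  ultimately have "ennreal (l\<^sup>2) * dirichlet (l\<^sup>2) \<le> ennreal (l\<^sup>2) * ennreal (8 * rmass / (l\<^sup>2 - 1))"
    by (intro mult_left_mono) auto
  also have "\<dots> = ennreal (8 * l\<^sup>2 / (l\<^sup>2 - 1) * rmass)"
    by (subst ennreal_mult'[symmetric]) (simp_all add: mult_ac)
  finally show ?thesis using dirichlet_powi[of 1] by simp
qed

text \<open>The local Dirichlet energy at the intermediate time is at most the full one at the beginning of
the period, which scaling expresses through \<open>dirichlet 1\<close>. So the drop is at most
\<open>3 (l\<^sup>2 - 1) dirichlet 1\<close> plus a vanishing error, while in the limit it is at least \<open>rmass\<close>.\<close>

lemma dirichlet_lower: "rmass \<le> 3 * (l\<^sup>2 - 1) * enn2real (dirichlet 1)"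
proof -
  let ?Q = "\<lambda>n. LINT x|lborel. psi x * (hflow f (eps n) x)\<^sup>2"
  define D where "D = enn2real (dirichlet 1)"
  have D: "dirichlet 1 = ennreal D" "D \<ge> 0"
    using order.strict_trans1[OF dirichlet_upper ennreal_less_top] by (auto simp: D_def)
  obtain B where B: "B \<ge> 0"
    "\<And>t. 0 < t \<Longrightarrow> t \<le> 1 \<Longrightarrow> (LINT x|lborel. indicator K x * (hflow f t x)\<^sup>2) \<le> 8 * rmass + B * t"
    using hflow_L2_K by blast
  let ?e = "C_eta * (8 * rmass + B)"
  define L where "L n = (l\<^sup>2 - 1) * (3 * D + eps n * ?e)" for n
  have "(LINT x|lborel. psi x * (f x)\<^sup>2) \<le> (l\<^sup>2 - 1) * (3 * D + 0 * ?e)"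
  proof (rule flow_L2_lower_semicontinuous[OF psi_cont psi_supp psi_nonneg eps_pos eps_le eps_lim, where L = L])
    show "L \<longlonglongrightarrow> (l\<^sup>2 - 1) * (3 * D + 0 * ?e)"
      unfolding L_def[abs_def] by (intro tendsto_intros eps_lim)
    fix n
    obtain \<tau> where \<tau>: "eps n < \<tau>" "\<tau> < l\<^sup>2 * eps n"
      "?Q n = (l\<^sup>2 - 1) * eps n * (- energy' \<tau>)"
      using energy_mean_value[OF eps_pos] by blast
    have \<tau>_pos: "\<tau> > 0" and \<tau>_le: "\<tau> \<le> 1" using \<tau>(1,2) eps_pos[of n] l_eps_le[of n] by linarith+
    let ?U = "LINT x|lborel. indicator K x * (hflow f \<tau> x)\<^sup>2"
    define G where "G = (LINT x|lborel. eta x * (norm (hgrad f \<tau> x))\<^sup>2)"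
    have "ennreal (eps n * G) = ennreal (eps n) * (\<integral>\<^sup>+x. ennreal (eta x * (norm (hgrad f \<tau> x))\<^sup>2) \<partial>lborel)"
      unfolding G_def using eps_pos[of n] by (simp only: ennreal_mult' local_dirichlet_eq[OF \<tau>_pos] less_imp_le)
    also have "\<dots> \<le> ennreal (eps n) * dirichlet \<tau>"
      unfolding dirichlet_def using eta_le_1
      by (intro mult_left_mono nn_integral_mono ennreal_leI) (auto intro: mult_left_le_one_le eta_nonneg)
    also have "\<dots> \<le> ennreal (eps n) * dirichlet (eps n)"
      unfolding dirichlet_def using \<tau> eps_pos[of n] by (intro mult_left_mono dirichlet_antimono) auto
    also have "\<dots> = ennreal D"
      using dirichlet_powi[of "- int (Suc n)"] by (simp only: eps_def zoom_def D)
    finally have G: "eps n * G \<le> D" using D(2) by (simp add: ennreal_le_iff)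
    have "?U \<le> 8 * rmass + B"
      using B(2)[OF \<tau>_pos \<tau>_le] mult_left_mono[OF \<tau>_le B(1)] by simp
    then have "C_eta * ?U \<le> ?e"
      by (rule mult_left_mono[OF _ C_eta_nonneg])
    then have "- energy' \<tau> \<le> 3 * G + ?e"
      using energy_derivative_lower[OF \<tau>_pos] unfolding energy'_def G_def by linarith
    then have "eps n * (- energy' \<tau>) \<le> eps n * (3 * G + ?e)"
      using eps_pos[of n] by (intro mult_left_mono) auto
    also have "\<dots> = 3 * (eps n * G) + eps n * ?e" by (simp add: algebra_simps)
    also have "\<dots> \<le> 3 * D + eps n * ?e" using G by simp
    finally have "(l\<^sup>2 - 1) * (eps n * (- energy' \<tau>)) \<le> L n"
      unfolding L_def using l2_gt_1 by (intro mult_left_mono) auto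
    then show "?Q n \<le> L n"
      unfolding \<tau>(3) by (simp add: mult.assoc)
  qed
  then show ?thesis by (simp add: integral_psi_sq D_def algebra_simps)
qed

end

section \<open>Borel representatives and the two-sided estimate\<close>

lemma AE_lborel_scale:
  fixes P :: "'a::euclidean_space \<Rightarrow> bool"
  assumes c: "c \<noteq> 0" and P: "AE x in lborel. P x"
  shows "AE x in lborel. P (c *\<^sub>R x)"
proof -
  obtain N where N: "{x \<in> space lborel. \<not> P x} \<subseteq> N" "emeasure lborel N = 0" "N \<in> sets lborel"
    by (rule AE_E[OF P])
  have [measurable]: "N \<in> sets borel" using N(3) by simp
  have "emeasure lborel N = ennreal (\<bar>c\<bar> ^ DIM('a)) * (\<integral>\<^sup>+x. indicator N (0 + c *\<^sub>R x) \<partial>lborel)"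
    using nn_integral_lborel_affine[of "indicator N" c 0] c by simp
  then have "(\<integral>\<^sup>+x. indicator N (c *\<^sub>R x) \<partial>lborel) = (0::ennreal)"
    using N(2) c by simp
  then have "AE x in lborel. indicator N (c *\<^sub>R x) = (0::ennreal)"
    by (subst (asm) nn_integral_0_iff_AE) auto
  then show ?thesis
  proof eventually_elim
    case (elim x)
    then have "c *\<^sub>R x \<notin> N" by (simp add: indicator_def split: if_splits)
    then show "P (c *\<^sub>R x)" using N(1) by auto
  qed
qed

text \<open>Exact self-similarity is kept by choosing a Borel version on the annulus only and extending it
by scaling: \<open>c x\<close> is the power of \<open>l\<close> that moves \<open>x\<close> into the annulus. The two functions differ
at most on countably many scaled copies of a null set and at the origin.\<close>

lemma dss_borel_representative:
  assumes l: "l > 1" and f: "dss l f" and L2: "in_L2 (annulus l) f"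
  obtains g where "dss_L2 l g" "AE x in lebesgue. f x = g x"
proof -
  have lp: "l > 0" using l by simp
  have f_scale: "f ((l powi k) *\<^sub>R x) = f x / (l powi k)" if "x \<noteq> 0" for k x
    using dss_powi[OF lp _ that, of f k] f by (simp add: dss_def divide_inverse mult.commute)
  have "(\<lambda>x. indicator (annulus l) x *\<^sub>R f x) \<in> borel_measurable lebesgue"
    using L2 by (simp add: in_L2_def set_borel_measurable_def)
  then obtain g0 where g0[measurable]: "g0 \<in> borel_measurable borel"
    and AE_g0: "AE x in lborel. indicator (annulus l) x *\<^sub>R f x = g0 x"
    using completion_ex_borel_measurable_real[of _ lborel] by auto
  define c where "c x = l powr (- of_int \<lfloor>log l (norm x)\<rfloor>)" for x :: plane
  have c_powi: "c x = l powi (- \<lfloor>log l (norm x)\<rfloor>)" for x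
    using powr_real_of_int'[of l "- \<lfloor>log l (norm x)\<rfloor>"] lp by (simp add: c_def)
  have [measurable]: "c \<in> borel_measurable borel" unfolding c_def[abs_def] by measurable
  define g where "g x = c x * g0 (c x *\<^sub>R x)" for x
  have g_meas[measurable]: "g \<in> borel_measurable borel" unfolding g_def[abs_def] by measurable
  let ?h = "\<lambda>x. indicator (annulus l) x * (g x)\<^sup>2"
  have g_dss: "g (l *\<^sub>R x) = g x / l" if x: "x \<noteq> 0" for x
  proof -
    have "log l (norm (l *\<^sub>R x)) = 1 + log l (norm x)"
      using x l by (simp add: log_mult)
    then have "c (l *\<^sub>R x) = l powr (- 1 - of_int \<lfloor>log l (norm x)\<rfloor>)"
      by (simp add: c_def)
    also have "\<dots> = c x / l" using lp by (simp add: c_def powr_diff powr_minus field_simps)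
    finally show ?thesis using lp by (simp add: g_def)
  qed
  have "AE x in lborel. \<forall>k::int. indicator (annulus l) ((l powi k) *\<^sub>R x) *\<^sub>R f ((l powi k) *\<^sub>R x) = g0 ((l powi k) *\<^sub>R x)"
    unfolding AE_all_countable using lp by (intro allI AE_lborel_scale[OF _ AE_g0]) simp
  then have AE_lb: "AE x in lborel. f x = g x"
    using AE_lborel_singleton[of "0::plane"]
  proof eventually_elim
    case (elim x)
    let ?k = "\<lfloor>log l (norm x)\<rfloor>"
    have "l powr (of_int ?k) \<le> l powr (log l (norm x))" "l powr (log l (norm x)) < l powr (of_int ?k + 1)"
      using l by (auto intro!: powr_mono powr_less_mono)
    moreover have "l powr (log l (norm x)) = norm x" using elim(2) l by simp
    ultimately have "1 \<le> c x * norm x" "c x * norm x < l"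
      using lp by (simp_all add: c_def powr_minus powr_add field_simps)
    then have "c x *\<^sub>R x \<in> annulus l" using lp by (simp add: annulus_def c_def)
    then have "f (c x *\<^sub>R x) = g0 (c x *\<^sub>R x)"
      using spec[OF elim(1), of "- ?k"] by (simp add: c_powi)
    moreover have "f (c x *\<^sub>R x) = f x / c x" unfolding c_powi by (rule f_scale[OF elim(2)])
    ultimately show "f x = g x" using lp by (simp add: g_def c_def field_simps)
  qed
  then have AE_leb: "AE x in lebesgue. f x = g x" by (simp add: AE_completion_iff)
  have [measurable]: "annulus l \<in> sets borel" unfolding annulus_def by measurable
  have "integrable lebesgue (\<lambda>x. indicator (annulus l) x *\<^sub>R (norm (f x))\<^sup>2)"
    using L2 by (simp add: in_L2_def set_integrable_def)
  moreover have m: "(\<lambda>x. ?h x) \<in> borel_measurable lborel" by measurable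
  moreover have "AE x in lebesgue. indicator (annulus l) x *\<^sub>R (norm (f x))\<^sup>2 = ?h x"
    using AE_leb by eventually_elim simp
  ultimately have "integrable lebesgue (\<lambda>x. ?h x)"
    using integrable_cong_AE_imp[OF _ measurable_completion[OF m]] by auto
  then have "integrable lborel (\<lambda>x. ?h x)"
    using integrable_completion[OF m] by simp
  with l g_dss have "dss_L2 l g" by unfold_locales auto
  with AE_leb that show ?thesis by blast
qed

lemma heat_kernel_eq: "heat_kernel = hk 1"
  by (simp add: heat_kernel_def hk_def fun_eq_iff)

lemma gradient_eqI: "(g has_derivative (\<lambda>h. D \<bullet> h)) (at x) \<Longrightarrow> gradient g x = D"
  unfolding gradient_def gderiv_def
proof (rule the_equality)
  assume D: "(g has_derivative (\<lambda>h. D \<bullet> h)) (at x)"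
  then show "(g has_derivative (\<lambda>h. h \<bullet> D)) (at x)" by (simp add: inner_commute)
  fix E assume "(g has_derivative (\<lambda>h. h \<bullet> E)) (at x)"
  from has_derivative_unique[OF this D] have "h \<bullet> E = D \<bullet> h" for h by (rule fun_cong)
  from this[of "E - D"] have "(E - D) \<bullet> (E - D) = 0"
    by (simp add: inner_diff_right inner_commute)
  then show "E = D" by simp
qed

context dss_L2 begin

lemma
  fixes f' :: "plane \<Rightarrow> real"
  assumes AE: "AE x in lebesgue. f' x = f x"
  shows integrable_heat_kernel_times: "integrable lebesgue (\<lambda>z. heat_kernel (x - z) * f' z)"
    and heat_eq_hflow: "heat f' = hflow f 1"
    and L2_norm_annulus: "L2_norm_on (annulus l) f' = sqrt rmass"
proof -
  have f_leb: "f \<in> borel_measurable lebesgue" by (intro measurable_completion) simp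
  have "AE x in lebesgue. f x = f' x" using AE by eventually_elim simp
  from borel_measurable_AE[OF f_leb this] have [measurable]: "f' \<in> borel_measurable lebesgue" .
  note [measurable] = f_leb
  have hk_leb [measurable]: "(\<lambda>z. hk 1 (x - z)) \<in> borel_measurable lebesgue" for x
    by (intro measurable_completion) simp
  have i: "integrable lebesgue (\<lambda>z. f z * hk 1 (x - z))" for x
    using integrable_hk_times[of 1 x] by (subst integrable_completion) auto
  have ae: "AE z in lebesgue. f z * hk 1 (x - z) = heat_kernel (x - z) * f' z" for x
    using AE by eventually_elim (simp add: heat_kernel_eq)
  have m: "(\<lambda>z. heat_kernel (x - z) * f' z) \<in> borel_measurable lebesgue" for x
    unfolding heat_kernel_eq by measurable
  show "integrable lebesgue (\<lambda>z. heat_kernel (x - z) * f' z)"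
    by (rule integrable_cong_AE_imp[OF i m ae])
  have "heat f' x = hflow f 1 x" for x
  proof -
    have "heat f' x = (LINT z|lebesgue. f z * hk 1 (x - z))"
      unfolding heat_def by (rule integral_cong_AE[OF _ m ae, symmetric]) measurable
    also have "\<dots> = hflow f 1 x" unfolding hflow_def by (rule integral_completion) simp
    finally show ?thesis .
  qed
  then show "heat f' = hflow f 1" by (rule ext)
  have [measurable]: "annulus l \<in> sets lebesgue" by (simp add: annulus_def)
  have "(LINT x:annulus l|lebesgue. (norm (f' x))\<^sup>2) = (LINT x|lebesgue. indicator (annulus l) x * (f x)\<^sup>2)"
    unfolding set_lebesgue_integral_def
  proof (rule integral_cong_AE)
    show "AE x in lebesgue. indicator (annulus l) x *\<^sub>R (norm (f' x))\<^sup>2 = indicator (annulus l) x * (f x)\<^sup>2"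
      using AE by eventually_elim simp
  qed measurable
  also have "\<dots> = rmass"
    unfolding rmass_def using borel_measurable_integrable[OF f_L2] by (rule integral_completion)
  finally show "L2_norm_on (annulus l) f' = sqrt rmass" by (simp add: L2_norm_on_def)
qed

lemma in_L2_hgrad: "in_L2 UNIV (hgrad f 1)"
  and L2_norm_hgrad: "L2_norm_on UNIV (hgrad f 1) = sqrt (enn2real (dirichlet 1))"
proof -
  have m [measurable]: "hgrad f 1 \<in> borel_measurable borel" by (intro hgrad_measurable) simp
  have i: "integrable lborel (\<lambda>x. (norm (hgrad f 1 x))\<^sup>2)"
    using order.strict_trans1[OF dirichlet_upper ennreal_less_top]
    by (intro integrableI_bounded) (auto simp: dirichlet_def)
  have "(\<lambda>x. indicator UNIV x *\<^sub>R hgrad f 1 x) \<in> borel_measurable lebesgue"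
    by (intro measurable_completion) simp
  moreover have "integrable lebesgue (\<lambda>x. indicator UNIV x *\<^sub>R (norm (hgrad f 1 x))\<^sup>2)"
    using i by (subst integrable_completion) auto
  ultimately show "in_L2 UNIV (hgrad f 1)"
    by (simp add: in_L2_def set_borel_measurable_def set_integrable_def)
  have "(LINT x:UNIV|lebesgue. (norm (hgrad f 1 x))\<^sup>2) = (LINT x|lborel. (norm (hgrad f 1 x))\<^sup>2)"
    unfolding set_lebesgue_integral_def by (subst integral_completion) auto
  also have "\<dots> = enn2real (dirichlet 1)"
    unfolding dirichlet_def by (rule integral_eq_nn_integral) auto
  finally show "L2_norm_on UNIV (hgrad f 1) = sqrt (enn2real (dirichlet 1))"
    by (simp add: L2_norm_on_def)
qed

end

theorem lemma2p1:
  fixes l :: real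
  assumes "l > 1"
  shows "\<exists>C>0. \<forall>f :: real^2 \<Rightarrow> real.
    dss l f \<longrightarrow> in_L2 (annulus l) f \<longrightarrow>
      (\<forall>x. integrable lebesgue (\<lambda>z. heat_kernel (x - z) * f z)) \<and>
      (\<forall>x. heat f differentiable (at x)) \<and>
      in_L2 UNIV (gradient (heat f)) \<and>
      1 / C * L2_norm_on (annulus l) f \<le> L2_norm_on UNIV (gradient (heat f)) \<and>
      L2_norm_on UNIV (gradient (heat f)) \<le> C * L2_norm_on (annulus l) f"
proof -
  define a b where "a = 3 * (l\<^sup>2 - 1)" and "b = 8 * l\<^sup>2 / (l\<^sup>2 - 1)"
  have "l\<^sup>2 > 1" using assms by simp
  then have a: "a > 0" and b: "b \<ge> 0" by (simp_all add: a_def b_def)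
  define C where "C = sqrt a + sqrt b"
  have C: "C > 0" "sqrt a \<le> C" "sqrt b \<le> C"
    using a b by (auto simp: C_def add_pos_nonneg)
  show ?thesis
  proof (intro exI[of _ C] conjI C(1) allI impI)
    fix f :: "real^2 \<Rightarrow> real"
    assume "dss l f" "in_L2 (annulus l) f"
    then obtain g where "dss_L2 l g" and AE: "AE x in lebesgue. f x = g x"
      using dss_borel_representative[OF assms] by blast
    interpret dss_L2 l g by fact
    note heat = heat_eq_hflow[OF AE] and norm_f = L2_norm_annulus[OF AE]
    have deriv: "(hflow g 1 has_derivative (\<lambda>h. hgrad g 1 x \<bullet> h)) (at x)" for x
      by (rule hflow_has_derivative_space) simp
    have grad: "gradient (heat f) = hgrad g 1"
      unfolding heat by (rule ext, rule gradient_eqI, rule deriv)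
    show "integrable lebesgue (\<lambda>z. heat_kernel (x - z) * f z)" for x
      by (rule integrable_heat_kernel_times[OF AE])
    show "heat f differentiable (at x)" for x
      unfolding heat using deriv by (rule differentiableI)
    show "in_L2 UNIV (gradient (heat f))"
      unfolding grad by (rule in_L2_hgrad)
    define D where "D = enn2real (dirichlet 1)"
    have lower: "rmass \<le> a * D" using dirichlet_lower by (simp add: a_def D_def)
    have upper: "D \<le> b * rmass"
    proof -
      have "D \<le> enn2real (ennreal (b * rmass))"
        unfolding D_def b_def by (rule enn2real_mono[OF dirichlet_upper]) simp
      then show ?thesis using b rmass_nonneg by simp
    qed
    have norm_grad: "L2_norm_on UNIV (gradient (heat f)) = sqrt D"
      unfolding grad D_def by (rule L2_norm_hgrad)
    have "sqrt rmass \<le> sqrt a * sqrt D"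
      using real_sqrt_le_mono[OF lower] by (simp add: real_sqrt_mult)
    also have "\<dots> \<le> C * sqrt D" by (intro mult_right_mono C) (simp add: D_def)
    finally show "1 / C * L2_norm_on (annulus l) f \<le> L2_norm_on UNIV (gradient (heat f))"
      using C(1) by (simp add: norm_f norm_grad divide_le_eq mult.commute)
    have "sqrt D \<le> sqrt b * sqrt rmass"
      using real_sqrt_le_mono[OF upper] by (simp add: real_sqrt_mult)
    also have "\<dots> \<le> C * sqrt rmass" by (intro mult_right_mono C) (simp add: rmass_nonneg)
    finally show "L2_norm_on UNIV (gradient (heat f)) \<le> C * L2_norm_on (annulus l) f"
      by (simp add: norm_f norm_grad)
  qed
qed

end
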